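(* Let $a,b\ge 1$ be integers, and for integers $c,d\ge 0$ let $P_{(c,d)}=P_{+^c-^d}$ denote the segregated $\mathfrak{sl}(3)$ clasp of weight $(c,d)$. Put $Q=P_{(a,b-1)}\otimes \mathrm{id}_-\in\mathrm{Hom}(+^a-^b,+^a-^b)$. Then $$P_{(a,b)}=Q+\frac{[b-1]}{[b]}\;Q\circ\big(\mathrm{id}_{+^a-^{b-2}}\otimes H^{-}\big)\circ Q-\frac{[a]}{[b][a+b+1]}\;Q\circ\big(\mathrm{id}_{+^{a-1}}\otimes X_b\big)\circ Q ,$$ where $H^-\in\mathrm{Hom}(--,--)$ and $X_b\in\mathrm{Hom}(+-^b,+-^b)$ are the webs described in the context (the second term is absent for $b=1$).
   Context: Ground field $K=\mathbb{C}(q^{1/2})$; $[n]=\frac{q^{n/2}-q^{-n/2}}{q^{1/2}-q^{-1/2}}$. Webs. An $\mathfrak{sl}(3)$ web in a rectangle is a planar oriented graph (possibly with closed oriented loops without vertices), up to isotopy, all of whose interior vertices are trivalent and are either sources or sinks, and whose univalent vertices lie on the bottom and top sides of the rectangle. For words $s,t$ in the letters $+,-$, $\mathrm{Hom}(s,t)$ is the $K$-vector space spanned by webs whose bottom endpoints read $s$ and whose top endpoints read $t$ (left to right), where $+$ means that the strand there is oriented upward and $-$ downward, modulo the local relations: (1) a closed loop (either orientation) may be removed with factor $[3]$; (2) a bigon (two parallel edges between two vertices, with one outer leg at each vertex) equals $-[2]$ times the single oriented strand; (3) a square face with its four outer legs equals the sum of the two planar, orientation-compatible ways of joining the four legs by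 two disjoint arcs. Composition $w\circ v$ stacks $w$ on top of $v$; $\otimes$ is horizontal juxtaposition; $\mathrm{id}_s$ is the web of vertical strands. Clasps. The weight of a word with $a$ letters $+$ and $b$ letters $-$ is $(a,b)$, meaning $a\lambda_1+b\lambda_2$. The partial order on weights is generated by $(a,b)\succ(a+1,b-2)$ and $(a,b)\succ(a-2,b+1)$. The clasp $P_s\in\mathrm{Hom}(s,s)$ is the unique nonzero idempotent such that $w\circ P_s=0$ for all $w\in\mathrm{Hom}(s,t)$ and $P_s\circ w'=0$ for all $w'\in\mathrm{Hom}(t,s)$ whenever the weight of $t$ is strictly less than that of $s$. Webs in the formula. $H^-$ has one sink joined to the two top endpoints, one source joined to the two bottom endpoints, and an edge oriented from the source to the sink. A transverse crossing of two oriented arcs is resolved by joining the two incoming half-edges at a new sink, the two outgoing half-edges at a new source, and adding an edge oriented from the source to the sink. To define $X_b$, draw vertical strands $v_1,\dots,v_{b-1}$ (left to right) oriented downward; an oriented arc $\alpha$ starting at the last (rightmost) top endpoint, going down and then to the left crossing $v_{b-1},\dots,v_1$ once each, and then up to the first (leftmost) top endpoint; and an oriented arc $\beta$, lying below $\alpha$ and disjoint from it, starting at the first (leftmost) bottom endpoint, going up and then to the right crossing $v_1,\dots,v_{b-1}$ once each, and then down to the last (rightmost) bottom endpoint. $X_b$ is obtained by resolving all $2(b-1)$ crossings. (It is the maximal cut-out of the hexagonal tiling with the given boundary; for $b=1$ it is a cup above a cap.) *)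

theory Defs
  imports
    Complex_Main
    "HOL-Library.Poly_Mapping"
    "HOL-Computational_Algebra.Polynomial"
    "HOL-Computational_Algebra.Fraction_Field"
begin

section \<open>The ground field\<close>

text \<open>Rational functions over the complex numbers; the variable is the square root of \<open>q\<close>.\<close>

type_synonym K = "complex poly fract"

definition q_half :: K
  where "q_half = Fract [:0, 1:] 1"

definition qint :: "nat \<Rightarrow> K"
  where "qint n = (q_half ^ n - inverse q_half ^ n) / (q_half - inverse q_half)"


section \<open>Webs\<close>

text \<open>
  A planar graph in a rectangle is described, up to isotopy, by a generic (Morse) position: it is
  cut by horizontal lines into slices, each of which has one elementary piece and otherwise
  vertical strands. A letter \<open>Pos\<close> (the letter $+$) stands for a strand that is oriented upward
  at the level in question, and \<open>Neg\<close> (the letter $-$) for one that is oriented downward.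
\<close>

datatype sgn = Pos | Neg

fun opp :: "sgn \<Rightarrow> sgn"
  where
    "opp Pos = Neg"
  | "opp Neg = Pos"

type_synonym sword = "sgn list"

text \<open>
  Every trivalent vertex can be put in a position where it has two legs below and one above
  (\<open>Merge\<close>) or one below and two above (\<open>Split\<close>). All three edges point into the vertex
  of \<open>Merge Pos\<close> and of \<open>Split Pos\<close> (sinks), and out of the vertex of \<open>Merge Neg\<close>
  and of \<open>Split Neg\<close> (sources).
\<close>

datatype piece = Cup sgn | Cap sgn | Merge sgn | Split sgn

fun piece_bot :: "piece \<Rightarrow> sword"
  where
    "piece_bot (Cup x) = []"
  | "piece_bot (Cap x) = [x, opp x]"
  | "piece_bot (Merge x) = [x, x]"
  | "piece_bot (Split x) = [x]"

fun piece_top :: "piece \<Rightarrow> sword"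
  where
    "piece_top (Cup x) = [x, opp x]"
  | "piece_top (Cap x) = []"
  | "piece_top (Merge x) = [opp x]"
  | "piece_top (Split x) = [opp x, opp x]"

text \<open>A slice: vertical strands on the left, the piece, vertical strands on the right.\<close>

type_synonym slice = "sword \<times> piece \<times> sword"

text \<open>A diagram: bottom word, slices from bottom to top, top word.\<close>

type_synonym diagram = "sword \<times> slice list \<times> sword"

fun is_diagram :: "sword \<Rightarrow> slice list \<Rightarrow> sword \<Rightarrow> bool"
  where
    "is_diagram s [] t \<longleftrightarrow> s = t"
  | "is_diagram s ((l, p, r) # ds) t \<longleftrightarrow> s = l @ piece_bot p @ r \<and> is_diagram (l @ piece_top p @ r) ds t"

text \<open>
  Planar isotopy (fixing the order of the endpoints) changes a generic position by these moves:
  two pieces that are next to each other exchange their heights; a zigzag of a strand is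
  straightened; a leg of a trivalent vertex is bent from below to above, around the right or
  around the left side. The vertices carry no distinguished leg, so the bent vertex is again
  the standard one.
\<close>

inductive isotopy_move :: "slice list \<Rightarrow> slice list \<Rightarrow> bool"
  where
    exchange: "isotopy_move
      [(l, p, m @ piece_bot p' @ r), (l @ piece_top p @ m, p', r)]
      [(l @ piece_bot p @ m, p', r), (l, p, m @ piece_top p' @ r)]"
  | zigzag_right: "isotopy_move [(l @ [x], Cup (opp x), r), (l, Cap x, x # r)] []"
  | zigzag_left: "isotopy_move [(l, Cup x, x # r), (l @ [x], Cap (opp x), r)] []"
  | bend_right: "isotopy_move [(l @ [x], Cup x, r), (l, Merge x, opp x # r)] [(l, Split x, r)]"
  | bend_left: "isotopy_move [(l, Cup (opp x), x # r), (l @ [opp x], Merge x, r)] [(l, Split x, r)]"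

inductive isotopic :: "diagram \<Rightarrow> diagram \<Rightarrow> bool"
  where
    refl: "is_diagram s ds t \<Longrightarrow> isotopic (s, ds, t) (s, ds, t)"
  | move: "isotopy_move ds ds' \<Longrightarrow> is_diagram s (us @ ds @ vs) t \<Longrightarrow> is_diagram s (us @ ds' @ vs) t
      \<Longrightarrow> isotopic (s, us @ ds @ vs, t) (s, us @ ds' @ vs, t)"
  | sym: "isotopic d d' \<Longrightarrow> isotopic d' d"
  | trans: "isotopic d d' \<Longrightarrow> isotopic d' d'' \<Longrightarrow> isotopic d d''"

quotient_type web = diagram / partial: isotopic
proof (rule part_equivpI)
  show "\<exists>d. isotopic d d"
    by (rule exI[of _ "([], [], [])"]) (simp add: isotopic.refl)
  show "symp isotopic"
    by (auto intro: sympI isotopic.sym)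
  show "transp isotopic"
    by (auto intro: transpI isotopic.trans)
qed

lemma isotopicD:
  assumes "isotopic d d'"
  shows "fst d = fst d' \<and> snd (snd d) = snd (snd d') \<and>
    is_diagram (fst d) (fst (snd d)) (snd (snd d)) \<and>
    is_diagram (fst d') (fst (snd d')) (snd (snd d'))"
  using assms by induction auto

lemma is_diagram_append:
  "is_diagram s (ds @ es) t \<longleftrightarrow> (\<exists>r. is_diagram s ds r \<and> is_diagram r es t)"
  by (induction ds arbitrary: s) auto

lift_definition web_bot :: "web \<Rightarrow> sword" is "\<lambda>(s, ds, t). s"
  using isotopicD by fastforce

lift_definition web_top :: "web \<Rightarrow> sword" is "\<lambda>(s, ds, t). t"
  using isotopicD by fastforce

lift_definition id_web :: "sword \<Rightarrow> web" is "\<lambda>s. (s, [], s)"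
  by (simp add: isotopic.refl)

lift_definition piece_web :: "piece \<Rightarrow> web" is "\<lambda>p. (piece_bot p, [([], p, [])], piece_top p)"
  by (simp add: isotopic.refl)

lemma isotopic_under:
  assumes "isotopic d d'" "is_diagram (snd (snd d)) es u"
  shows "isotopic (fst d, fst (snd d) @ es, u) (fst d', fst (snd d') @ es, u)"
  using assms
proof (induction)
  case (refl s ds t)
  then show ?case by (auto intro!: isotopic.refl simp: is_diagram_append)
next
  case (move ds ds' s us vs t)
  have "isotopic (s, us @ ds @ (vs @ es), u) (s, us @ ds' @ (vs @ es), u)"
    using move by (intro isotopic.move) (auto simp: is_diagram_append)
  then show ?case by simp
next
  case (sym d d')
  show ?case
    by (rule isotopic.sym, rule sym.IH) (use isotopicD[OF sym.hyps] sym.prems in simp)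
next
  case (trans d d' d'')
  show ?case
    by (rule isotopic.trans[OF trans.IH(1) trans.IH(2)])
      (use isotopicD[OF trans.hyps(1)] trans.prems in simp_all)
qed

lemma isotopic_above:
  assumes "isotopic d d'" "is_diagram u es (fst d)"
  shows "isotopic (u, es @ fst (snd d), snd (snd d)) (u, es @ fst (snd d'), snd (snd d'))"
  using assms
proof (induction)
  case (refl s ds t)
  then show ?case by (auto intro!: isotopic.refl simp: is_diagram_append)
next
  case (move ds ds' s us vs t)
  have "isotopic (u, (es @ us) @ ds @ vs, t) (u, (es @ us) @ ds' @ vs, t)"
    using move by (intro isotopic.move) (auto simp: is_diagram_append)
  then show ?case by simp
next
  case (sym d d')
  show ?case
    by (rule isotopic.sym, rule sym.IH) (use isotopicD[OF sym.hyps] sym.prems in simp)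
next
  case (trans d d' d'')
  show ?case
    by (rule isotopic.trans[OF trans.IH(1) trans.IH(2)])
      (use isotopicD[OF trans.hyps(1)] trans.prems in simp_all)
qed

text \<open>
  \<open>stack w v\<close> is \<open>w\<close> on top of \<open>v\<close>; it is a junk value (the empty web) if the words do
  not match. On linear combinations, pairs that do not match contribute zero.
\<close>

lift_definition stack :: "web \<Rightarrow> web \<Rightarrow> web" is
  "\<lambda>(s', ds', t') (s, ds, t). if t = s' then (s, ds @ ds', t') else ([], [], [])"
proof -
  fix w w' v v' :: diagram
  assume w: "isotopic w w'" and v: "isotopic v v'"
  obtain s1 d1 t1 s2 d2 t2 s3 d3 t3 s4 d4 t4
    where e: "w = (s1, d1, t1)" "w' = (s2, d2, t2)" "v = (s3, d3, t3)" "v' = (s4, d4, t4)"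
    by (metis prod.exhaust)
  have ends: "s1 = s2" "t1 = t2" "s3 = s4" "t3 = t4"
    and dia: "is_diagram s1 d1 t1" "is_diagram s4 d4 t4"
    using isotopicD[OF w] isotopicD[OF v] by (auto simp: e)
  show "isotopic
     ((case w of (s', ds', t') \<Rightarrow> \<lambda>(s, ds, t). if t = s' then (s, ds @ ds', t') else ([], [], [])) v)
     ((case w' of (s', ds', t') \<Rightarrow> \<lambda>(s, ds, t). if t = s' then (s, ds @ ds', t') else ([], [], [])) v')"
  proof (cases "t3 = s1")
    case True
    have "isotopic (s3, d3 @ d1, t1) (s4, d4 @ d1, t1)"
      using isotopic_under[OF v, of d1 t1] dia True by (simp add: e)
    moreover have "isotopic (s4, d4 @ d1, t1) (s4, d4 @ d2, t2)"
      using isotopic_above[OF w, of s4 d4] dia True ends by (simp add: e)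
    ultimately show ?thesis
      using True ends isotopic.trans by (simp add: e)
  next
    case False
    then show ?thesis using ends by (simp add: e isotopic.refl)
  qed
qed

definition widen :: "sword \<Rightarrow> sword \<Rightarrow> slice list \<Rightarrow> slice list"
  where "widen u v = map (\<lambda>(l, p, r). (u @ l, p, r @ v))"

lemma widen_append: "widen u v (ds @ es) = widen u v ds @ widen u v es"
  by (simp add: widen_def)

lemma is_diagram_widen: "is_diagram s ds t \<Longrightarrow> is_diagram (u @ s @ v) (widen u v ds) (u @ t @ v)"
  by (induction s ds t rule: is_diagram.induct) (auto simp: widen_def)

lemma isotopy_move_widen: "isotopy_move ds ds' \<Longrightarrow> isotopy_move (widen u v ds) (widen u v ds')"
proof (induction rule: isotopy_move.induct)
  case (exchange l p m p' r)
  show ?case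
    using isotopy_move.exchange[of "u @ l" p m p' "r @ v"] by (simp add: widen_def)
next
  case (zigzag_right l x r)
  show ?case
    using isotopy_move.zigzag_right[of "u @ l" x "r @ v"] by (simp add: widen_def)
next
  case (zigzag_left l x r)
  show ?case
    using isotopy_move.zigzag_left[of "u @ l" x "r @ v"] by (simp add: widen_def)
next
  case (bend_right l x r)
  show ?case
    using isotopy_move.bend_right[of "u @ l" x "r @ v"] by (simp add: widen_def)
next
  case (bend_left l x r)
  show ?case
    using isotopy_move.bend_left[of "u @ l" x "r @ v"] by (simp add: widen_def)
qed

lemma isotopic_widen:
  assumes "isotopic d d'"
  shows "isotopic (u @ fst d @ v, widen u v (fst (snd d)), u @ snd (snd d) @ v)
    (u @ fst d' @ v, widen u v (fst (snd d')), u @ snd (snd d') @ v)"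
  using assms
proof (induction)
  case (refl s ds t)
  then show ?case by (auto intro!: isotopic.refl is_diagram_widen)
next
  case (move ds ds' s us vs t)
  then show ?case
    using isotopic.move[OF isotopy_move_widen[OF move.hyps(1), of u v],
        of "u @ s @ v" "widen u v us" "widen u v vs" "u @ t @ v"]
      is_diagram_widen[OF move.hyps(2), of u v] is_diagram_widen[OF move.hyps(3), of u v]
    by (simp add: widen_append)
next
  case (sym d d')
  then show ?case using isotopic.sym by blast
next
  case (trans d d' d'')
  then show ?case using isotopic.trans by blast
qed

text \<open>Horizontal juxtaposition, drawn with the pieces of the left factor below those of the right one.\<close>

lift_definition juxt :: "web \<Rightarrow> web \<Rightarrow> web" is
  "\<lambda>(s, ds, t) (s', ds', t'). (s @ s', widen [] s' ds @ widen t [] ds', t @ t')"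
proof -
  fix w w' v v' :: diagram
  assume w: "isotopic w w'" and v: "isotopic v v'"
  obtain s1 d1 t1 s2 d2 t2 s3 d3 t3 s4 d4 t4
    where e: "w = (s1, d1, t1)" "w' = (s2, d2, t2)" "v = (s3, d3, t3)" "v' = (s4, d4, t4)"
    by (metis prod.exhaust)
  have ends: "s1 = s2" "t1 = t2" "s3 = s4" "t3 = t4"
    and dia: "is_diagram s2 d2 t2" "is_diagram s3 d3 t3"
    using isotopicD[OF w] isotopicD[OF v] by (auto simp: e)
  have "isotopic (s1 @ s3, widen [] s3 d1, t1 @ s3) (s2 @ s3, widen [] s3 d2, t2 @ s3)"
    using isotopic_widen[OF w, of "[]" s3] by (simp add: e)
  from isotopic_under[OF this, of "widen t1 [] d3" "t1 @ t3"]
  have 1: "isotopic (s1 @ s3, widen [] s3 d1 @ widen t1 [] d3, t1 @ t3)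
      (s2 @ s3, widen [] s3 d2 @ widen t1 [] d3, t1 @ t3)"
    using is_diagram_widen[OF dia(2), of t1 "[]"] by simp
  have "isotopic (t1 @ s3, widen t1 [] d3, t1 @ t3) (t1 @ s4, widen t1 [] d4, t1 @ t4)"
    using isotopic_widen[OF v, of t1 "[]"] by (simp add: e)
  from isotopic_above[OF this, of "s2 @ s3" "widen [] s3 d2"]
  have 2: "isotopic (s2 @ s3, widen [] s3 d2 @ widen t1 [] d3, t1 @ t3)
      (s2 @ s3, widen [] s3 d2 @ widen t1 [] d4, t1 @ t4)"
    using is_diagram_widen[OF dia(1), of "[]" s3] ends by simp
  show "isotopic
     ((case w of (s, ds, t) \<Rightarrow> \<lambda>(s', ds', t').
        (s @ s', widen [] s' ds @ widen t [] ds', t @ t')) v)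
     ((case w' of (s, ds, t) \<Rightarrow> \<lambda>(s', ds', t').
        (s @ s', widen [] s' ds @ widen t [] ds', t @ t')) v')"
    using isotopic.trans[OF 1 2] ends by (simp add: e)
qed


section \<open>Linear combinations of webs and the local relations\<close>

type_synonym lin_web = "web \<Rightarrow>\<^sub>0 K"

definition scale_lin :: "K \<Rightarrow> lin_web \<Rightarrow> lin_web"
  where "scale_lin c f = Poly_Mapping.map (\<lambda>x. c * x) f"

definition stack_lin :: "lin_web \<Rightarrow> lin_web \<Rightarrow> lin_web"
  where "stack_lin f g = (\<Sum>w\<in>Poly_Mapping.keys f. \<Sum>v\<in>Poly_Mapping.keys g.
    if web_bot w = web_top v
    then Poly_Mapping.single (stack w v) (Poly_Mapping.lookup f w * Poly_Mapping.lookup g v)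
    else 0)"

definition juxt_lin :: "lin_web \<Rightarrow> lin_web \<Rightarrow> lin_web"
  where "juxt_lin f g = (\<Sum>w\<in>Poly_Mapping.keys f. \<Sum>v\<in>Poly_Mapping.keys g.
    Poly_Mapping.single (juxt w v) (Poly_Mapping.lookup f w * Poly_Mapping.lookup g v))"

definition loop_web :: "sgn \<Rightarrow> web"
  where "loop_web x = stack (piece_web (Cap x)) (piece_web (Cup x))"

definition bigon_web :: "sgn \<Rightarrow> web"
  where "bigon_web x = stack (piece_web (Merge (opp x))) (piece_web (Split x))"

text \<open>
  \<open>rung_web x\<close> is a horizontal edge between two vertices: its left vertex has the legs at the
  left end of the bottom and of the top side, its right vertex those at the right end. Two of
  them on top of each other bound a square face.
\<close>

definition rung_web :: "sgn \<Rightarrow> web"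
  where "rung_web x =
    stack (juxt (id_web [opp x]) (piece_web (Merge (opp x))))
      (juxt (piece_web (Split x)) (id_web [opp x]))"

definition square_web :: "sgn \<Rightarrow> web"
  where "square_web x = stack (rung_web (opp x)) (rung_web x)"

text \<open>
  The subspace of relations: the smallest one that contains the three local relations and is
  closed under inserting into a larger web.
\<close>

inductive_set web_relations :: "lin_web set"
  where
    loop: "Poly_Mapping.single (loop_web x) 1 - Poly_Mapping.single (id_web []) (qint 3)
      \<in> web_relations"
  | bigon: "Poly_Mapping.single (bigon_web x) 1 - Poly_Mapping.single (id_web [x]) (- qint 2)
      \<in> web_relations"
  | square: "Poly_Mapping.single (square_web x) 1
      - (Poly_Mapping.single (id_web [x, opp x]) 1
        + Poly_Mapping.single (stack (piece_web (Cup x)) (piece_web (Cap x))) 1) \<in> web_relations"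
  | zero: "0 \<in> web_relations"
  | add: "f \<in> web_relations \<Longrightarrow> g \<in> web_relations \<Longrightarrow> f + g \<in> web_relations"
  | scale: "f \<in> web_relations \<Longrightarrow> scale_lin c f \<in> web_relations"
  | stack_above: "f \<in> web_relations \<Longrightarrow> stack_lin g f \<in> web_relations"
  | stack_below: "f \<in> web_relations \<Longrightarrow> stack_lin f g \<in> web_relations"
  | juxt_left: "f \<in> web_relations \<Longrightarrow> juxt_lin g f \<in> web_relations"
  | juxt_right: "f \<in> web_relations \<Longrightarrow> juxt_lin f g \<in> web_relations"

lemma lookup_scale_lin: "Poly_Mapping.lookup (scale_lin c f) w = c * Poly_Mapping.lookup f w"
  by (simp add: scale_lin_def Poly_Mapping.map.rep_eq when_def)

lemma scale_lin_minus: "scale_lin (- 1) f = - f"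
  by (rule poly_mapping_eqI) (simp add: lookup_scale_lin)

lemma scale_lin_diff: "scale_lin c (f - g) = scale_lin c f - scale_lin c g"
  by (rule poly_mapping_eqI) (simp add: lookup_scale_lin lookup_minus algebra_simps)

lemma scale_lin_add: "scale_lin c (f + g) = scale_lin c f + scale_lin c g"
  by (rule poly_mapping_eqI) (simp add: lookup_scale_lin lookup_add algebra_simps)

lemma scale_lin_add_scalar: "scale_lin (c + d) f = scale_lin c f + scale_lin d f"
  by (rule poly_mapping_eqI) (simp add: lookup_scale_lin lookup_add algebra_simps)

lemma scale_lin_scale: "scale_lin c (scale_lin d f) = scale_lin (c * d) f"
  by (rule poly_mapping_eqI) (simp add: lookup_scale_lin)

lemma scale_lin_one: "scale_lin 1 f = f"
  by (rule poly_mapping_eqI) (simp add: lookup_scale_lin)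

lemma web_relations_uminus: "f \<in> web_relations \<Longrightarrow> - f \<in> web_relations"
  using web_relations.scale[of f "- 1"] by (simp add: scale_lin_minus)

lemma web_relations_diff: "f \<in> web_relations \<Longrightarrow> g \<in> web_relations \<Longrightarrow> f - g \<in> web_relations"
  using web_relations.add[of f "- g"] web_relations_uminus[of g] by simp

lemma stack_lin_superset:
  assumes "finite A" "finite B" "Poly_Mapping.keys f \<subseteq> A" "Poly_Mapping.keys g \<subseteq> B"
  shows "stack_lin f g = (\<Sum>w\<in>A. \<Sum>v\<in>B.
    if web_bot w = web_top v
    then Poly_Mapping.single (stack w v) (Poly_Mapping.lookup f w * Poly_Mapping.lookup g v)
    else 0)"
proof -
  have "(\<Sum>v\<in>B. if web_bot w = web_top v
      then Poly_Mapping.single (stack w v) (Poly_Mapping.lookup f w * Poly_Mapping.lookup g v) else 0)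
    = (\<Sum>v\<in>Poly_Mapping.keys g. if web_bot w = web_top v
      then Poly_Mapping.single (stack w v) (Poly_Mapping.lookup f w * Poly_Mapping.lookup g v) else 0)"
    for w
    by (rule sum.mono_neutral_right) (use assms in \<open>auto simp: in_keys_iff\<close>)
  then show ?thesis
    unfolding stack_lin_def
    by (simp, intro sum.mono_neutral_left) (use assms in \<open>auto simp: in_keys_iff cong: if_cong\<close>)
qed

lemma juxt_lin_superset:
  assumes "finite A" "finite B" "Poly_Mapping.keys f \<subseteq> A" "Poly_Mapping.keys g \<subseteq> B"
  shows "juxt_lin f g = (\<Sum>w\<in>A. \<Sum>v\<in>B.
    Poly_Mapping.single (juxt w v) (Poly_Mapping.lookup f w * Poly_Mapping.lookup g v))"
proof -
  have "(\<Sum>v\<in>B.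
      Poly_Mapping.single (juxt w v) (Poly_Mapping.lookup f w * Poly_Mapping.lookup g v))
    = (\<Sum>v\<in>Poly_Mapping.keys g.
      Poly_Mapping.single (juxt w v) (Poly_Mapping.lookup f w * Poly_Mapping.lookup g v))" for w
    by (rule sum.mono_neutral_right) (use assms in \<open>auto simp: in_keys_iff\<close>)
  then show ?thesis
    unfolding juxt_lin_def
    by (simp, intro sum.mono_neutral_left) (use assms in \<open>auto simp: in_keys_iff\<close>)
qed

lemma stack_lin_diff_left: "stack_lin (f - f') g = stack_lin f g - stack_lin f' g"
proof -
  let ?A = "Poly_Mapping.keys f \<union> Poly_Mapping.keys f'" and ?B = "Poly_Mapping.keys g"
  have k: "Poly_Mapping.keys (f - f') \<subseteq> ?A"
    by (auto simp: in_keys_iff lookup_minus)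
  note e1 = stack_lin_superset[of ?A ?B "f - f'" g]
  note e2 = stack_lin_superset[of ?A ?B f g]
  note e3 = stack_lin_superset[of ?A ?B f' g]
  show ?thesis
    apply (subst e1, simp, simp, use k in simp, use k in simp)
    apply (subst e2, simp, simp, simp, simp)
    apply (subst e3, simp, simp, simp, simp)
    unfolding sum_subtractf[symmetric]
    by (intro sum.cong HOL.refl) (simp add: lookup_minus left_diff_distrib single_diff)
qed

lemma stack_lin_diff_right: "stack_lin f (g - g') = stack_lin f g - stack_lin f g'"
proof -
  let ?A = "Poly_Mapping.keys f" and ?B = "Poly_Mapping.keys g \<union> Poly_Mapping.keys g'"
  have k: "Poly_Mapping.keys (g - g') \<subseteq> ?B"
    by (auto simp: in_keys_iff lookup_minus)
  note e1 = stack_lin_superset[of ?A ?B f "g - g'"]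
  note e2 = stack_lin_superset[of ?A ?B f g]
  note e3 = stack_lin_superset[of ?A ?B f g']
  show ?thesis
    apply (subst e1, simp, simp, use k in simp, use k in simp)
    apply (subst e2, simp, simp, simp, simp)
    apply (subst e3, simp, simp, simp, simp)
    unfolding sum_subtractf[symmetric]
    by (intro sum.cong HOL.refl) (simp add: lookup_minus right_diff_distrib single_diff)
qed

lemma juxt_lin_diff_left: "juxt_lin (f - f') g = juxt_lin f g - juxt_lin f' g"
proof -
  let ?A = "Poly_Mapping.keys f \<union> Poly_Mapping.keys f'" and ?B = "Poly_Mapping.keys g"
  have k: "Poly_Mapping.keys (f - f') \<subseteq> ?A"
    by (auto simp: in_keys_iff lookup_minus)
  note e1 = juxt_lin_superset[of ?A ?B "f - f'" g]
  note e2 = juxt_lin_superset[of ?A ?B f g]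
  note e3 = juxt_lin_superset[of ?A ?B f' g]
  show ?thesis
    apply (subst e1, simp, simp, use k in simp, use k in simp)
    apply (subst e2, simp, simp, simp, simp)
    apply (subst e3, simp, simp, simp, simp)
    unfolding sum_subtractf[symmetric]
    by (intro sum.cong HOL.refl) (simp add: lookup_minus left_diff_distrib single_diff)
qed

lemma juxt_lin_diff_right: "juxt_lin f (g - g') = juxt_lin f g - juxt_lin f g'"
proof -
  let ?A = "Poly_Mapping.keys f" and ?B = "Poly_Mapping.keys g \<union> Poly_Mapping.keys g'"
  have k: "Poly_Mapping.keys (g - g') \<subseteq> ?B"
    by (auto simp: in_keys_iff lookup_minus)
  note e1 = juxt_lin_superset[of ?A ?B f "g - g'"]
  note e2 = juxt_lin_superset[of ?A ?B f g]
  note e3 = juxt_lin_superset[of ?A ?B f g']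
  show ?thesis
    apply (subst e1, simp, simp, use k in simp, use k in simp)
    apply (subst e2, simp, simp, simp, simp)
    apply (subst e3, simp, simp, simp, simp)
    unfolding sum_subtractf[symmetric]
    by (intro sum.cong HOL.refl) (simp add: lookup_minus right_diff_distrib single_diff)
qed

text \<open>
  The elements of \<open>skein\<close> are linear combinations of webs with arbitrary boundary words modulo
  the relations, that is, \<open>skein\<close> is the direct sum of all the spaces \<open>Hom s t\<close> below.
\<close>

quotient_type skein = lin_web / "\<lambda>f g. f - g \<in> web_relations"
proof (rule equivpI)
  show "reflp (\<lambda>f g. f - g \<in> web_relations)"
    by (simp add: reflp_def web_relations.zero)
  show "symp (\<lambda>f g. f - g \<in> web_relations)"
    by (metis (no_types, lifting) minus_diff_eq sympI web_relations_uminus)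
  show "transp (\<lambda>f g. f - g \<in> web_relations)"
  proof (rule transpI)
    fix f g h assume "f - g \<in> web_relations" "g - h \<in> web_relations"
    from web_relations.add[OF this] show "f - h \<in> web_relations" by simp
  qed
qed

instantiation skein :: ab_group_add
begin

lift_definition zero_skein :: skein is 0 .

lift_definition plus_skein :: "skein \<Rightarrow> skein \<Rightarrow> skein" is "(+)"
  subgoal for f f' g g' using web_relations.add[of "f - f'" "g - g'"] by (simp add: algebra_simps)
  done

lift_definition minus_skein :: "skein \<Rightarrow> skein \<Rightarrow> skein" is "(-)"
  subgoal for f f' g g' using web_relations_diff[of "f - f'" "g - g'"] by (simp add: algebra_simps)
  done

lift_definition uminus_skein :: "skein \<Rightarrow> skein" is uminus
  subgoal for f f' using web_relations_uminus[of "f - f'"] by (simp add: algebra_simps)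
  done

instance
  by standard (transfer, simp add: web_relations.zero algebra_simps)+

end

lift_definition scale_skein :: "K \<Rightarrow> skein \<Rightarrow> skein" (infixr \<open>\<cdot>\<close> 75) is scale_lin
  by (metis scale_lin_diff web_relations.scale)

lift_definition comp_skein :: "skein \<Rightarrow> skein \<Rightarrow> skein" (infixl \<open>\<circle>\<close> 70) is stack_lin
  subgoal for f f' g g'
    using web_relations.add[OF web_relations.stack_below[of "f - f'" g]
        web_relations.stack_above[of "g - g'" f']]
    by (simp add: stack_lin_diff_left stack_lin_diff_right)
  done

lift_definition tensor_skein :: "skein \<Rightarrow> skein \<Rightarrow> skein" (infixr \<open>\<otimes>\<close> 73) is juxt_lin
  subgoal for f f' g g'
    using web_relations.add[OF web_relations.juxt_right[of "f - f'" g]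
        web_relations.juxt_left[of "g - g'" f']]
    by (simp add: juxt_lin_diff_left juxt_lin_diff_right)
  done

definition web_class :: "web \<Rightarrow> skein"
  where "web_class w = abs_skein (Poly_Mapping.single w 1)"

global_interpretation skein: vector_space scale_skein
  defines skein_span = skein.span
proof
  fix a b :: K and x y :: skein
  show "a \<cdot> (x + y) = a \<cdot> x + a \<cdot> y"
    by transfer (simp add: scale_lin_add web_relations.zero)
  show "(a + b) \<cdot> x = a \<cdot> x + b \<cdot> x"
    by transfer (simp add: scale_lin_add_scalar web_relations.zero)
  show "a \<cdot> (b \<cdot> x) = (a * b) \<cdot> x"
    by transfer (simp add: scale_lin_scale web_relations.zero)
  show "1 \<cdot> x = x"
    by transfer (simp add: scale_lin_one web_relations.zero)
qed

definition Hom :: "sword \<Rightarrow> sword \<Rightarrow> skein set"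
  where "Hom s t = skein_span (web_class ` {w. web_bot w = s \<and> web_top w = t})"

definition id_skein :: "sword \<Rightarrow> skein"
  where "id_skein s = web_class (id_web s)"


section \<open>Clasps\<close>

text \<open>
  Weights are taken in the whole weight lattice: a chain of elementary steps that relates two
  dominant weights may pass through weights that are not dominant, as in (1,1), (2,-1), (0,0).
\<close>

definition weight :: "sword \<Rightarrow> int \<times> int"
  where "weight s = (int (count_list s Pos), int (count_list s Neg))"

inductive weight_less :: "int \<times> int \<Rightarrow> int \<times> int \<Rightarrow> bool"
  where
    step1: "weight_less (a + 1, b - 2) (a, b)"
  | step2: "weight_less (a - 2, b + 1) (a, b)"
  | trans: "weight_less x y \<Longrightarrow> weight_less y z \<Longrightarrow> weight_less x z"

definition is_clasp :: "sword \<Rightarrow> skein \<Rightarrow> bool"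
  where "is_clasp s P \<longleftrightarrow> P \<in> Hom s s \<and> P \<noteq> 0 \<and> P \<circle> P = P \<and>
    (\<forall>t. weight_less (weight t) (weight s) \<longrightarrow>
      (\<forall>w\<in>Hom s t. w \<circle> P = 0) \<and> (\<forall>w\<in>Hom t s. P \<circle> w = 0))"

definition clasp :: "sword \<Rightarrow> skein"
  where "clasp s = (THE P. is_clasp s P)"

definition seg :: "nat \<Rightarrow> nat \<Rightarrow> sword"
  where "seg a b = replicate a Pos @ replicate b Neg"


section \<open>The webs in the formula\<close>

definition H_minus :: web
  where "H_minus = stack (piece_web (Split Pos)) (piece_web (Merge Neg))"

text \<open>
  If two strands that both run downward cross, then the incoming half-edges are the two upper
  ones and the outgoing half-edges the two lower ones, so the resolved crossing is \<open>H_minus\<close>.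
  \<open>sweep_up n\<close> and \<open>sweep_down n\<close> are resolutions of \<open>n\<close> vertical downward strands crossed by
  one more downward arc: in \<open>sweep_up n\<close> this arc runs from the right end of the top side to the
  left end of the bottom side, in \<open>sweep_down n\<close> from the left end of the top side to the right
  end of the bottom side.
\<close>

fun sweep_up :: "nat \<Rightarrow> web"
  where
    "sweep_up 0 = id_web [Neg]"
  | "sweep_up (Suc n) =
      stack (juxt (id_web (replicate n Neg)) H_minus) (juxt (sweep_up n) (id_web [Neg]))"

fun sweep_down :: "nat \<Rightarrow> web"
  where
    "sweep_down 0 = id_web [Neg]"
  | "sweep_down (Suc n) =
      stack (juxt (sweep_down n) (id_web [Neg])) (juxt (id_web (replicate n Neg)) H_minus)"

text \<open>
  \<open>alpha_web n\<close> contains the arc $\alpha$: from the last top endpoint it crosses the \<open>n\<close> vertical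
  strands from right to left and then turns up, left of them, to the first top endpoint.
  \<open>beta_web n\<close> contains $\beta$: from the first bottom endpoint it goes up, turns at a cap left of
  the vertical strands, and then crosses them from left to right, down to the last bottom endpoint.
\<close>

definition alpha_web :: "nat \<Rightarrow> web"
  where "alpha_web n =
    stack (juxt (id_web [Pos]) (sweep_up n)) (juxt (piece_web (Cup Pos)) (id_web (replicate n Neg)))"

definition beta_web :: "nat \<Rightarrow> web"
  where "beta_web n =
    stack (juxt (piece_web (Cap Pos)) (id_web (replicate n Neg))) (juxt (id_web [Pos]) (sweep_down n))"

definition X_web :: "nat \<Rightarrow> web"
  where "X_web b = stack (alpha_web (b - 1)) (beta_web (b - 1))"

end

theory Submission
  imports Defs
begin

text \<open>
  Every web is a combination of composites of cups, caps, merges, splits and rungs in which no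
  intermediate word is longer than the longer end word: a cup or split that opens a maximal word
  is followed by rungs and then by a descent, and the descent can be pushed down through the rungs
  and cancelled against the cup or split. Hence an endomorphism \<open>P\<close> of a segregated word that kills
  the caps and merges at its top and differs from the identity by webs starting with a cap or
  merge is a clasp, \<open>End(s) \<circle> P = K \<cdot> P\<close>, and it is the only clasp as soon as it is non-zero.

  The right hand side of the recursion is shown to be such an element by induction on \<open>b\<close>. Only the
  last merge and the last cap need a computation; it leads to a partial trace of the innermost
  strand, which is evaluated by conjugating with a path of rungs that swaps the two segments
  of the word. Non-vanishing is seen on the highest weight vector of a tensor product of vector
  representations of quantum \<open>sl(3)\<close> and their duals, on which everything starting with
  a cap or merge acts as zero.
\<close>

section \<open>Webs as classes of diagrams\<close>

text \<open>A \<open>rung\<close> is the resolved crossing of two antiparallel strands, and the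
  square relation makes it invertible up to a term that factors through a cap. Above an element that
  kills caps and merges, a closed path of rungs therefore acts as the identity; this is why
  endomorphisms act by scalars, and neither a basis of webs nor a count of faces enters. Diagrams
  are lists of slices, so the reduction tracks only the lengths of intermediate words. The price is
  a family of irreducible chains: a rung next to a merge encloses no face that could be removed. The
  recursion expands a clasp at its last strand, whereas the trace met under the last merge closes an
  inner strand of the other sign. Exchanging the two segments makes that strand the last one, and
  this forces one induction over both signs. The coefficient \<open>[a]/([b][a+b+1])\<close> has two
  sources: for \<open>b = 1\<close> it is the inverse of the partial trace \<open>[a+2]/[a]\<close>,
  and for larger \<open>b\<close> it is the solution of the linear equation that the last merge
  imposes.\<close>

definition web_of :: "sword \<Rightarrow> slice list \<Rightarrow> sword \<Rightarrow> web"
  where "web_of s ds t = abs_web (s, ds, t)"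

lemma opp_opp [simp]: "opp (opp x) = x"
  by (cases x) auto

lemma opp_neq [simp]: "opp x \<noteq> x" "x \<noteq> opp x"
  by (cases x; simp)+

lemma eq_or_opp: "y = x \<or> y = opp x"
  by (cases x; cases y) auto

lemma opp_eq_iff [simp]: "opp x = opp y \<longleftrightarrow> x = y"
  by (metis opp_opp)

lemma isotopic_self: "is_diagram s ds t \<longleftrightarrow> isotopic (s, ds, t) (s, ds, t)"
  using isotopicD isotopic.refl by fastforce

lemma web_cases:
  obtains s ds t where "is_diagram s ds t" "w = web_of s ds t"
proof -
  obtain s ds t where e: "rep_web w = (s, ds, t)"
    by (metis prod.exhaust)
  have "isotopic (s, ds, t) (s, ds, t)" "abs_web (s, ds, t) = w"
    using Quotient_rep_reflp[OF Quotient_web, of w] Quotient_abs_rep[OF Quotient_web, of w]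
    by (auto simp: e)
  then show thesis
    using that[of s ds t] by (simp add: web_of_def isotopic_self)
qed

lemma web_of_eqI: "isotopic (s, ds, t) (s, es, t) \<Longrightarrow> web_of s ds t = web_of s es t"
  unfolding web_of_def using Quotient_rel_abs[OF Quotient_web] by blast

lemma web_bot_web_of [simp]: "is_diagram s ds t \<Longrightarrow> web_bot (web_of s ds t) = s"
  and web_top_web_of [simp]: "is_diagram s ds t \<Longrightarrow> web_top (web_of s ds t) = t"
  by (simp_all add: web_of_def isotopic_self web_bot.abs_eq web_top.abs_eq)

lemma is_diagram_appendI: "is_diagram s ds t \<Longrightarrow> is_diagram t es u \<Longrightarrow> is_diagram s (ds @ es) u"
  by (auto simp: is_diagram_append)

lemma stack_web_of: "is_diagram s ds t \<Longrightarrow> is_diagram t es u \<Longrightarrow> stack (web_of t es u) (web_of s ds t) = web_of s (ds @ es) u"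
  by (simp add: web_of_def isotopic_self stack.abs_eq)

lemma juxt_web_of: "is_diagram s ds t \<Longrightarrow> is_diagram s' es t' \<Longrightarrow>
    juxt (web_of s ds t) (web_of s' es t') = web_of (s @ s') (widen [] s' ds @ widen t [] es) (t @ t')"
  by (simp add: web_of_def isotopic_self juxt.abs_eq)

lemma id_web_web_of: "id_web s = web_of s [] s"
  by (simp add: web_of_def id_web.abs_eq)

lemma piece_web_web_of: "piece_web p = web_of (piece_bot p) [([], p, [])] (piece_top p)"
  by (simp add: web_of_def piece_web.abs_eq)

lemma web_ends [simp]:
  "web_bot (id_web s) = s" "web_top (id_web s) = s"
  "web_bot (piece_web p) = piece_bot p" "web_top (piece_web p) = piece_top p"
  by (simp_all add: id_web_web_of piece_web_web_of)

lemma is_diagram_juxt: "is_diagram s ds t \<Longrightarrow> is_diagram s' es t' \<Longrightarrow>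
    is_diagram (s @ s') (widen [] s' ds @ widen t [] es) (t @ t')"
  using is_diagram_widen[of s ds t "[]" s'] is_diagram_widen[of s' es t' t "[]"]
  by (auto simp: is_diagram_append)

lemma web_ends_stack:
  assumes "web_bot w = web_top v"
  shows "web_bot (stack w v) = web_bot v" "web_top (stack w v) = web_top w"
  using assms by (cases w rule: web_cases; cases v rule: web_cases;
      auto simp: stack_web_of is_diagram_append intro!: web_bot_web_of web_top_web_of)+

lemma web_ends_juxt [simp]:
  "web_bot (juxt w v) = web_bot w @ web_bot v" "web_top (juxt w v) = web_top w @ web_top v"
  by (cases w rule: web_cases; cases v rule: web_cases; simp add: juxt_web_of is_diagram_juxt)+

lemma stack_assoc:
  assumes "web_bot w = web_top v" "web_bot v = web_top u"
  shows "stack (stack w v) u = stack w (stack v u)"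
proof -
  obtain s ds t where w: "is_diagram s ds t" "w = web_of s ds t" by (rule web_cases)
  obtain s' es t' where v: "is_diagram s' es t'" "v = web_of s' es t'" by (rule web_cases)
  obtain s'' fs t'' where u: "is_diagram s'' fs t''" "u = web_of s'' fs t''" by (rule web_cases)
  have "t' = s" "t'' = s'" using assms w v u by auto
  then show ?thesis
    using w v u is_diagram_appendI[of s' es s ds t] is_diagram_appendI[of s'' fs s' es s]
    by (simp add: stack_web_of)
qed

lemma stack_id_web:
  "stack (id_web (web_top w)) w = w" "stack w (id_web (web_bot w)) = w"
  by (cases w rule: web_cases; simp add: id_web_web_of stack_web_of)+

lemma widen_simps [simp]:
  "widen u v [] = []" "widen u v ((l, p, r) # ds) = (u @ l, p, r @ v) # widen u v ds"
  "widen [] [] ds = ds" "widen u v (ds @ es) = widen u v ds @ widen u v es"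
  "widen u v (widen u' v' ds) = widen (u @ u') (v' @ v) ds"
  by (auto simp: widen_def case_prod_beta)

lemma juxt_assoc: "juxt (juxt w v) u = juxt w (juxt v u)"
  by (cases w rule: web_cases; cases v rule: web_cases; cases u rule: web_cases;
      simp add: juxt_web_of is_diagram_juxt)

lemma juxt_id_web [simp]:
  "juxt (id_web []) w = w" "juxt w (id_web []) = w"
  "juxt (id_web s) (id_web t) = id_web (s @ t)"
  by (cases w rule: web_cases; simp add: id_web_web_of juxt_web_of)+

lemma juxt_id_stack:
  assumes "web_bot w = web_top v"
  shows "juxt (id_web l) (stack w v) = stack (juxt (id_web l) w) (juxt (id_web l) v)"
    and "juxt (stack w v) (id_web l) = stack (juxt w (id_web l)) (juxt v (id_web l))"
proof -
  obtain s ds t where w: "is_diagram s ds t" "w = web_of s ds t" by (rule web_cases)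
  obtain s' es t' where v: "is_diagram s' es t'" "v = web_of s' es t'" by (rule web_cases)
  have e: "t' = s" using assms w v by auto
  note d = is_diagram_widen[OF w(1), of l "[]"] is_diagram_widen[OF v(1), of l "[]"]
    is_diagram_widen[OF w(1), of "[]" l] is_diagram_widen[OF v(1), of "[]" l]
    is_diagram_appendI[of s' es s ds t]
  show "juxt (id_web l) (stack w v) = stack (juxt (id_web l) w) (juxt (id_web l) v)"
    and "juxt (stack w v) (id_web l) = stack (juxt w (id_web l)) (juxt v (id_web l))"
    using d w v e by (simp_all add: stack_web_of juxt_web_of id_web_web_of)
qed

section \<open>Isotopy inside a larger diagram and the interchange law\<close>

lemma isotopic_move_under_over:
  assumes "isotopic (s, ds, t) (s, es, t)" "is_diagram u us s" "is_diagram t vs v"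
  shows "isotopic (u, us @ ds @ vs, v) (u, us @ es @ vs, v)"
proof -
  have "isotopic (s, ds @ vs, v) (s, es @ vs, v)"
    using isotopic_under[OF assms(1), of vs v] assms(3) by simp
  from isotopic_above[OF this, of u us] assms(2) show ?thesis by simp
qed

text \<open>An isotopy move exchanges two adjacent slices only, so a piece climbs past a whole
  diagram to its right by induction on that diagram, one exchange per slice. The gap
  \<open>m\<close> is arbitrary because \<open>exchange_slices\<close> uses it with the strands to
  the right of the current slice included.\<close>

lemma exchange_slice:
  assumes "is_diagram s es t"
  shows "isotopic (l @ piece_bot p @ m @ s @ r, (l, p, m @ s @ r) # widen (l @ piece_top p @ m) r es,
        l @ piece_top p @ m @ t @ r)
      (l @ piece_bot p @ m @ s @ r, widen (l @ piece_bot p @ m) r es @ [(l, p, m @ t @ r)],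
        l @ piece_top p @ m @ t @ r)"
  using assms
proof (induction s es t rule: is_diagram.induct)
  case (1 s t)
  then show ?case by (auto intro!: isotopic.refl)
next
  case (2 s l' p' r' ds t)
  let ?s1 = "l' @ piece_top p' @ r'"
  have d: "is_diagram ?s1 ds t" and s: "s = l' @ piece_bot p' @ r'"
    using 2(2) by auto
  have w: "is_diagram (l @ piece_top p @ m @ ?s1 @ r) (widen (l @ piece_top p @ m) r ds) (l @ piece_top p @ m @ t @ r)"
    using is_diagram_widen[OF d, of "l @ piece_top p @ m" r] by simp
  have "isotopic (l @ piece_bot p @ m @ s @ r,
      [] @ [(l, p, (m @ l') @ piece_bot p' @ (r' @ r)), (l @ piece_top p @ (m @ l'), p', r' @ r)] @ widen (l @ piece_top p @ m) r ds,
      l @ piece_top p @ m @ t @ r)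
     (l @ piece_bot p @ m @ s @ r,
      [] @ [(l @ piece_bot p @ (m @ l'), p', r' @ r), (l, p, (m @ l') @ piece_top p' @ (r' @ r))] @ widen (l @ piece_top p @ m) r ds,
      l @ piece_top p @ m @ t @ r)"
    by (rule isotopic.move[OF isotopy_move.exchange]) (use w s in simp_all)
  moreover have "isotopic (l @ piece_bot p @ m @ s @ r,
      [(l @ piece_bot p @ (m @ l'), p', r' @ r)] @ ((l, p, m @ ?s1 @ r) # widen (l @ piece_top p @ m) r ds),
      l @ piece_top p @ m @ t @ r)
     (l @ piece_bot p @ m @ s @ r,
      [(l @ piece_bot p @ (m @ l'), p', r' @ r)] @ (widen (l @ piece_bot p @ m) r ds @ [(l, p, m @ t @ r)]),
      l @ piece_top p @ m @ t @ r)"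
    using isotopic_above[OF 2(1)[OF d], of "l @ piece_bot p @ m @ s @ r" "[(l @ piece_bot p @ (m @ l'), p', r' @ r)]"]
    by (simp add: s)
  ultimately show ?case
    using isotopic.trans by (simp add: s)
qed

lemma exchange_slices:
  assumes "is_diagram s ds t" "is_diagram s' es t'"
  shows "isotopic (s @ m @ s', widen [] (m @ s') ds @ widen (t @ m) [] es, t @ m @ t')
      (s @ m @ s', widen (s @ m) [] es @ widen [] (m @ t') ds, t @ m @ t')"
  using assms(1)
proof (induction s ds t rule: is_diagram.induct)
  case (1 s t)
  then show ?case
    using is_diagram_widen[OF assms(2), of "s @ m" "[]"] by (auto intro!: isotopic.refl)
next
  case (2 s l p r ds t)
  let ?s1 = "l @ piece_top p @ r"
  have d: "is_diagram ?s1 ds t" and s: "s = l @ piece_bot p @ r"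
    using 2(2) by auto
  have "isotopic (s @ m @ s', [(l, p, r @ m @ s')] @ (widen [] (m @ s') ds @ widen (t @ m) [] es), t @ m @ t')
     (s @ m @ s', [(l, p, r @ m @ s')] @ (widen (?s1 @ m) [] es @ widen [] (m @ t') ds), t @ m @ t')"
    using isotopic_above[OF 2(1)[OF d], of "s @ m @ s'" "[(l, p, r @ m @ s')]"] by (simp add: s)
  moreover have "isotopic (s @ m @ s', ((l, p, r @ m @ s') # widen (?s1 @ m) [] es) @ widen [] (m @ t') ds, t @ m @ t')
     (s @ m @ s', (widen (s @ m) [] es @ [(l, p, r @ m @ t')]) @ widen [] (m @ t') ds, t @ m @ t')"
    using isotopic_under[OF exchange_slice[OF assms(2), of l p "r @ m" "[]"], of "widen [] (m @ t') ds" "t @ m @ t'"]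
      is_diagram_widen[OF d, of "[]" "m @ t'"] by (simp add: s)
  ultimately show ?case
    using isotopic.trans by (simp add: s)
qed

text \<open>\<open>juxt\<close> draws the left factor below the right one, so the second form is its
  definition and only the first one needs an isotopy.\<close>

lemma juxt_exchange:
  "juxt w v = stack (juxt w (id_web (web_top v))) (juxt (id_web (web_bot w)) v)"
  "juxt w v = stack (juxt (id_web (web_top w)) v) (juxt w (id_web (web_bot v)))"
proof -
  obtain s ds t where w: "is_diagram s ds t" "w = web_of s ds t" by (rule web_cases)
  obtain s' es t' where v: "is_diagram s' es t'" "v = web_of s' es t'" by (rule web_cases)
  have d: "is_diagram (s @ s') (widen [] s' ds) (t @ s')" "is_diagram (t @ s') (widen t [] es) (t @ t')"
    "is_diagram (s @ s') (widen s [] es) (s @ t')" "is_diagram (s @ t') (widen [] t' ds) (t @ t')"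
    using is_diagram_widen[OF w(1), of "[]"] is_diagram_widen[OF v(1), of _ "[]"] by auto
  show "juxt w v = stack (juxt w (id_web (web_top v))) (juxt (id_web (web_bot w)) v)"
    using exchange_slices[OF w(1) v(1), of "[]"]
    by (simp add: w v juxt_web_of id_web_web_of stack_web_of d web_of_eqI)
  show "juxt w v = stack (juxt (id_web (web_top w)) v) (juxt w (id_web (web_bot v)))"
    by (simp add: w v juxt_web_of id_web_web_of stack_web_of d)
qed


subsection \<open>Turning webs upside down\<close>

text \<open>Reflection in a horizontal line combined with reversal of all orientations. The boundary
  letters are thereby kept, and a sink becomes a source, whence the change of sign at
  vertices.\<close>

fun flip_piece :: "piece \<Rightarrow> piece"
  where
    "flip_piece (Cup x) = Cap x"
  | "flip_piece (Cap x) = Cup x"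
  | "flip_piece (Merge x) = Split (opp x)"
  | "flip_piece (Split x) = Merge (opp x)"

lemma flip_piece_simps [simp]:
  "flip_piece (flip_piece p) = p"
  "piece_bot (flip_piece p) = piece_top p" "piece_top (flip_piece p) = piece_bot p"
  by (cases p; simp)+

definition flip_slices :: "slice list \<Rightarrow> slice list"
  where "flip_slices ds = rev (map (\<lambda>(l, p, r). (l, flip_piece p, r)) ds)"

lemma flip_slices_simps [simp]:
  "flip_slices [] = []" "flip_slices ((l, p, r) # ds) = flip_slices ds @ [(l, flip_piece p, r)]"
  "flip_slices (ds @ es) = flip_slices es @ flip_slices ds"
  "flip_slices (flip_slices ds) = ds"
  "flip_slices (widen u v ds) = widen u v (flip_slices ds)"
  by (auto simp: flip_slices_def widen_def rev_map comp_def case_prod_beta)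

lemma is_diagram_flip: "is_diagram s ds t \<Longrightarrow> is_diagram t (flip_slices ds) s"
  by (induction s ds t rule: is_diagram.induct) (auto simp: is_diagram_append)

lemma isotopic_move1:
  "isotopy_move ds es \<Longrightarrow> is_diagram s ds t \<Longrightarrow> is_diagram s es t \<Longrightarrow> isotopic (s, ds, t) (s, es, t)"
  using isotopic.move[of ds es s "[]" "[]" t] by simp

text \<open>The isotopy moves only bend a leg of a merge upwards. To bend a leg of a split down
  again, the split is written as a merge over a cup, the cap slides below the merge, and cup and cap
  form a zigzag. Reflected bend moves have this form, so reflection respects isotopy by this lemma
  and its mirror image.\<close>

lemma unbend_right:
  "isotopic (l @ y # y # r, [(l, Split y, y # r), (l @ [opp y], Cap (opp y), r)], l @ opp y # r)
    (l @ y # y # r, [(l, Merge y, r)], l @ opp y # r)"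
proof -
  have 1: "isotopic (l @ y # y # r, [] @ [(l @ [y], Cup y, y # r), (l, Merge y, opp y # y # r)] @ [(l @ [opp y], Cap (opp y), r)], l @ opp y # r)
    (l @ y # y # r, [] @ [(l, Split y, y # r)] @ [(l @ [opp y], Cap (opp y), r)], l @ opp y # r)"
    by (rule isotopic.move[OF isotopy_move.bend_right]) auto
  have 2: "isotopic (l @ y # y # r,
      [(l @ [y], Cup y, y # r)] @ [(l, Merge y, [] @ piece_bot (Cap (opp y)) @ r), (l @ piece_top (Merge y) @ [], Cap (opp y), r)] @ [], l @ opp y # r)
    (l @ y # y # r, [(l @ [y], Cup y, y # r)] @ [(l @ piece_bot (Merge y) @ [], Cap (opp y), r), (l, Merge y, [] @ piece_top (Cap (opp y)) @ r)] @ [], l @ opp y # r)"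
    by (rule isotopic.move[OF isotopy_move.exchange]) auto
  have 3: "isotopic (l @ y # y # r,
      [] @ [(l @ [y], Cup y, y # r), ((l @ [y]) @ [y], Cap (opp y), r)] @ [(l, Merge y, r)], l @ opp y # r)
    (l @ y # y # r, [] @ [] @ [(l, Merge y, r)], l @ opp y # r)"
    by (rule isotopic.move[OF isotopy_move.zigzag_left]) auto
  show ?thesis
    using isotopic.trans[OF isotopic.sym[OF 1[simplified]] isotopic.trans[OF 2[simplified] 3[simplified]]]
    by simp
qed

lemma unbend_left:
  "isotopic (l @ y # y # r, [(l @ [y], Split y, r), (l, Cap y, opp y # r)], l @ opp y # r)
    (l @ y # y # r, [(l, Merge y, r)], l @ opp y # r)"
proof -
  have 1: "isotopic (l @ y # y # r, [] @ [((l @ [y]) , Cup (opp y), y # r), ((l @ [y]) @ [opp y], Merge y, r)] @ [(l, Cap y, opp y # r)], l @ opp y # r)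
    (l @ y # y # r, [] @ [(l @ [y], Split y, r)] @ [(l, Cap y, opp y # r)], l @ opp y # r)"
    by (rule isotopic.move[OF isotopy_move.bend_left]) auto
  have 2: "isotopic (l @ y # y # r,
      [(l @ [y], Cup (opp y), y # r)] @ [(l, Cap y, [] @ piece_bot (Merge y) @ r), (l @ piece_top (Cap y) @ [], Merge y, r)] @ [], l @ opp y # r)
    (l @ y # y # r, [(l @ [y], Cup (opp y), y # r)] @ [(l @ piece_bot (Cap y) @ [], Merge y, r), (l, Cap y, [] @ piece_top (Merge y) @ r)] @ [], l @ opp y # r)"
    by (rule isotopic.move[OF isotopy_move.exchange]) auto
  have 3: "isotopic (l @ y # y # r,
      [] @ [(l @ [y], Cup (opp y), y # r), (l, Cap y, y # y # r)] @ [(l, Merge y, r)], l @ opp y # r)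
    (l @ y # y # r, [] @ [] @ [(l, Merge y, r)], l @ opp y # r)"
    by (rule isotopic.move[OF isotopy_move.zigzag_right]) auto
  show ?thesis
    using isotopic.trans[OF isotopic.sym[OF 1[simplified]] isotopic.trans[OF isotopic.sym[OF 2[simplified]] 3[simplified]]]
    by simp
qed

lemma isotopic_flip_move:
  assumes "isotopy_move ds es" "is_diagram s ds t" "is_diagram s es t"
  shows "isotopic (t, flip_slices ds, s) (t, flip_slices es, s)"
  using assms
proof (induction rule: isotopy_move.induct)
  case (exchange l p m p' r)
  have "isotopy_move [(l, flip_piece p, m @ piece_bot (flip_piece p') @ r), (l @ piece_top (flip_piece p) @ m, flip_piece p', r)]
      [(l @ piece_bot (flip_piece p) @ m, flip_piece p', r), (l, flip_piece p, m @ piece_top (flip_piece p') @ r)]"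
    by (rule isotopy_move.exchange)
  then show ?case
    using exchange by (intro isotopic.sym[OF isotopic_move1]) auto
next
  case (zigzag_right l x r)
  then show ?case
    using isotopy_move.zigzag_left[of l x r] by (intro isotopic_move1) auto
next
  case (zigzag_left l x r)
  then show ?case
    using isotopy_move.zigzag_right[of l x r] by (intro isotopic_move1) auto
next
  case (bend_right l x r)
  then show ?case
    using unbend_right[of l "opp x" r] by auto
next
  case (bend_left l x r)
  then show ?case
    using unbend_left[of l "opp x" r] by auto
qed

lemma isotopic_flip:
  assumes "isotopic d d'"
  shows "isotopic (snd (snd d), flip_slices (fst (snd d)), fst d) (snd (snd d'), flip_slices (fst (snd d')), fst d')"
  using assms
proof (induction)
  case (refl s ds t)
  then show ?case by (auto intro!: isotopic.refl is_diagram_flip)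
next
  case (move ds es s us vs t)
  obtain u v where uv: "is_diagram s us u" "is_diagram u ds v" "is_diagram v vs t"
    using move(2) by (auto simp: is_diagram_append)
  obtain u' v' where uv': "is_diagram s us u'" "is_diagram u' es v'" "is_diagram v' vs t"
    using move(3) by (auto simp: is_diagram_append)
  \<comment> \<open>A list of slices determines its upper word from the lower one. This identifies
    \<open>u'\<close> with \<open>u\<close>; for \<open>v'\<close> and \<open>v\<close> the same
    argument runs downwards from \<open>t\<close>, through the reflected diagram.\<close>
  have det: "is_diagram s ds u \<Longrightarrow> is_diagram s ds v \<Longrightarrow> u = v" for s ds u v
    by (induction s ds u rule: is_diagram.induct) auto
  have u: "u' = u" using det uv uv' by blast
  have "v' = v"
    using det[OF is_diagram_flip[OF uv(3)] is_diagram_flip[OF uv'(3)]] by simp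
  with isotopic_flip_move[OF move(1), of u v] uv uv' u
  have "isotopic (v, flip_slices ds, u) (v, flip_slices es, u)" by simp
  from isotopic_move_under_over[OF this is_diagram_flip[OF uv(3)] is_diagram_flip[OF uv(1)]]
  show ?case by simp
next
  case (sym d d')
  then show ?case using isotopic.sym by blast
next
  case (trans d d' d'')
  then show ?case using isotopic.trans by blast
qed

lift_definition flip_web :: "web \<Rightarrow> web" is "\<lambda>(s, ds, t). (t, flip_slices ds, s)"
  using isotopic_flip by fastforce

lemma flip_web_web_of: "is_diagram s ds t \<Longrightarrow> flip_web (web_of s ds t) = web_of t (flip_slices ds) s"
  by (simp add: web_of_def isotopic_self flip_web.abs_eq)

lemma flip_web_simps [simp]:
  "flip_web (flip_web w) = w"
  "web_bot (flip_web w) = web_top w" "web_top (flip_web w) = web_bot w"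
  "flip_web (id_web s) = id_web s" "flip_web (piece_web p) = piece_web (flip_piece p)"
  by (cases w rule: web_cases; simp add: flip_web_web_of is_diagram_flip id_web_web_of piece_web_web_of)+

lemma flip_web_stack:
  assumes "web_bot w = web_top v"
  shows "flip_web (stack w v) = stack (flip_web v) (flip_web w)"
proof -
  obtain s ds t where w: "is_diagram s ds t" "w = web_of s ds t" by (rule web_cases)
  obtain s' es t' where v: "is_diagram s' es t'" "v = web_of s' es t'" by (rule web_cases)
  have "t' = s" using assms w v by auto
  then show ?thesis
    using w v is_diagram_appendI[of s' es s ds t]
    by (simp add: stack_web_of flip_web_web_of is_diagram_flip)
qed

lemma flip_web_juxt: "flip_web (juxt w v) = juxt (flip_web w) (flip_web v)"
proof -
  obtain s ds t where w: "is_diagram s ds t" "w = web_of s ds t" by (rule web_cases)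
  obtain s' es t' where v: "is_diagram s' es t'" "v = web_of s' es t'" by (rule web_cases)
  show ?thesis
    using exchange_slices[OF is_diagram_flip[OF w(1)] is_diagram_flip[OF v(1)], of "[]"]
    by (simp add: w v juxt_web_of flip_web_web_of is_diagram_juxt is_diagram_flip web_of_eqI isotopic.sym)
qed

section \<open>The skein category\<close>

lemma skein_induct [case_names zero add scale web]:
  assumes "P 0" "\<And>f g. P f \<Longrightarrow> P g \<Longrightarrow> P (f + g)" "\<And>c f. P f \<Longrightarrow> P (c \<cdot> f)"
    "\<And>w. P (web_class w)"
  shows "P (f :: skein)"
proof -
  have *: "P (abs_skein (\<Sum>w\<in>A. Poly_Mapping.single w (c w)))" for A c
  proof (induction A rule: infinite_finite_induct)
    case (insert w A)
    have "abs_skein (Poly_Mapping.single w (c w)) = c w \<cdot> web_class w"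
      by (simp add: web_class_def scale_skein.abs_eq scale_lin_def Poly_Mapping.map_single)
    then have "P (abs_skein (Poly_Mapping.single w (c w)))"
      using assms(3,4) by simp
    then show ?case
      using assms(2) insert by (simp add: plus_skein.abs_eq[symmetric])
  qed (simp_all add: assms(1)[unfolded zero_skein_def])
  have "g = (\<Sum>w\<in>Poly_Mapping.keys g. Poly_Mapping.single w (Poly_Mapping.lookup g w))" for g :: lin_web
    by (rule poly_mapping_eqI) (simp add: lookup_sum lookup_single when_def in_keys_iff)
  then have "P (abs_skein g)" for g
    using * by metis
  then show ?thesis
    using Quotient_abs_rep[OF Quotient_skein, of f] by metis
qed

lemma comp_diff_left: "(f - f') \<circle> g = f \<circle> g - f' \<circle> g"
  by (transfer, simp add: stack_lin_diff_left web_relations.zero)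

lemma comp_diff_right: "f \<circle> (g - g') = f \<circle> g - f \<circle> g'"
  by (transfer, simp add: stack_lin_diff_right web_relations.zero)

lemma comp_zero [simp]: "0 \<circle> g = 0" "f \<circle> 0 = 0"
  using comp_diff_left[of f f g] comp_diff_left[of 0 0 g] comp_diff_right[of f 0 0] by simp_all

lemma comp_minus_left: "(- f) \<circle> g = - (f \<circle> g)"
  using comp_diff_left[of 0 f g] by simp

lemma comp_minus_right: "f \<circle> (- g) = - (f \<circle> g)"
  using comp_diff_right[of f 0 g] by simp

lemma comp_add_left: "(f + f') \<circle> g = f \<circle> g + f' \<circle> g"
  using comp_diff_left[of f "- f'" g] by (simp add: comp_minus_left)

lemma comp_add_right: "f \<circle> (g + g') = f \<circle> g + f \<circle> g'"
  using comp_diff_right[of f g "- g'"] by (simp add: comp_minus_right)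

lemma tensor_diff_left: "(f - f') \<otimes> g = f \<otimes> g - f' \<otimes> g"
  by (transfer, simp add: juxt_lin_diff_left web_relations.zero)

lemma tensor_diff_right: "f \<otimes> (g - g') = f \<otimes> g - f \<otimes> g'"
  by (transfer, simp add: juxt_lin_diff_right web_relations.zero)

lemma tensor_zero [simp]: "0 \<otimes> g = 0" "f \<otimes> (0 :: skein) = 0"
  using tensor_diff_left[of 0 0 g] tensor_diff_right[of f 0 0] by simp_all

lemma tensor_minus_left: "(- f) \<otimes> g = - (f \<otimes> g)"
  using tensor_diff_left[of 0 f g] by simp

lemma tensor_minus_right: "f \<otimes> (- g) = - (f \<otimes> (g :: skein))"
  using tensor_diff_right[of f 0 g] by simp

lemma tensor_add_left: "(f + f') \<otimes> g = f \<otimes> g + f' \<otimes> g"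
  using tensor_diff_left[of f "- f'" g] by (simp add: tensor_minus_left)

lemma tensor_add_right: "f \<otimes> (g + g') = f \<otimes> g + f \<otimes> (g' :: skein)"
  using tensor_diff_right[of f g "- g'"] by (simp add: tensor_minus_right)

lemma stack_lin_scale_left: "stack_lin (scale_lin c f) g = scale_lin c (stack_lin f g)"
proof -
  have k: "Poly_Mapping.keys (scale_lin c f) \<subseteq> Poly_Mapping.keys f"
    by (auto simp: in_keys_iff lookup_scale_lin)
  have sum: "scale_lin c (\<Sum>x\<in>A. h x) = (\<Sum>x\<in>A. scale_lin c (h x))" for A and h :: "web \<Rightarrow> lin_web"
    by (induction A rule: infinite_finite_induct)
      (auto simp: scale_lin_add intro!: poly_mapping_eqI simp: lookup_scale_lin)
  show ?thesis
    apply (subst stack_lin_superset[of "Poly_Mapping.keys f" "Poly_Mapping.keys g"])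
    using k apply auto
    unfolding stack_lin_def sum
    by (intro sum.cong HOL.refl) (auto intro!: poly_mapping_eqI simp: lookup_scale_lin lookup_single when_def)
qed

lemma stack_lin_scale_right: "stack_lin f (scale_lin c g) = scale_lin c (stack_lin f g)"
proof -
  have k: "Poly_Mapping.keys (scale_lin c g) \<subseteq> Poly_Mapping.keys g"
    by (auto simp: in_keys_iff lookup_scale_lin)
  have sum: "scale_lin c (\<Sum>x\<in>A. h x) = (\<Sum>x\<in>A. scale_lin c (h x))" for A and h :: "web \<Rightarrow> lin_web"
    by (induction A rule: infinite_finite_induct)
      (auto simp: scale_lin_add intro!: poly_mapping_eqI simp: lookup_scale_lin)
  show ?thesis
    apply (subst stack_lin_superset[of "Poly_Mapping.keys f" "Poly_Mapping.keys g"])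
    using k apply auto
    unfolding stack_lin_def sum
    by (intro sum.cong HOL.refl) (auto intro!: poly_mapping_eqI simp: lookup_scale_lin lookup_single when_def)
qed

lemma juxt_lin_scale_left: "juxt_lin (scale_lin c f) g = scale_lin c (juxt_lin f g)"
proof -
  have k: "Poly_Mapping.keys (scale_lin c f) \<subseteq> Poly_Mapping.keys f"
    by (auto simp: in_keys_iff lookup_scale_lin)
  have sum: "scale_lin c (\<Sum>x\<in>A. h x) = (\<Sum>x\<in>A. scale_lin c (h x))" for A and h :: "web \<Rightarrow> lin_web"
    by (induction A rule: infinite_finite_induct)
      (auto simp: scale_lin_add intro!: poly_mapping_eqI simp: lookup_scale_lin)
  show ?thesis
    apply (subst juxt_lin_superset[of "Poly_Mapping.keys f" "Poly_Mapping.keys g"])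
    using k apply auto
    unfolding juxt_lin_def sum
    by (intro sum.cong HOL.refl) (auto intro!: poly_mapping_eqI simp: lookup_scale_lin lookup_single when_def)
qed

lemma juxt_lin_scale_right: "juxt_lin f (scale_lin c g) = scale_lin c (juxt_lin f g)"
proof -
  have k: "Poly_Mapping.keys (scale_lin c g) \<subseteq> Poly_Mapping.keys g"
    by (auto simp: in_keys_iff lookup_scale_lin)
  have sum: "scale_lin c (\<Sum>x\<in>A. h x) = (\<Sum>x\<in>A. scale_lin c (h x))" for A and h :: "web \<Rightarrow> lin_web"
    by (induction A rule: infinite_finite_induct)
      (auto simp: scale_lin_add intro!: poly_mapping_eqI simp: lookup_scale_lin)
  show ?thesis
    apply (subst juxt_lin_superset[of "Poly_Mapping.keys f" "Poly_Mapping.keys g"])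
    using k apply auto
    unfolding juxt_lin_def sum
    by (intro sum.cong HOL.refl) (auto intro!: poly_mapping_eqI simp: lookup_scale_lin lookup_single when_def)
qed

lemma scale_comp [simp]: "(c \<cdot> f) \<circle> g = c \<cdot> (f \<circle> g)" "f \<circle> (c \<cdot> g) = c \<cdot> (f \<circle> g)"
  by (transfer, simp add: stack_lin_scale_left stack_lin_scale_right web_relations.zero)+

lemma scale_tensor [simp]: "(c \<cdot> f) \<otimes> g = c \<cdot> (f \<otimes> g)" "f \<otimes> (c \<cdot> g) = c \<cdot> (f \<otimes> g)"
  by (transfer, simp add: juxt_lin_scale_left juxt_lin_scale_right web_relations.zero)+

lemma comp_web_class: "web_class w \<circle> web_class v = (if web_bot w = web_top v then web_class (stack w v) else 0)"
  by (simp add: web_class_def comp_skein.abs_eq stack_lin_def zero_skein_def)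

lemma tensor_web_class: "web_class w \<otimes> web_class v = web_class (juxt w v)"
  by (simp add: web_class_def tensor_skein.abs_eq juxt_lin_def)

lemma comp_web_class':
  "web_bot w = web_top v \<Longrightarrow> web_class w \<circle> web_class v = web_class (stack w v)"
  "web_bot w \<noteq> web_top v \<Longrightarrow> web_class w \<circle> web_class v = 0"
  by (simp_all add: comp_web_class)

text \<open>No typing is required, because webs whose words do not match compose to 0: in each of
  the four patterns of matching words both bracketings agree. Later rewriting can therefore ignore
  the words.\<close>

lemma comp_skein_assoc: "(f \<circle> g) \<circle> h = f \<circle> (g \<circle> h)"
proof -
  have 1: "(web_class w \<circle> web_class v) \<circle> web_class u = web_class w \<circle> (web_class v \<circle> web_class u)" for w v u
  proof (cases "web_bot w = web_top v")
    case wv: True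
    show ?thesis
    proof (cases "web_bot v = web_top u")
      case True
      show ?thesis
        unfolding comp_web_class'(1)[OF wv] comp_web_class'(1)[OF True]
        by (subst (1 2) comp_web_class'(1))
          (use wv True in \<open>simp_all only: web_ends_stack[OF wv] web_ends_stack[OF True] stack_assoc[OF wv True]\<close>)
    next
      case False
      show ?thesis
        unfolding comp_web_class'(1)[OF wv] comp_web_class'(2)[OF False]
        by (subst comp_web_class'(2)) (use False in \<open>simp_all only: web_ends_stack[OF wv] comp_zero not_False_eq_True\<close>)
    qed
  next
    case wv: False
    show ?thesis
    proof (cases "web_bot v = web_top u")
      case True
      show ?thesis
        unfolding comp_web_class'(2)[OF wv] comp_web_class'(1)[OF True]
        by (subst comp_web_class'(2)) (use wv in \<open>simp_all only: web_ends_stack[OF True] comp_zero not_False_eq_True\<close>)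
    next
      case False
      show ?thesis
        unfolding comp_web_class'(2)[OF wv] comp_web_class'(2)[OF False] by simp
    qed
  qed
  have 2: "(web_class w \<circle> web_class v) \<circle> h = web_class w \<circle> (web_class v \<circle> h)" for w v
    by (induction h rule: skein_induct) (use 1 in \<open>simp_all add: comp_add_right\<close>)
  have 3: "(web_class w \<circle> g) \<circle> h = web_class w \<circle> (g \<circle> h)" for w
    by (induction g rule: skein_induct) (use 2 in \<open>simp_all add: comp_add_left comp_add_right\<close>)
  show ?thesis
    by (induction f rule: skein_induct) (use 3 in \<open>simp_all add: comp_add_left\<close>)
qed

lemma tensor_assoc: "(f \<otimes> g) \<otimes> h = f \<otimes> (g \<otimes> h)"
proof (induction f rule: skein_induct)
  case (web w)
  show ?case
  proof (induction g rule: skein_induct)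
    case (web v)
    show ?case
    proof (induction h rule: skein_induct)
      case (web u)
      show ?case
        by (auto simp: tensor_web_class juxt_assoc)
    qed (simp_all add: tensor_add_right)
  qed (simp_all add: tensor_add_left tensor_add_right)
qed (simp_all add: tensor_add_left)

lemma tensor_id_Nil [simp]: "id_skein [] \<otimes> f = f" "f \<otimes> id_skein [] = f"
  by (induction f rule: skein_induct)
    (simp_all add: tensor_add_left tensor_add_right id_skein_def tensor_web_class)

lemma tensor_id_id: "id_skein s \<otimes> id_skein t = id_skein (s @ t)"
  by (simp add: id_skein_def tensor_web_class)

lemma tensor_id_comp:
  "id_skein l \<otimes> (f \<circle> g) = (id_skein l \<otimes> f) \<circle> (id_skein l \<otimes> g)"
  "(f \<circle> g) \<otimes> id_skein l = (f \<otimes> id_skein l) \<circle> (g \<otimes> id_skein l)"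
proof -
  have *: "id_skein l \<otimes> (f \<circle> g) = (id_skein l \<otimes> f) \<circle> (id_skein l \<otimes> g) \<and>
      (f \<circle> g) \<otimes> id_skein l = (f \<otimes> id_skein l) \<circle> (g \<otimes> id_skein l)"
  proof (induction f rule: skein_induct)
    case (web w)
    show ?case
    proof (induction g rule: skein_induct)
      case (web v)
      show ?case
        by (auto simp: id_skein_def tensor_web_class comp_web_class juxt_id_stack)
    qed (simp_all add: comp_add_right tensor_add_right tensor_add_left)
  qed (simp_all add: comp_add_left tensor_add_right tensor_add_left)
  then show "id_skein l \<otimes> (f \<circle> g) = (id_skein l \<otimes> f) \<circle> (id_skein l \<otimes> g)"
    and "(f \<circle> g) \<otimes> id_skein l = (f \<otimes> id_skein l) \<circle> (g \<otimes> id_skein l)"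
    by blast+
qed

text \<open>Inserts a local identity between vertical strands. It is total and untyped, so
  composites of inserted pieces rewrite without side conditions; only interchange and the absorption
  of identities ask for membership in \<open>Hom\<close>.\<close>

definition wid :: "sword \<Rightarrow> skein \<Rightarrow> sword \<Rightarrow> skein"
  where "wid l f r = id_skein l \<otimes> f \<otimes> id_skein r"

lemma wid_Nil [simp]: "wid [] f [] = f"
  by (simp add: wid_def)

lemma wid_wid [simp]: "wid l (wid l' f r') r = wid (l @ l') f (r' @ r)"
proof -
  have *: "id_skein a \<otimes> id_skein b \<otimes> g = id_skein (a @ b) \<otimes> g" for a b g
    using tensor_assoc[of "id_skein a" "id_skein b" g] by (simp add: tensor_id_id)
  show ?thesis
    by (simp add: wid_def tensor_assoc tensor_id_id *)
qed

lemma wid_comp: "wid l (f \<circle> g) r = wid l f r \<circle> wid l g r"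
  by (simp add: wid_def tensor_id_comp)

lemma wid_zero [simp]: "wid l 0 r = 0"
  and wid_add: "wid l (f + g) r = wid l f r + wid l g r"
  and wid_diff: "wid l (f - g) r = wid l f r - wid l g r"
  and wid_scale [simp]: "wid l (c \<cdot> f) r = c \<cdot> wid l f r"
  by (simp_all add: wid_def tensor_add_left tensor_add_right tensor_diff_left tensor_diff_right)

lemma wid_id [simp]: "wid l (id_skein s) r = id_skein (l @ s @ r)"
  by (simp add: wid_def tensor_id_id)


subsection \<open>Typing\<close>

lemma id_comp_web_class:
  "id_skein t \<circle> web_class w = (if web_top w = t then web_class w else 0)"
  "web_class w \<circle> id_skein s = (if web_bot w = s then web_class w else 0)"
  using stack_id_web[of w] by (auto simp: id_skein_def comp_web_class)

lemma web_class_in_Hom [intro]: "web_bot w = s \<Longrightarrow> web_top w = t \<Longrightarrow> web_class w \<in> Hom s t"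
  unfolding Hom_def by (rule skein.span_base) auto

lemma Hom_zero [simp, intro]: "0 \<in> Hom s t"
  and Hom_add [intro]: "f \<in> Hom s t \<Longrightarrow> g \<in> Hom s t \<Longrightarrow> f + g \<in> Hom s t"
  and Hom_diff [intro]: "f \<in> Hom s t \<Longrightarrow> g \<in> Hom s t \<Longrightarrow> f - g \<in> Hom s t"
  and Hom_scale [intro]: "f \<in> Hom s t \<Longrightarrow> c \<cdot> f \<in> Hom s t"
  by (simp_all add: Hom_def skein.span_zero skein.span_add skein.span_diff skein.span_scale)

lemma Hom_induct [consumes 1, case_names zero add scale web]:
  assumes "f \<in> Hom s t" "P 0" "\<And>f g. P f \<Longrightarrow> P g \<Longrightarrow> P (f + g)" "\<And>c f. P f \<Longrightarrow> P (c \<cdot> f)"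
    "\<And>w. web_bot w = s \<Longrightarrow> web_top w = t \<Longrightarrow> P (web_class w)"
  shows "P f"
  using assms(1) unfolding Hom_def
proof (induction rule: skein.span_induct_alt)
  case base
  then show ?case using assms by simp
next
  case (step c x y)
  then show ?case using assms by auto
qed

lemma Hom_id_comp: "f \<in> Hom s t \<Longrightarrow> id_skein t \<circle> f = f"
  and Hom_comp_id: "f \<in> Hom s t \<Longrightarrow> f \<circle> id_skein s = f"
  by (induction rule: Hom_induct; simp add: comp_add_left comp_add_right id_comp_web_class)+

text \<open>The skein type is the direct sum of all \<open>Hom\<close> spaces, and composing with
  the two identities projects onto one summand.\<close>

lemma in_HomI:
  assumes "id_skein t \<circle> f \<circle> id_skein s = f"
  shows "f \<in> Hom s t"
proof -
  have "id_skein t \<circle> g \<circle> id_skein s \<in> Hom s t" for g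
  proof (induction g rule: skein_induct)
    case (web w)
    then show ?case by (auto simp: id_comp_web_class)
  qed (auto simp: comp_add_left comp_add_right)
  from this[of f] show ?thesis by (simp add: assms)
qed

lemma Hom_id [intro, simp]: "id_skein s \<in> Hom s s"
  unfolding id_skein_def by (rule web_class_in_Hom) auto

lemma Hom_comp:
  assumes "f \<in> Hom s t" "g \<in> Hom t u"
  shows "g \<circle> f \<in> Hom s u"
  by (rule in_HomI) (use assms in \<open>simp add: comp_skein_assoc Hom_comp_id Hom_id_comp flip: comp_skein_assoc\<close>,
    use assms in \<open>simp add: comp_skein_assoc Hom_comp_id Hom_id_comp\<close>)

lemma Hom_tensor:
  assumes "f \<in> Hom s t" "g \<in> Hom s' t'"
  shows "f \<otimes> g \<in> Hom (s @ s') (t @ t')"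
  using assms(1)
proof (induction rule: Hom_induct)
  case (web w)
  note w = this
  show ?case
    using assms(2)
  proof (induction rule: Hom_induct)
    case (web v)
    then show ?case using w by (auto simp: tensor_web_class)
  qed (auto simp: tensor_add_right)
qed (auto simp: tensor_add_left)

lemma Hom_wid: "f \<in> Hom s t \<Longrightarrow> wid l f r \<in> Hom (l @ s @ r) (l @ t @ r)"
  unfolding wid_def by (intro Hom_tensor Hom_id)

lemma Hom_widI: "f \<in> Hom s t \<Longrightarrow> u = l @ s @ r \<Longrightarrow> v = l @ t @ r \<Longrightarrow> wid l f r \<in> Hom u v"
  using Hom_wid by simp

lemma tensor_exchange:
  assumes "f \<in> Hom s t" "g \<in> Hom s' t'"
  shows "(f \<otimes> id_skein t') \<circle> (id_skein s \<otimes> g) = (id_skein t \<otimes> g) \<circle> (f \<otimes> id_skein s')"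
  using assms(1)
proof (induction rule: Hom_induct)
  case (web w)
  note w = this
  show ?case
    using assms(2)
  proof (induction rule: Hom_induct)
    case (web v)
    then show ?case
      using w juxt_exchange[of w v] by (simp add: tensor_web_class id_skein_def comp_web_class)
  qed (simp_all add: comp_add_left comp_add_right tensor_add_right tensor_add_left)
qed (simp_all add: comp_add_left comp_add_right tensor_add_right tensor_add_left)

lemma wid_exchange:
  assumes "f \<in> Hom s t" "g \<in> Hom s' t'"
  shows "wid l f (m @ t' @ r) \<circle> wid (l @ s @ m) g r = wid (l @ t @ m) g r \<circle> wid l f (m @ s' @ r)"
proof -
  have "wid [] f m \<in> Hom (s @ m) (t @ m)"
    using Hom_wid[OF assms(1), of "[]" m] by simp
  from tensor_exchange[OF this assms(2)]
  have "wid l (wid [] (wid [] f m) t' \<circle> wid (s @ m) g []) r = wid l (wid (t @ m) g [] \<circle> wid [] (wid [] f m) s') r"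
    by (simp add: wid_def[of "[]"] wid_def[of _ _ "[]"])
  then show ?thesis
    by (simp add: wid_comp)
qed

lemma wid_exchangeI:
  assumes "f \<in> Hom s t" "g \<in> Hom s' t'"
    and "l' = l @ s @ m" "l'' = l @ t @ m" "r' = m @ t' @ r" "r'' = m @ s' @ r"
  shows "wid l f r' \<circle> wid l' g r = wid l'' g r \<circle> wid l f r''"
  using wid_exchange[OF assms(1,2)] assms(3-) by simp


subsection \<open>Turning skeins upside down\<close>

definition flip_lin :: "lin_web \<Rightarrow> lin_web"
  where "flip_lin = Poly_Mapping.map_key flip_web"

lemma inj_flip_web: "inj flip_web"
  by (metis flip_web_simps(1) injI)

lemma lookup_flip_lin: "Poly_Mapping.lookup (flip_lin f) w = Poly_Mapping.lookup f (flip_web w)"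
  by (simp add: flip_lin_def map_key.rep_eq inj_flip_web)

lemma flip_lin_add: "flip_lin (f + g) = flip_lin f + flip_lin g"
  and flip_lin_diff: "flip_lin (f - g) = flip_lin f - flip_lin g"
  and flip_lin_scale: "flip_lin (scale_lin c f) = scale_lin c (flip_lin f)"
  and flip_lin_zero [simp]: "flip_lin 0 = 0"
  by (rule poly_mapping_eqI; simp add: lookup_flip_lin lookup_add lookup_minus lookup_scale_lin)+

lemma flip_lin_single: "flip_lin (Poly_Mapping.single w c) = Poly_Mapping.single (flip_web w) c"
  by (rule poly_mapping_eqI) (metis flip_web_simps(1) lookup_flip_lin lookup_single_eq lookup_single_not_eq)

lemma flip_lin_flip [simp]: "flip_lin (flip_lin f) = f"
  by (rule poly_mapping_eqI) (simp add: lookup_flip_lin)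

lemma keys_flip_lin: "Poly_Mapping.keys (flip_lin f) = flip_web ` Poly_Mapping.keys f"
  by (force simp: in_keys_iff lookup_flip_lin intro: image_eqI[of _ _ "flip_web _"])

lemma flip_lin_sum: "flip_lin (\<Sum>x\<in>A. h x) = (\<Sum>x\<in>A. flip_lin (h x))"
  by (induction A rule: infinite_finite_induct) (auto simp: flip_lin_add)

lemma flip_lin_stack: "flip_lin (stack_lin f g) = stack_lin (flip_lin g) (flip_lin f)"
proof -
  have i: "inj_on flip_web A" for A
    using inj_flip_web inj_on_subset by blast
  have "stack_lin (flip_lin g) (flip_lin f) =
    (\<Sum>v\<in>Poly_Mapping.keys g. \<Sum>w\<in>Poly_Mapping.keys f. if web_bot w = web_top v
      then Poly_Mapping.single (flip_web (stack w v)) (Poly_Mapping.lookup f w * Poly_Mapping.lookup g v) else 0)"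
    unfolding stack_lin_def keys_flip_lin
    by (simp add: sum.reindex[OF i] lookup_flip_lin flip_web_stack mult.commute eq_commute cong: if_cong)
  also have "\<dots> = flip_lin (stack_lin f g)"
    unfolding stack_lin_def flip_lin_sum
    by (subst sum.swap) (auto simp: flip_lin_single intro!: sum.cong)
  finally show ?thesis ..
qed

lemma flip_lin_juxt: "flip_lin (juxt_lin f g) = juxt_lin (flip_lin f) (flip_lin g)"
proof -
  have i: "inj_on flip_web A" for A
    using inj_flip_web inj_on_subset by blast
  show ?thesis
    unfolding juxt_lin_def keys_flip_lin flip_lin_sum
    by (simp add: sum.reindex[OF i] lookup_flip_lin flip_web_juxt flip_lin_single)
qed

text \<open>The horizontal edge may be tilted either way: the left vertex is written as a merge over
  a cup, moves up past the right vertex, and the right vertex absorbs the cup. Reflection exchanges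
  the two drawings, so the reflected rung is again a rung.\<close>

lemma Ralt: "stack (juxt (piece_web (Merge x)) (id_web [x])) (juxt (id_web [x]) (piece_web (Split (opp x)))) = rung_web x"
proof -
  have 1: "isotopic ([x, opp x], [] @ [([] @ [x], Cup x, [opp x]), ([], Merge x, opp x # [opp x])] @ [([opp x], Merge (opp x), [])], [opp x, x])
    ([x, opp x], [] @ [([], Split x, [opp x])] @ [([opp x], Merge (opp x), [])], [opp x, x])"
    by (rule isotopic.move[OF isotopy_move.bend_right]) auto
  have 2: "isotopic ([x, opp x], [([x], Cup x, [opp x])] @ [([], Merge x, [] @ piece_bot (Merge (opp x)) @ []), ([] @ piece_top (Merge x) @ [], Merge (opp x), [])] @ [], [opp x, x])
     ([x, opp x], [([x], Cup x, [opp x])] @ [([] @ piece_bot (Merge x) @ [], Merge (opp x), []), ([], Merge x, [] @ piece_top (Merge (opp x)) @ [])] @ [], [opp x, x])"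
    by (rule isotopic.move[OF isotopy_move.exchange]) auto
  have 3: "isotopic ([x, opp x], [] @ [([x], Cup (opp (opp x)), opp x # []), ([x] @ [opp (opp x)], Merge (opp x), [])] @ [([], Merge x, [x])], [opp x, x])
     ([x, opp x], [] @ [([x], Split (opp x), [])] @ [([], Merge x, [x])], [opp x, x])"
    by (rule isotopic.move[OF isotopy_move.bend_left]) auto
  have "isotopic ([x, opp x], [([], Split x, [opp x]), ([opp x], Merge (opp x), [])], [opp x, x])
      ([x, opp x], [([x], Split (opp x), []), ([], Merge x, [x])], [opp x, x])"
    using isotopic.trans[OF isotopic.sym[OF 1[simplified]] isotopic.trans[OF 2[simplified] 3[simplified]]]
    by simp
  from web_of_eqI[OF this] show ?thesis
    by (simp add: rung_web_def id_web_web_of piece_web_web_of juxt_web_of stack_web_of)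
qed

lemma flip_rung_web: "flip_web (rung_web x) = rung_web (opp x)"
  using Ralt[of "opp x"] by (simp add: rung_web_def flip_web_stack flip_web_juxt)

lemma rung_web_ends [simp]: "web_bot (rung_web x) = [x, opp x]" "web_top (rung_web x) = [opp x, x]"
  by (simp_all add: rung_web_def web_ends_stack)

lemma flip_lin_relations: "f \<in> web_relations \<Longrightarrow> flip_lin f \<in> web_relations"
proof (induction rule: web_relations.induct)
  case (loop x)
  show ?case
    using web_relations.loop[of x] by (simp add: flip_lin_diff flip_lin_single loop_web_def flip_web_stack)
next
  case (bigon x)
  show ?case
    using web_relations.bigon[of x] by (simp add: flip_lin_diff flip_lin_single bigon_web_def flip_web_stack)
next
  case (square x)
  show ?case
    using web_relations.square[of x]
    by (simp add: flip_lin_diff flip_lin_add flip_lin_single square_web_def flip_web_stack flip_rung_web)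
qed (simp_all add: web_relations.intros flip_lin_add flip_lin_scale flip_lin_stack flip_lin_juxt)

lift_definition flip_skein :: "skein \<Rightarrow> skein" is flip_lin
  by (metis flip_lin_diff flip_lin_relations)

lemma flip_zero [simp]: "flip_skein 0 = 0"
  and flip_add: "flip_skein (f + g) = flip_skein f + flip_skein g"
  and flip_diff: "flip_skein (f - g) = flip_skein f - flip_skein g"
  and flip_scale: "flip_skein (c \<cdot> f) = c \<cdot> flip_skein f"
  and flip_comp: "flip_skein (f \<circle> g) = flip_skein g \<circle> flip_skein f"
  and flip_tensor: "flip_skein (f \<otimes> h) = flip_skein f \<otimes> flip_skein h"
  and flip_flip [simp]: "flip_skein (flip_skein f) = f"
  by (transfer, simp add: web_relations.zero flip_lin_add flip_lin_diff flip_lin_scale flip_lin_stack flip_lin_juxt)+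

lemma flip_web_class: "flip_skein (web_class w) = web_class (flip_web w)"
  by (simp add: web_class_def flip_skein.abs_eq flip_lin_single)

lemma flip_id [simp]: "flip_skein (id_skein s) = id_skein s"
  by (simp add: id_skein_def flip_web_class)

lemma flip_wid: "flip_skein (wid l f r) = wid l (flip_skein f) r"
  by (simp add: wid_def flip_tensor)

lemma Hom_flip: "f \<in> Hom s t \<Longrightarrow> flip_skein f \<in> Hom t s"
  by (induction rule: Hom_induct) (auto simp: flip_add flip_scale flip_web_class)

section \<open>Local identities\<close>

lemma comp_eq_extend: "a \<circle> b = c \<circle> d \<Longrightarrow> a \<circle> (b \<circle> z) = c \<circle> (d \<circle> z)"
  and comp_eq_absorb: "a \<circle> b = c \<Longrightarrow> a \<circle> (b \<circle> z) = c \<circle> z"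
  by (simp_all flip: comp_skein_assoc)

definition piece_skein :: "piece \<Rightarrow> skein"
  where "piece_skein p = web_class (piece_web p)"

abbreviation "cup x \<equiv> piece_skein (Cup x)"
abbreviation "cap x \<equiv> piece_skein (Cap x)"
abbreviation "mg x \<equiv> piece_skein (Merge x)"
abbreviation "sp x \<equiv> piece_skein (Split x)"

definition rung :: "sgn \<Rightarrow> skein"
  where "rung x = web_class (rung_web x)"

lemma piece_skein_Hom: "piece_skein p \<in> Hom (piece_bot p) (piece_top p)"
  unfolding piece_skein_def by (rule web_class_in_Hom) auto

lemma piece_Hom [intro, simp]:
  "cup x \<in> Hom [] [x, opp x]" "cap x \<in> Hom [x, opp x] []"
  "mg x \<in> Hom [x, x] [opp x]" "sp x \<in> Hom [x] [opp x, opp x]"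
  using piece_skein_Hom[of "Cup x"] piece_skein_Hom[of "Cap x"] piece_skein_Hom[of "Merge x"] piece_skein_Hom[of "Split x"] by simp_all

lemma rung_Hom [intro, simp]: "rung x \<in> Hom [x, opp x] [opp x, x]"
  unfolding rung_def by (rule web_class_in_Hom) auto

lemma cap_opp_Hom [intro, simp]: "cap (opp x) \<in> Hom [opp x, x] []" "cup (opp x) \<in> Hom [] [opp x, x]"
  "mg (opp x) \<in> Hom [opp x, opp x] [x]" "sp (opp x) \<in> Hom [opp x] [x, x]"
  "rung (opp x) \<in> Hom [opp x, x] [x, opp x]"
  using piece_Hom[of "opp x"] rung_Hom[of "opp x"] by simp_all

lemma flip_piece_skein: "flip_skein (piece_skein p) = piece_skein (flip_piece p)"
  by (simp add: piece_skein_def flip_web_class)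

lemma flip_rung: "flip_skein (rung x) = rung (opp x)"
  by (simp add: rung_def flip_web_class flip_rung_web)

lemma wid_piece_skein: "wid l (piece_skein p) r = web_class (web_of (l @ piece_bot p @ r) [(l, p, r)] (l @ piece_top p @ r))"
  by (simp add: wid_def piece_skein_def id_skein_def tensor_web_class piece_web_web_of id_web_web_of juxt_web_of)

lemma web_class_web_of_Nil: "web_class (web_of s [] s) = id_skein s"
  by (simp add: id_skein_def id_web_web_of)

lemma web_class_web_of_Cons:
  assumes "is_diagram s ((l, p, r) # ds) t"
  shows "web_class (web_of s ((l, p, r) # ds) t) = web_class (web_of (l @ piece_top p @ r) ds t) \<circle> wid l (piece_skein p) r"
  using assms stack_web_of[of s "[(l, p, r)]" "l @ piece_top p @ r" ds t]
  by (simp add: wid_piece_skein comp_web_class)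

lemma web_class_web_of_single:
  assumes "is_diagram s [(l, p, r)] t"
  shows "web_class (web_of s [(l, p, r)] t) = wid l (piece_skein p) r"
  using assms by (auto simp: wid_piece_skein)

lemma web_class_web_of_two:
  assumes "is_diagram s [(l, p, r), (l', p', r')] t"
  shows "web_class (web_of s [(l, p, r), (l', p', r')] t) = wid l' (piece_skein p') r' \<circle> wid l (piece_skein p) r"
  unfolding web_class_web_of_Cons[OF assms]
  by (subst web_class_web_of_single) (use assms in auto)

lemma move_skein:
  assumes "isotopy_move ds es" "is_diagram s ds t" "is_diagram s es t"
  shows "web_class (web_of s ds t) = web_class (web_of s es t)"
  by (simp add: web_of_eqI[OF isotopic_move1[OF assms]])

section \<open>Isotopy moves and local relations as equations between skeins\<close>

lemma zigzag_right: "wid [] (cap x) [x] \<circle> wid [x] (cup (opp x)) [] = id_skein [x]"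
  using move_skein[OF isotopy_move.zigzag_right[of "[]" x "[]"], of "[x]" "[x]"]
  by (simp add: web_class_web_of_two web_class_web_of_Nil)

lemma zigzag_left: "wid [x] (cap (opp x)) [] \<circle> wid [] (cup x) [x] = id_skein [x]"
  using move_skein[OF isotopy_move.zigzag_left[of "[]" x "[]"], of "[x]" "[x]"]
  by (simp add: web_class_web_of_two web_class_web_of_Nil)

lemma mg_cup_right: "wid [] (mg x) [opp x] \<circle> wid [x] (cup x) [] = sp x"
  using move_skein[OF isotopy_move.bend_right[of "[]" x "[]"], of "[x]" "[opp x, opp x]"]
  by (simp add: web_class_web_of_two web_class_web_of_single)

lemma mg_cup_left: "wid [opp x] (mg x) [] \<circle> wid [] (cup (opp x)) [x] = sp x"
  using move_skein[OF isotopy_move.bend_left[of "[]" x "[]"], of "[x]" "[opp x, opp x]"]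
  by (simp add: web_class_web_of_two web_class_web_of_single)

lemma cap_sp_right: "wid [opp x] (cap (opp x)) [] \<circle> wid [] (sp x) [x] = mg x"
  using arg_cong[where f = web_class, OF web_of_eqI[OF unbend_right[of "[]" x "[]"]]]
  by (simp add: web_class_web_of_two web_class_web_of_single)

lemma cap_sp_left: "wid [] (cap x) [opp x] \<circle> wid [x] (sp x) [] = mg x"
  using arg_cong[where f = web_class, OF web_of_eqI[OF unbend_left[of "[]" x "[]"]]]
  by (simp add: web_class_web_of_two web_class_web_of_single)

lemma web_class_stack: "web_bot w = web_top v \<Longrightarrow> web_class (stack w v) = web_class w \<circle> web_class v"
  by (simp add: comp_web_class)

lemma web_class_juxt: "web_class (juxt w v) = web_class w \<otimes> web_class v"
  by (simp add: tensor_web_class)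

lemma rung_left: "rung x = wid [opp x] (mg (opp x)) [] \<circle> wid [] (sp x) [opp x]"
  by (simp add: rung_def rung_web_def web_class_stack web_class_juxt wid_def piece_skein_def id_skein_def[symmetric])

lemma rung_right: "rung x = wid [] (mg x) [x] \<circle> wid [x] (sp (opp x)) []"
  unfolding rung_def Ralt[symmetric]
  by (simp add: web_class_stack web_class_juxt wid_def piece_skein_def id_skein_def[symmetric])

lemma skein_relation: "f - g \<in> web_relations \<Longrightarrow> abs_skein f = abs_skein g"
  using Quotient_rel_abs[OF Quotient_skein] by blast

lemma abs_single: "abs_skein (Poly_Mapping.single w c) = c \<cdot> web_class w"
  by (simp add: web_class_def scale_skein.abs_eq scale_lin_def Poly_Mapping.map_single)

lemma loop: "cap x \<circle> cup x = qint 3 \<cdot> id_skein []"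
  using skein_relation[OF web_relations.loop[of x]]
  by (simp add: abs_single loop_web_def web_class_stack piece_skein_def id_skein_def)

lemma bigon: "mg (opp x) \<circle> sp x = (- qint 2) \<cdot> id_skein [x]"
  using skein_relation[OF web_relations.bigon[of x]]
  by (simp add: abs_single bigon_web_def web_class_stack piece_skein_def id_skein_def del: skein.scale_minus_left)

lemma rung_rung: "rung (opp x) \<circle> rung x = id_skein [x, opp x] + cup x \<circle> cap x"
  using skein_relation[OF web_relations.square[of x]]
  by (simp add: abs_single square_web_def web_class_stack piece_skein_def id_skein_def rung_def plus_skein.abs_eq[symmetric])

text \<open>Rotation invariance of the vertex: both sides are one vertex with all three legs
  pointing down.\<close>

lemma cap_mg: "cap y \<circle> wid [y] (mg y) [] = cap (opp y) \<circle> wid [] (mg y) [y]"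
proof -
  have "cap y \<circle> wid [y] (mg y) [] = (wid [] (cap y) [] \<circle> wid [y, opp y] (cap (opp y)) []) \<circle> wid [y] (sp y) [y]"
    by (subst cap_sp_right[symmetric]) (simp add: wid_comp comp_skein_assoc)
  also have "wid [] (cap y) [] \<circle> wid [y, opp y] (cap (opp y)) [] =
      wid [] (cap (opp y)) [] \<circle> wid [] (cap y) [opp y, y]"
    by (rule wid_exchangeI[of _ "[y, opp y]" "[]" _ "[opp y, y]" "[]"]) auto
  also have "\<dots> \<circle> wid [y] (sp y) [y] = cap (opp y) \<circle> wid [] (wid [] (cap y) [opp y] \<circle> wid [y] (sp y) []) [y]"
    by (simp add: wid_comp comp_skein_assoc)
  finally show ?thesis
    by (simp only: cap_sp_left)
qed

lemma cap_rung: "cap (opp x) \<circle> rung x = (- qint 2) \<cdot> cap x"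
proof -
  have "cap (opp x) \<circle> rung x = (cap (opp x) \<circle> wid [opp x] (mg (opp x)) []) \<circle> wid [] (sp x) [opp x]"
    by (simp add: rung_left comp_skein_assoc)
  also have "\<dots> = cap x \<circle> wid [] (mg (opp x) \<circle> sp x) [opp x]"
    by (simp add: cap_mg wid_comp comp_skein_assoc)
  finally show ?thesis
    by (simp add: bigon Hom_comp_id[OF piece_Hom(2)] del: skein.scale_minus_left)
qed

text \<open>A rung whose upper right leg is capped off is a planar tree with two vertices, three
  legs below and one above, hence a composite of two merges. This lets a cap pass down through a
  neighbouring rung.\<close>

lemma cap_rung_right:
  "wid [opp x] (cap x) [] \<circle> wid [] (rung x) [opp x] = mg x \<circle> wid [x] (mg (opp x)) []"
proof -
  have "wid [opp x] (cap x) [] \<circle> wid [] (rung x) [opp x] =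
      wid [opp x] (cap x \<circle> wid [] (mg (opp x)) [opp x]) [] \<circle> wid [] (sp x) [opp x, opp x]"
    by (simp add: rung_left comp_skein_assoc wid_comp)
  also have "cap x \<circle> wid [] (mg (opp x)) [opp x] = cap (opp x) \<circle> wid [opp x] (mg (opp x)) []"
    using cap_mg[of "opp x"] by simp
  also have "wid [opp x] \<dots> [] \<circle> wid [] (sp x) [opp x, opp x] =
      wid [opp x] (cap (opp x)) [] \<circle> (wid [opp x, opp x] (mg (opp x)) [] \<circle> wid [] (sp x) [opp x, opp x])"
    by (simp add: wid_comp comp_skein_assoc)
  also have "wid [opp x, opp x] (mg (opp x)) [] \<circle> wid [] (sp x) [opp x, opp x] =
      wid [] (sp x) [x] \<circle> wid [x] (mg (opp x)) []"
    by (rule wid_exchangeI[of _ "[x]" "[opp x, opp x]" _ "[opp x, opp x]" "[x]", symmetric]) auto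
  finally show ?thesis
    by (simp add: cap_sp_right flip: comp_skein_assoc)
qed

lemma cap_rung_left:
  "wid [] (cap x) [x] \<circle> wid [x] (rung x) [] = mg (opp x) \<circle> wid [] (mg x) [opp x]"
proof -
  have "wid [] (cap x) [x] \<circle> wid [x] (rung x) [] =
      wid [] (cap x \<circle> wid [x] (mg x) []) [x] \<circle> wid [x, x] (sp (opp x)) []"
    by (simp add: rung_right comp_skein_assoc wid_comp)
  also have "\<dots> = wid [] (cap (opp x)) [x] \<circle> (wid [] (mg x) [x, x] \<circle> wid [x, x] (sp (opp x)) [])"
    by (simp add: cap_mg wid_comp comp_skein_assoc)
  also have "wid [] (mg x) [x, x] \<circle> wid [x, x] (sp (opp x)) [] = wid [opp x] (sp (opp x)) [] \<circle> wid [] (mg x) [opp x]"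
    by (rule wid_exchangeI[of _ "[x, x]" "[opp x]" _ "[opp x]" "[x, x]"]) auto
  finally show ?thesis
    using cap_sp_left[of "opp x"] by (simp flip: comp_skein_assoc)
qed

lemma mg_rung:
  "wid [opp x] (mg x) [] \<circle> wid [] (rung x) [x] = wid [] (mg x) [opp x] \<circle> wid [x] (rung (opp x)) []"
proof -
  have "wid [opp x] (mg x) [] \<circle> wid [] (rung x) [x] =
      wid [opp x] (cap x) [opp x] \<circle> ((wid [opp x, x] (sp x) [] \<circle> wid [opp x] (mg (opp x)) [x]) \<circle> wid [] (sp x) [opp x, x])"
    by (subst cap_sp_left[symmetric]) (simp add: rung_left comp_skein_assoc wid_comp)
  also have "wid [opp x, x] (sp x) [] \<circle> wid [opp x] (mg (opp x)) [x] =
      wid [opp x] (mg (opp x)) [opp x, opp x] \<circle> wid [opp x, opp x, opp x] (sp x) []"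
    by (rule wid_exchangeI[of _ "[opp x, opp x]" "[x]" _ "[x]" "[opp x, opp x]", symmetric]) auto
  also have "wid [opp x] (cap x) [opp x] \<circle> (wid [opp x] (mg (opp x)) [opp x, opp x] \<circle> wid [opp x, opp x, opp x] (sp x) [] \<circle> wid [] (sp x) [opp x, x]) =
      wid [opp x] (cap x \<circle> wid [] (mg (opp x)) [opp x]) [opp x] \<circle> (wid [opp x, opp x, opp x] (sp x) [] \<circle> wid [] (sp x) [opp x, x])"
    by (simp add: comp_skein_assoc wid_comp)
  also have "cap x \<circle> wid [] (mg (opp x)) [opp x] = cap (opp x) \<circle> wid [opp x] (mg (opp x)) []"
    using cap_mg[of "opp x"] by simp
  also have "wid [opp x, opp x, opp x] (sp x) [] \<circle> wid [] (sp x) [opp x, x] =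
     wid [] (sp x) [opp x, opp x, opp x] \<circle> wid [x, opp x] (sp x) []"
    by (rule wid_exchangeI[of _ "[x]" "[opp x, opp x]" _ "[x]" "[opp x, opp x]", symmetric]) auto
  also have "wid [opp x] (cap (opp x) \<circle> wid [opp x] (mg (opp x)) []) [opp x] \<circle> (wid [] (sp x) [opp x, opp x, opp x] \<circle> wid [x, opp x] (sp x) []) =
    wid [opp x] (cap (opp x)) [opp x] \<circle> ((wid [opp x, opp x] (mg (opp x)) [opp x] \<circle> wid [] (sp x) [opp x, opp x, opp x]) \<circle> wid [x, opp x] (sp x) [])"
    by (simp add: comp_skein_assoc wid_comp)
  also have "wid [opp x, opp x] (mg (opp x)) [opp x] \<circle> wid [] (sp x) [opp x, opp x, opp x] =
      wid [] (sp x) [x, opp x] \<circle> wid [x] (mg (opp x)) [opp x]"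
    by (rule wid_exchangeI[of _ "[x]" "[opp x, opp x]" _ "[opp x, opp x]" "[x]", symmetric]) auto
  also have "wid [opp x] (cap (opp x)) [opp x] \<circle> (wid [] (sp x) [x, opp x] \<circle> wid [x] (mg (opp x)) [opp x] \<circle> wid [x, opp x] (sp x) []) =
      wid [] (wid [opp x] (cap (opp x)) [] \<circle> wid [] (sp x) [x]) [opp x] \<circle> wid [x] (wid [] (mg (opp x)) [opp x] \<circle> wid [opp x] (sp x) []) []"
    by (simp add: comp_skein_assoc wid_comp)
  finally show ?thesis
    using rung_right[of "opp x"] by (simp only: cap_sp_right opp_opp)
qed

lemma rung_cup: "rung x \<circle> cup x = (- qint 2) \<cdot> cup (opp x)"
  using arg_cong[where f = flip_skein, OF cap_rung[of "opp x"]]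
  by (simp add: flip_comp flip_rung flip_piece_skein flip_scale del: skein.scale_minus_left)

lemma rung_sp:
  "wid [] (rung x) [opp x] \<circle> wid [x] (sp x) [] = wid [opp x] (rung (opp x)) [] \<circle> wid [] (sp x) [x]"
  using arg_cong[where f = flip_skein, OF mg_rung[of "opp x"]]
  by (simp add: flip_comp flip_rung flip_piece_skein flip_wid)

lemma rung_cup_right:
  "wid [] (rung x) [x] \<circle> wid [x] (cup (opp x)) [] = wid [opp x] (sp (opp x)) [] \<circle> sp x"
  using arg_cong[where f = flip_skein, OF cap_rung_right[of "opp x"]]
  by (simp add: flip_comp flip_rung flip_piece_skein flip_wid)

text \<open>Taking a strand across a split by two rungs closes a square face, and the two summands
  are its smoothings. This is what happens to a split under the middle of a comb with two
  rungs.\<close>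

lemma rung_rung_sp:
  "wid [opp x] (rung x) [] \<circle> (wid [] (rung x) [opp x] \<circle> wid [x] (sp x) []) =
    wid [] (sp x) [x] + wid [opp x] (cup (opp x)) [] \<circle> mg x"
proof -
  have "wid [opp x] (rung x) [] \<circle> (wid [] (rung x) [opp x] \<circle> wid [x] (sp x) []) =
      wid [opp x] (rung (opp (opp x)) \<circle> rung (opp x)) [] \<circle> wid [] (sp x) [x]"
    by (simp add: rung_sp wid_comp comp_skein_assoc)
  also have "\<dots> = wid [opp x] (id_skein [opp x, x]) [] \<circle> wid [] (sp x) [x]
       + wid [opp x] (cup (opp x)) [] \<circle> (wid [opp x] (cap (opp x)) [] \<circle> wid [] (sp x) [x])"
    by (simp add: rung_rung wid_add comp_add_left wid_comp comp_skein_assoc del: opp_opp, simp)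
  finally show ?thesis
    by (simp add: cap_sp_right Hom_id_comp[OF Hom_widI[OF piece_Hom(4)]])
qed

section \<open>Reducing the width of webs\<close>

text \<open>
  A comb lets the first strand cross the middle ones along rungs and then merges it with the last.
  Pushing caps and merges down through rungs produces combs, so descents have to include them.
\<close>

primrec comb :: "sgn \<Rightarrow> nat \<Rightarrow> skein"
  where
    "comb x 0 = mg x"
  | "comb x (Suc n) = wid [opp x] (comb x n) [] \<circle> wid [] (rung x) (replicate n (opp x) @ [x])"

lemma replicate_snoc [simp]: "replicate n x @ x # xs = x # replicate n x @ xs"
  by (induction n) auto

lemma comb_Hom [intro, simp]:
  "comb x n \<in> Hom (x # replicate n (opp x) @ [x]) (opp x # replicate n (opp x))"
proof (induction n)
  case (Suc n)
  show ?case
    unfolding comb.simps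
    by (rule Hom_comp[OF Hom_widI Hom_widI[OF Suc.IH]]) (auto intro: rung_Hom)
qed auto

text \<open>A comb reads the same from both ends, so rungs can be split off or added on either side.
  The identity \<open>mg_rung\<close> enters once, at the base; the induction step only exchanges
  distant rungs.\<close>

lemma comb_Suc_right:
  "comb x (Suc n) = wid [] (comb x n) [opp x] \<circle> wid (x # replicate n (opp x)) (rung (opp x)) []"
proof (induction n)
  case 0
  show ?case by (simp add: mg_rung)
next
  case (Suc n)
  let ?o = "replicate n (opp x)"
  have "comb x (Suc (Suc n)) = wid [opp x] (comb x n) [opp x] \<circle>
      (wid (opp x # x # ?o) (rung (opp x)) [] \<circle> wid [] (rung x) (opp x # ?o @ [x]))"
    by (subst comb.simps(2), subst Suc.IH) (simp add: wid_comp comp_skein_assoc)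
  also have "wid (opp x # x # ?o) (rung (opp x)) [] \<circle> wid [] (rung x) (opp x # ?o @ [x]) =
      wid [] (rung x) (?o @ [x, opp x]) \<circle> wid (x # opp x # ?o) (rung (opp x)) []"
    by (rule wid_exchangeI[of _ "[x, opp x]" "[opp x, x]" _ "[opp x, x]" "[x, opp x]", symmetric]) auto
  finally show ?case
    by (simp add: wid_comp comp_skein_assoc)
qed

inductive move :: "sword \<Rightarrow> sword \<Rightarrow> skein \<Rightarrow> bool"
  where
    piece: "move (l @ piece_bot p @ r) (l @ piece_top p @ r) (wid l (piece_skein p) r)"
  | rung: "move (l @ [x, opp x] @ r) (l @ [opp x, x] @ r) (wid l (rung x) r)"

text \<open>The bound \<open>k\<close> applies to every word that is passed on the way, including both ends.\<close>

inductive narrow :: "nat \<Rightarrow> sword \<Rightarrow> sword \<Rightarrow> skein \<Rightarrow> bool" for k s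
  where
    id: "length s \<le> k \<Longrightarrow> narrow k s s (id_skein s)"
  | zero: "narrow k s t 0"
  | add: "narrow k s t f \<Longrightarrow> narrow k s t g \<Longrightarrow> narrow k s t (f + g)"
  | scale: "narrow k s t f \<Longrightarrow> narrow k s t (c \<cdot> f)"
  | step: "narrow k s t f \<Longrightarrow> move t t' m \<Longrightarrow> length t' \<le> k \<Longrightarrow> narrow k s t' (m \<circle> f)"

inductive descent :: "sword \<Rightarrow> sword \<Rightarrow> skein \<Rightarrow> bool"
  where
    cap: "descent (l @ [x, opp x] @ r) (l @ r) (wid l (cap x) r)"
  | comb: "descent (l @ (x # replicate n (opp x) @ [x]) @ r) (l @ (opp x # replicate n (opp x)) @ r) (wid l (comb x n) r)"

text \<open>Meant for \<open>t\<close> of length \<open>Suc k\<close>: the descent leaves the word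
  that is too long, and all that follows respects the bound.\<close>

inductive descent_span :: "nat \<Rightarrow> sword \<Rightarrow> sword \<Rightarrow> skein \<Rightarrow> bool" for k t v
  where
    zero: "descent_span k t v 0"
  | add: "descent_span k t v f \<Longrightarrow> descent_span k t v g \<Longrightarrow> descent_span k t v (f + g)"
  | comp: "descent t u d \<Longrightarrow> narrow k u v h \<Longrightarrow> descent_span k t v (h \<circle> d)"

lemma move_Hom: "move s t m \<Longrightarrow> m \<in> Hom s t"
  by (induction rule: move.induct) (auto intro!: Hom_wid piece_skein_Hom rung_Hom simp del: append_Cons)

lemma narrow_Hom: "narrow k s t f \<Longrightarrow> f \<in> Hom s t"
  by (induction rule: narrow.induct) (auto intro: Hom_comp move_Hom)

lemma narrow_comp: "narrow k t u g \<Longrightarrow> narrow k s t f \<Longrightarrow> narrow k s u (g \<circle> f)"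
proof (induction rule: narrow.induct)
  case id
  then show ?case by (simp add: Hom_id_comp[OF narrow_Hom])
qed (auto simp: comp_add_left comp_skein_assoc intro: narrow.intros)

lemma narrow_move: "move s t m \<Longrightarrow> length s \<le> k \<Longrightarrow> length t \<le> k \<Longrightarrow> narrow k s t m"
  using narrow.step[OF narrow.id] Hom_comp_id[OF move_Hom] by metis

lemma narrow_piece:
  "s = l @ piece_bot p @ r \<Longrightarrow> t = l @ piece_top p @ r \<Longrightarrow> length s \<le> k \<Longrightarrow> length t \<le> k \<Longrightarrow>
    narrow k s t (wid l (piece_skein p) r)"
  using narrow_move[OF move.piece] by simp

lemma narrow_rung:
  "s = l @ [x, opp x] @ r \<Longrightarrow> t = l @ [opp x, x] @ r \<Longrightarrow> length s \<le> k \<Longrightarrow>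
    narrow k s t (wid l (rung x) r)"
  using narrow_move[OF move.rung] by simp

lemma narrow_comb:
  "length (l @ (x # replicate n (opp x) @ [x]) @ r) \<le> k \<Longrightarrow>
    narrow k (l @ (x # replicate n (opp x) @ [x]) @ r) (l @ (opp x # replicate n (opp x)) @ r) (wid l (comb x n) r)"
proof (induction n arbitrary: l)
  case 0
  then show ?case by (auto intro!: narrow_piece)
next
  case (Suc n)
  have "narrow k (l @ (x # replicate (Suc n) (opp x) @ [x]) @ r)
     ((l @ [opp x]) @ (x # replicate n (opp x) @ [x]) @ r) (wid l (rung x) (replicate n (opp x) @ [x] @ r))"
    using Suc.prems by (intro narrow_rung) auto
  from narrow_comp[OF Suc.IH this] Suc.prems
  show ?case by (simp add: wid_comp)
qed

lemma descent_narrow: "descent t v d \<Longrightarrow> length t \<le> k \<Longrightarrow> narrow k t v d"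
  by (induction rule: descent.induct) (auto intro!: narrow_piece narrow_comb[simplified])

lemma descent_Hom: "descent t v d \<Longrightarrow> d \<in> Hom t v"
  using descent_narrow narrow_Hom by blast

lemma descent_span_Hom: "descent_span k t v f \<Longrightarrow> f \<in> Hom t v"
  by (induction rule: descent_span.induct) (auto intro: Hom_comp descent_Hom narrow_Hom)

lemma descent_span_comp: "descent_span k t v f \<Longrightarrow> narrow k v w g \<Longrightarrow> descent_span k t w (g \<circle> f)"
  by (induction rule: descent_span.induct)
    (auto simp: comp_add_right intro: descent_span.intros narrow_comp simp flip: comp_skein_assoc)

lemma descent_span_scale: "descent_span k t v f \<Longrightarrow> descent_span k t v (c \<cdot> f)"
proof (induction rule: descent_span.induct)
  case (comp u d h)
  then show ?case
    using descent_span.comp[OF comp(1) narrow.scale[OF comp(2), of c]] by simp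
qed (auto simp: skein.scale_right_distrib intro: descent_span.intros)

lemma descent_length: "descent t v d \<Longrightarrow> length v < length t"
  by (induction rule: descent.induct) auto

lemma descent_span_descent:
  assumes "descent t v d" "length t = Suc k"
  shows "descent_span k t v d"
  using descent_span.comp[OF assms(1) narrow.id] descent_length[OF assms(1)] assms(2)
    Hom_id_comp[OF descent_Hom[OF assms(1)]] by simp


subsection \<open>Overlaps of words\<close>

lemma append_eq_prefix: "a @ b = c @ d \<Longrightarrow> length a \<le> length c \<Longrightarrow> \<exists>m. c = a @ m \<and> b = m @ d"
  by (metis append_eq_append_conv2 append_eq_append_conv_if append_take_drop_id)

lemma append_eq_suffix: "a @ b = c @ d \<Longrightarrow> length b \<le> length d \<Longrightarrow> \<exists>m. d = m @ b \<and> a = c @ m"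
  using append_eq_prefix[of c d a b] by (metis (no_types, lifting) add_le_cancel_right add_le_mono le_trans length_append linorder_le_cases nat_add_left_cancel_le)

lemma overlap_pair:
  assumes "l @ [a, b] @ r = l' @ [c, d] @ r'"
  obtains
    (far_right) m where "l' = l @ [a, b] @ m" "r = m @ [c, d] @ r'"
  | (far_left) m where "l = l' @ [c, d] @ m" "r' = m @ [a, b] @ r"
  | (same) "l' = l" "r' = r" "c = a" "d = b"
  | (left) "l = l' @ [c]" "d = a" "r' = b # r"
  | (right) "l' = l @ [a]" "c = b" "r = d # r'"
proof -
  consider "length l' + 2 \<le> length l" | "length l' + 1 = length l" | "length l' = length l"
    | "length l' = length l + 1" | "length l' \<ge> length l + 2" by linarith
  then show thesis
  proof cases
    case 1
    with append_eq_prefix[of "l' @ [c, d]" r' l "[a, b] @ r"] assms show ?thesis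
      by (auto intro: far_left)
  next
    case 2
    with append_eq_prefix[of "l' @ [c]" "d # r'" l "[a, b] @ r"] assms show ?thesis
      by (auto intro: left)
  next
    case 3
    with assms show ?thesis by (auto intro: same)
  next
    case 4
    with append_eq_prefix[of "l @ [a]" "b # r" l' "[c, d] @ r'"] assms show ?thesis
      by (auto intro: right)
  next
    case 5
    with append_eq_prefix[of "l @ [a, b]" r l' "[c, d] @ r'"] assms show ?thesis
      by (auto intro: far_right)
  qed
qed


subsection \<open>Descents above cups and splits\<close>

fun is_up :: "piece \<Rightarrow> bool"
  where
    "is_up (Cup x) = True"
  | "is_up (Split x) = True"
  | "is_up _ = False"

text \<open>The sign in the split case is chosen so that the upper words are
  \<open>[y, opp y]\<close> and \<open>[y, y]\<close>, the shapes that occur below caps and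
  merges.\<close>

lemma is_up_cases [consumes 1, case_names Cup Split]:
  assumes "is_up p"
  obtains y where "p = Cup y" | y where "p = Split (opp y)"
  by (cases p) (use assms that opp_opp in \<open>auto, metis\<close>)

text \<open>On disjoint strands the descent can be done first, and then the word is shortened before
  the cup or split lengthens it.\<close>

lemma far_right_up:
  assumes C: "C \<in> Hom A A'" "\<And>l r. length (l @ A @ r) \<le> k \<Longrightarrow> narrow k (l @ A @ r) (l @ A' @ r) (wid l C r)"
    and "length A' < length A" and p: "is_up p" and len: "length (l @ A @ m @ piece_top p @ r) \<le> Suc k"
  shows "narrow k (l @ A @ m @ piece_bot p @ r) (l @ A' @ m @ piece_top p @ r)
      (wid l C (m @ piece_top p @ r) \<circle> wid (l @ A @ m) (piece_skein p) r)"
proof -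
  have lt: "length (piece_bot p) < length (piece_top p)"
    using p by (cases rule: is_up_cases) auto
  have "wid l C (m @ piece_top p @ r) \<circle> wid (l @ A @ m) (piece_skein p) r =
      wid (l @ A' @ m) (piece_skein p) r \<circle> wid l C (m @ piece_bot p @ r)"
    by (rule wid_exchange[OF C(1) piece_skein_Hom])
  moreover have "narrow k (l @ A' @ m @ piece_bot p @ r) (l @ A' @ m @ piece_top p @ r) (wid (l @ A' @ m) (piece_skein p) r)"
    using assms(3) len lt by (intro narrow_piece) auto
  moreover have "narrow k (l @ A @ m @ piece_bot p @ r) (l @ A' @ m @ piece_bot p @ r) (wid l C (m @ piece_bot p @ r))"
    using C(2)[of l "m @ piece_bot p @ r"] len lt by auto
  ultimately show ?thesis
    using narrow_comp by simp
qed

lemma far_left_up: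
  assumes C: "C \<in> Hom A A'" "\<And>l r. length (l @ A @ r) \<le> k \<Longrightarrow> narrow k (l @ A @ r) (l @ A' @ r) (wid l C r)"
    and "length A' < length A" and p: "is_up p" and len: "length (l @ piece_top p @ m @ A @ r) \<le> Suc k"
  shows "narrow k (l @ piece_bot p @ m @ A @ r) (l @ piece_top p @ m @ A' @ r)
      (wid (l @ piece_top p @ m) C r \<circle> wid l (piece_skein p) (m @ A @ r))"
proof -
  have lt: "length (piece_bot p) < length (piece_top p)"
    using p by (cases rule: is_up_cases) auto
  have "wid (l @ piece_top p @ m) C r \<circle> wid l (piece_skein p) (m @ A @ r) =
      wid l (piece_skein p) (m @ A' @ r) \<circle> wid (l @ piece_bot p @ m) C r"
    by (rule wid_exchange[OF piece_skein_Hom C(1), symmetric])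
  moreover have "narrow k (l @ piece_bot p @ m @ A' @ r) (l @ piece_top p @ m @ A' @ r) (wid l (piece_skein p) (m @ A' @ r))"
    using assms(3) len lt by (intro narrow_piece) auto
  moreover have "narrow k (l @ piece_bot p @ m @ A @ r) (l @ piece_bot p @ m @ A' @ r) (wid (l @ piece_bot p @ m) C r)"
    using C(2)[of "l @ piece_bot p @ m" r] len lt by auto
  ultimately show ?thesis
    using narrow_comp by simp
qed

lemma wid_eq: "a \<circle> b = c \<Longrightarrow> wid l a r \<circle> wid l b r = wid l c r"
  by (simp flip: wid_comp)

text \<open>A cap on both new letters closes a loop, since the two equal letters above a split do
  not fit under a cap. With one shared letter, a cup gives a zigzag and a split gives a
  merge.\<close>

lemma cap_up:
  assumes up: "is_up p" and t: "l @ [x, opp x] @ r = l' @ piece_top p @ r'"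
    and len: "length (l @ [x, opp x] @ r) = Suc k"
  shows "narrow k (l' @ piece_bot p @ r') (l @ r) (wid l (cap x) r \<circle> wid l' (piece_skein p) r')"
proof -
  obtain c d where cd: "piece_top p = [c, d]"
    using up by (cases rule: is_up_cases) auto
  have nc: "length (l @ [x, opp x] @ r) \<le> k \<Longrightarrow> narrow k (l @ [x, opp x] @ r) (l @ [] @ r) (wid l (cap x) r)" for l r
    by (intro narrow_piece) auto
  from t[unfolded cd] show ?thesis
  proof (cases rule: overlap_pair)
    case (far_right m)
    then show ?thesis
      using far_right_up[OF _ nc, where l = l and m = m and p = p and r = r'] up len cd by simp
  next
    case (far_left m)
    then show ?thesis
      using far_left_up[OF _ nc, where l = l' and m = m and p = p and r = r] up len cd by simp
  next
    case same
    with up cd have p: "p = Cup x"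
      by (cases rule: is_up_cases) auto
    have "wid l (cap x) r \<circle> wid l (cup x) r = qint 3 \<cdot> id_skein (l @ r)"
      using wid_eq[OF loop, of l x r] by simp
    then show ?thesis
      using same p len by (auto intro!: narrow.scale narrow.id)
  next
    case left
    show ?thesis
    proof (cases rule: is_up_cases[OF up])
      case (1 y)
      then have y: "y = opp x" "c = opp x" using cd left by auto
      have "wid (l' @ [opp x]) (cap x) r \<circle> wid l' (cup (opp x)) (opp x # r) = id_skein (l' @ [opp x] @ r)"
        using wid_eq[OF zigzag_left[of "opp x"], of l' r] by simp
      then show ?thesis
        using left 1 y len by (auto intro!: narrow.id)
    next
      case (2 y)
      then have y: "y = x" "c = x" using cd left by auto
      have "wid (l' @ [x]) (cap x) r \<circle> wid l' (sp (opp x)) (opp x # r) = wid l' (mg (opp x)) r"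
        using wid_eq[OF cap_sp_right[of "opp x"], of l' r] by simp
      then show ?thesis
        using left 2 y len by (auto intro!: narrow_piece)
    qed
  next
    case right
    show ?thesis
    proof (cases rule: is_up_cases[OF up])
      case (1 y)
      then have y: "y = opp x" "d = x" using cd right by auto
      have "wid l (cap x) (x # r') \<circle> wid (l @ [x]) (cup (opp x)) r' = id_skein (l @ [x] @ r')"
        using wid_eq[OF zigzag_right[of x], of l r'] by simp
      then show ?thesis
        using right 1 y len by (auto intro!: narrow.id)
    next
      case (2 y)
      then have y: "y = opp x" "d = opp x" using cd right by auto
      have "wid l (cap x) (opp x # r') \<circle> wid (l @ [x]) (sp x) r' = wid l (mg x) r'"
        using wid_eq[OF cap_sp_left[of x], of l r'] by simp
      then show ?thesis
        using right 2 y len by (auto intro!: narrow_piece)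
    qed
  qed
qed

text \<open>A merge on both new letters closes a bigon. With one shared letter, a cup bends the
  merge into a split, and a split turns it into a rung; the rung is admissible because it keeps the
  length \<open>k\<close> of the word below the split.\<close>

lemma mg_up:
  assumes up: "is_up p" and t: "l @ [x, x] @ r = l' @ piece_top p @ r'"
    and len: "length (l @ [x, x] @ r) = Suc k"
  shows "narrow k (l' @ piece_bot p @ r') (l @ [opp x] @ r) (wid l (mg x) r \<circle> wid l' (piece_skein p) r')"
proof -
  obtain c d where cd: "piece_top p = [c, d]"
    using up by (cases rule: is_up_cases) auto
  have nc: "length (l @ [x, x] @ r) \<le> k \<Longrightarrow> narrow k (l @ [x, x] @ r) (l @ [opp x] @ r) (wid l (mg x) r)" for l r
    by (intro narrow_piece) auto
  from t[unfolded cd] show ?thesis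
  proof (cases rule: overlap_pair)
    case (far_right m)
    then show ?thesis
      using far_right_up[OF _ nc, where l = l and m = m and p = p and r = r'] up len cd by simp
  next
    case (far_left m)
    then show ?thesis
      using far_left_up[OF _ nc, where l = l' and m = m and p = p and r = r] up len cd by simp
  next
    case same
    with up cd have p: "p = Split (opp x)"
      by (cases rule: is_up_cases) auto
    have "wid l (mg x) r \<circle> wid l (sp (opp x)) r = (- qint 2) \<cdot> id_skein (l @ [opp x] @ r)"
      using wid_eq[OF bigon[of "opp x"], of l r] by (simp del: skein.scale_minus_left)
    then show ?thesis
      using same p len narrow.scale[OF narrow.id[of "l @ [opp x] @ r" k], of "- qint 2"]
      by (simp del: skein.scale_minus_left)
  next
    case left
    show ?thesis
    proof (cases rule: is_up_cases[OF up])
      case (1 y)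
      then have y: "y = opp x" "c = opp x" using cd left by auto
      have "wid (l' @ [opp x]) (mg x) r \<circle> wid l' (cup (opp x)) (x # r) = wid l' (sp x) r"
        using wid_eq[OF mg_cup_left[of x], of l' r] by simp
      then show ?thesis
        using left 1 y len by (auto intro!: narrow_piece)
    next
      case (2 y)
      then have y: "y = x" "c = x" using cd left by auto
      have "wid (l' @ [x]) (mg x) r \<circle> wid l' (sp (opp x)) (x # r) = wid l' (rung (opp x)) r"
        using wid_eq[OF rung_left[of "opp x", symmetric], of l' r] by simp
      then show ?thesis
        using left 2 y len by (auto intro!: narrow_rung)
    qed
  next
    case right
    show ?thesis
    proof (cases rule: is_up_cases[OF up])
      case (1 y)
      then have y: "y = x" "d = opp x" using cd right by auto
      have "wid l (mg x) (opp x # r') \<circle> wid (l @ [x]) (cup x) r' = wid l (sp x) r'"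
        using wid_eq[OF mg_cup_right[of x], of l r'] by simp
      then show ?thesis
        using right 1 y len by (auto intro!: narrow_piece)
    next
      case (2 y)
      then have y: "y = x" "d = x" using cd right by auto
      have "wid l (mg x) (x # r') \<circle> wid (l @ [x]) (sp (opp x)) r' = wid l (rung x) r'"
        using wid_eq[OF rung_right[of x, symmetric], of l r'] by simp
      then show ?thesis
        using right 2 y len by (auto intro!: narrow_rung)
    qed
  qed
qed

lemma comb_two_sp:
  "comb x 2 \<circle> wid [x] (sp x) [x] =
    wid [] (sp x) [opp x] \<circle> wid [x] (mg x) [] + wid [opp x] (sp x) [] \<circle> wid [] (mg x) [x]"
proof -
  have "comb x 2 \<circle> wid [x] (sp x) [x] = wid [opp x, opp x] (mg x) [] \<circle>
      wid [] (wid [opp x] (rung x) [] \<circle> (wid [] (rung x) [opp x] \<circle> wid [x] (sp x) [])) [x]"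
    by (simp add: numeral_2_eq_2 wid_comp comp_skein_assoc)
  also have "\<dots> = wid [opp x, opp x] (mg x) [] \<circle> wid [] (sp x) [x, x]
      + wid [opp x] (wid [opp x] (mg x) [] \<circle> wid [] (cup (opp x)) [x]) [] \<circle> wid [] (mg x) [x]"
    by (simp add: rung_rung_sp wid_add wid_comp comp_add_right comp_skein_assoc)
  also have "wid [opp x, opp x] (mg x) [] \<circle> wid [] (sp x) [x, x] = wid [] (sp x) [opp x] \<circle> wid [x] (mg x) []"
    by (rule wid_exchangeI[of _ "[x]" "[opp x, opp x]" _ "[x, x]" "[opp x]", symmetric]) auto
  finally show ?thesis
    by (simp add: mg_cup_left)
qed

lemma comb_one_cup:
  "comb x 1 \<circle> wid [] (cup x) [x] = (- qint 2) \<cdot> sp x"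
  "comb x 1 \<circle> wid [x] (cup (opp x)) [] = (- qint 2) \<cdot> sp x"
proof -
  have "comb x 1 \<circle> wid [] (cup x) [x] = wid [opp x] (mg x) [] \<circle> wid [] (rung x \<circle> cup x) [x]"
    by (simp add: wid_comp comp_skein_assoc)
  then show "comb x 1 \<circle> wid [] (cup x) [x] = (- qint 2) \<cdot> sp x"
    by (simp add: rung_cup mg_cup_left del: skein.scale_minus_left)
  have "comb x 1 \<circle> wid [x] (cup (opp x)) [] = wid [] (mg x) [opp x] \<circle> wid [x] (rung (opp x) \<circle> cup (opp x)) []"
    using comb_Suc_right[of x 0] by (simp add: wid_comp comp_skein_assoc)
  then show "comb x 1 \<circle> wid [x] (cup (opp x)) [] = (- qint 2) \<cdot> sp x"
    by (simp add: rung_cup mg_cup_right del: skein.scale_minus_left)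
qed

text \<open>Rungs are peeled off at whichever end is far from the cup or split. As the piece is two
  letters wide, what remains is a merge, a comb with one rung over a cup, or a comb with two rungs
  over a split of its two middle letters. The last case is the square relation in
  \<open>comb_two_sp\<close>.\<close>

lemma comb_up:
  assumes "is_up p" "l @ (x # replicate n (opp x) @ [x]) @ r = l' @ piece_top p @ r'"
    and "length (l @ (x # replicate n (opp x) @ [x]) @ r) = Suc k"
  shows "narrow k (l' @ piece_bot p @ r') (l @ (opp x # replicate n (opp x)) @ r)
    (wid l (comb x n) r \<circle> wid l' (piece_skein p) r')"
  using assms
proof (induction n arbitrary: l r l' r')
  case 0
  then show ?case
    using mg_up[of p l x r l' r' k] by simp
next
  case (Suc n)
  note up = Suc.prems(1) and t = Suc.prems(2) and len = Suc.prems(3)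
  let ?o = "replicate n (opp x)"
  have lt: "length (piece_bot p) < length (piece_top p)" and l2: "length (piece_top p) = 2"
    using up by (cases rule: is_up_cases; simp)+
  consider (a) "length l + 2 \<le> length l'" | (b) "length r + 2 \<le> length r'"
    | (c) "length l' < length l + 2" "length r' < length r + 2" by linarith
  then show ?case
  proof cases
    case a
    then obtain m where m: "l' = l @ [x, opp x] @ m" "?o @ [x] @ r = m @ piece_top p @ r'"
      using append_eq_prefix[of "l @ [x, opp x]" "?o @ [x] @ r" l' "piece_top p @ r'"] t by auto
    have "wid l (comb x (Suc n)) r \<circle> wid l' (piece_skein p) r' =
      wid (l @ [opp x]) (comb x n) r \<circle> (wid l (rung x) (m @ piece_top p @ r') \<circle> wid (l @ [x, opp x] @ m) (piece_skein p) r')"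
      by (simp add: wid_comp comp_skein_assoc m flip: m(2))
    also have "wid l (rung x) (m @ piece_top p @ r') \<circle> wid (l @ [x, opp x] @ m) (piece_skein p) r' =
        wid (l @ [opp x, x] @ m) (piece_skein p) r' \<circle> wid l (rung x) (m @ piece_bot p @ r')"
      by (rule wid_exchange[OF rung_Hom piece_skein_Hom])
    finally have e: "wid l (comb x (Suc n)) r \<circle> wid l' (piece_skein p) r' =
      (wid (l @ [opp x]) (comb x n) r \<circle> wid (l @ [opp x, x] @ m) (piece_skein p) r') \<circle> wid l (rung x) (m @ piece_bot p @ r')"
      by (simp add: comp_skein_assoc)
    have "narrow k ((l @ [opp x, x] @ m) @ piece_bot p @ r') ((l @ [opp x]) @ (opp x # ?o) @ r)
        (wid (l @ [opp x]) (comb x n) r \<circle> wid (l @ [opp x, x] @ m) (piece_skein p) r')"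
      by (rule Suc.IH[OF up]) (use m len in auto)
    moreover have "narrow k (l' @ piece_bot p @ r') ((l @ [opp x, x] @ m) @ piece_bot p @ r') (wid l (rung x) (m @ piece_bot p @ r'))"
      using len lt arg_cong[OF t, of length] by (intro narrow_rung) (auto simp: m)
    ultimately show ?thesis
      unfolding e by (auto dest: narrow_comp)
  next
    case b
    have "(l @ x # ?o) @ [opp x, x] @ r = (l' @ piece_top p) @ r'"
      using t by simp
    with b obtain m where m: "r' = m @ [opp x, x] @ r" "l @ x # ?o = l' @ piece_top p @ m"
      using append_eq_suffix[of "l @ x # ?o" "[opp x, x] @ r" "l' @ piece_top p" r'] by auto
    have "wid l (comb x (Suc n)) r \<circle> wid l' (piece_skein p) r' =
      wid l (comb x n) (opp x # r) \<circle> (wid (l' @ piece_top p @ m) (rung (opp x)) r \<circle> wid l' (piece_skein p) (m @ [opp x, x] @ r))"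
      by (simp add: comb_Suc_right wid_comp comp_skein_assoc m(1) del: comb.simps append_assoc flip: m(2))
    also have "wid (l' @ piece_top p @ m) (rung (opp x)) r \<circle> wid l' (piece_skein p) (m @ [opp x, x] @ r) =
        wid l' (piece_skein p) (m @ [x, opp x] @ r) \<circle> wid (l' @ piece_bot p @ m) (rung (opp x)) r"
      using wid_exchange[OF piece_skein_Hom rung_Hom[of "opp x"], of l' p m r] by simp
    finally have e: "wid l (comb x (Suc n)) r \<circle> wid l' (piece_skein p) r' =
      (wid l (comb x n) (opp x # r) \<circle> wid l' (piece_skein p) (m @ [x, opp x] @ r)) \<circle> wid (l' @ piece_bot p @ m) (rung (opp x)) r"
      by (simp add: comp_skein_assoc)
    have "narrow k (l' @ piece_bot p @ (m @ [x, opp x] @ r)) (l @ (opp x # ?o) @ (opp x # r))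
        (wid l (comb x n) (opp x # r) \<circle> wid l' (piece_skein p) (m @ [x, opp x] @ r))"
      by (rule Suc.IH[OF up]) (use m len in \<open>auto simp flip: append_assoc\<close>)
    moreover have "narrow k (l' @ piece_bot p @ r') (l' @ piece_bot p @ (m @ [x, opp x] @ r)) (wid (l' @ piece_bot p @ m) (rung (opp x)) r)"
      using len lt arg_cong[OF t, of length] by (intro narrow_rung) (auto simp: m)
    ultimately show ?thesis
      unfolding e by (auto dest: narrow_comp)
  next
    case c
    \<comment> \<open>The comb spans \<open>n + 3\<close> letters and the piece two. Both ends being
      near leaves no room for \<open>n\<close> above 1.\<close>
    have "length l' + length r' = length l + length r + n + 1"
      using arg_cong[OF t, of length] l2 by simp
    with c consider (c1) "n = 0" "length l' = length l" | (c2) "n = 0" "length l' = length l + 1"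
      | (c3) "n = 1" "length l' = length l + 1" by linarith
    then show ?thesis
    proof cases
      case c1
      then have "l' = l" "piece_top p @ r' = [x, opp x, x] @ r" using t by auto
      with up have p: "p = Cup x" "r' = x # r"
        by (cases rule: is_up_cases; auto)+
      show ?thesis
        using wid_eq[OF comb_one_cup(1)[of x], of l r] len narrow_piece[of _ l "Split x" r]
        by (auto simp: c1 p \<open>l' = l\<close> simp del: skein.scale_minus_left comb.simps intro!: narrow.scale narrow_piece)
    next
      case c2
      then have l': "l' = l @ [x]" "piece_top p @ r' = [opp x, x] @ r"
        using t append_eq_prefix[of "l @ [x]" "[opp x, x] @ r" l' "piece_top p @ r'"] by auto
      with up have p: "p = Cup (opp x)" "r' = r"
        by (cases rule: is_up_cases; auto)+
      show ?thesis
        using wid_eq[OF comb_one_cup(2)[of x], of l r] len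
        by (auto simp: c2 p l' simp del: skein.scale_minus_left comb.simps intro!: narrow.scale narrow_piece)
    next
      case c3
      then have l': "l' = l @ [x]" "piece_top p @ r' = [opp x, opp x, x] @ r"
        using t append_eq_prefix[of "l @ [x]" "[opp x, opp x, x] @ r" l' "piece_top p @ r'"] by auto
      with up have p: "p = Split x" "r' = x # r"
        by (cases rule: is_up_cases; auto)+
      have "narrow k (l @ [x, x, x] @ r) (l @ [opp x, opp x, opp x] @ r)
          (wid l (wid [] (sp x) [opp x]) r \<circle> wid l (wid [x] (mg x) []) r + wid l (wid [opp x] (sp x) []) r \<circle> wid l (wid [] (mg x) [x]) r)"
        unfolding wid_wid
        by (intro narrow.add narrow_comp[of k "l @ [x, opp x] @ r"] narrow_comp[of k "l @ [opp x, x] @ r"] narrow_piece) (use len c3 in auto)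
      moreover have "wid l (comb x 2) r \<circle> wid l (wid [x] (sp x) [x]) r = wid l (wid [] (sp x) [opp x]) r \<circle> wid l (wid [x] (mg x) []) r + wid l (wid [opp x] (sp x) []) r \<circle> wid l (wid [] (mg x) [x]) r"
        unfolding wid_comp[symmetric] wid_add[symmetric] comb_two_sp ..
      ultimately show ?thesis
        by (simp add: c3 p l' numeral_2_eq_2 del: comb.simps)
    qed
  qed
qed

lemma descent_up:
  assumes "descent t v d" "is_up p" "t = l' @ piece_top p @ r'" "length t = Suc k"
  shows "narrow k (l' @ piece_bot p @ r') v (d \<circle> wid l' (piece_skein p) r')"
  using assms(1)
proof cases
  case (cap l x r)
  then show ?thesis using cap_up[of p l x r l' r' k] assms by simp
next
  case (comb l x n r)
  then show ?thesis using comb_up[of p l x n r l' r' k] assms by simp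
qed

subsection \<open>Descents above rungs\<close>

lemma far_right_rung:
  assumes d: "descent (l @ A @ m @ [opp y, y] @ r) (l @ A' @ m @ [opp y, y] @ r) (wid l C (m @ [opp y, y] @ r))"
    "descent (l @ A @ m @ [y, opp y] @ r) (l @ A' @ m @ [y, opp y] @ r) (wid l C (m @ [y, opp y] @ r))"
    and C: "C \<in> Hom A A'" and len: "length (l @ A @ m @ [opp y, y] @ r) = Suc k"
  shows "descent_span k (l @ A @ m @ [y, opp y] @ r) (l @ A' @ m @ [opp y, y] @ r)
      (wid l C (m @ [opp y, y] @ r) \<circle> wid (l @ A @ m) (rung y) r)"
proof -
  have "wid l C (m @ [opp y, y] @ r) \<circle> wid (l @ A @ m) (rung y) r =
      wid (l @ A' @ m) (rung y) r \<circle> wid l C (m @ [y, opp y] @ r)"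
    by (rule wid_exchange[OF C rung_Hom])
  moreover have "narrow k (l @ A' @ m @ [y, opp y] @ r) (l @ A' @ m @ [opp y, y] @ r) (wid (l @ A' @ m) (rung y) r)"
    using descent_length[OF d(1)] len by (intro narrow_rung) auto
  ultimately show ?thesis
    using descent_span.comp[OF d(2)] by simp
qed

lemma far_left_rung:
  assumes d: "descent (l @ [opp y, y] @ m @ A @ r) (l @ [opp y, y] @ m @ A' @ r) (wid (l @ [opp y, y] @ m) C r)"
    "descent (l @ [y, opp y] @ m @ A @ r) (l @ [y, opp y] @ m @ A' @ r) (wid (l @ [y, opp y] @ m) C r)"
    and C: "C \<in> Hom A A'" and len: "length (l @ [opp y, y] @ m @ A @ r) = Suc k"
  shows "descent_span k (l @ [y, opp y] @ m @ A @ r) (l @ [opp y, y] @ m @ A' @ r)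
      (wid (l @ [opp y, y] @ m) C r \<circle> wid l (rung y) (m @ A @ r))"
proof -
  have "wid (l @ [opp y, y] @ m) C r \<circle> wid l (rung y) (m @ A @ r) =
      wid l (rung y) (m @ A' @ r) \<circle> wid (l @ [y, opp y] @ m) C r"
    by (rule wid_exchange[OF rung_Hom C, symmetric])
  moreover have "narrow k (l @ [y, opp y] @ m @ A' @ r) (l @ [opp y, y] @ m @ A' @ r) (wid l (rung y) (m @ A' @ r))"
    using descent_length[OF d(1)] len by (intro narrow_rung) auto
  ultimately show ?thesis
    using descent_span.comp[OF d(2)] by simp
qed

lemma descent_capI: "t = l @ [x, opp x] @ r \<Longrightarrow> v = l @ r \<Longrightarrow> descent t v (wid l (cap x) r)"
  using descent.cap by simp

lemma descent_combI:
  "t = l @ (x # replicate n (opp x) @ [x]) @ r \<Longrightarrow> v = l @ (opp x # replicate n (opp x)) @ r \<Longrightarrow>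
    descent t v (wid l (comb x n) r)"
  using descent.comb by simp

lemma cap_rung_descent_span:
  assumes t: "l @ [x, opp x] @ r = l' @ [opp y, y] @ r'" and len: "length (l @ [x, opp x] @ r) = Suc k"
  shows "descent_span k (l' @ [y, opp y] @ r') (l @ r) (wid l (cap x) r \<circle> wid l' (rung y) r')"
  using t
proof (cases rule: overlap_pair)
  case (far_right m)
  then show ?thesis
    using far_right_rung[of l "[x, opp x]" m y r' "[]" "cap x" k] len
      descent.cap[of l x "m @ [opp y, y] @ r'"] descent.cap[of l x "m @ [y, opp y] @ r'"] by simp
next
  case (far_left m)
  then show ?thesis
    using far_left_rung[of l' y m "[x, opp x]" r "[]" "cap x" k] len
      descent.cap[of "l' @ [opp y, y] @ m" x r] descent.cap[of "l' @ [y, opp y] @ m" x r] by simp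
next
  case same
  then have x: "x = opp y" by simp
  have "wid l (cap x) r \<circle> wid l' (rung y) r' = (- qint 2) \<cdot> wid l (cap y) r"
    using wid_eq[OF cap_rung[of y], of l r] same(1,2) by (simp add: x del: skein.scale_minus_left)
  then show ?thesis
    using same(1,2) len by (auto simp: x simp del: skein.scale_minus_left intro!: descent_span_scale descent_span_descent descent_capI)
next
  case left
  have "wid l (cap x) r \<circle> wid l' (rung y) r' = wid l' (mg x) r \<circle> wid (l' @ [x]) (comb (opp x) 0) r"
    using wid_eq[OF cap_rung_right[of x], of l' r] left by (simp add: wid_comp)
  moreover have "descent_span k (l' @ [y, opp y] @ r') (l @ r) (wid l' (mg x) r \<circle> wid (l' @ [x]) (comb (opp x) 0) r)"
    by (rule descent_span.comp[of _ "l' @ [x, x] @ r"])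
      (use left len in \<open>auto intro!: descent_combI narrow_piece simp del: comb.simps\<close>)
  ultimately show ?thesis by simp
next
  case right
  then have y: "y = x" by simp
  have "wid l (cap x) r \<circle> wid l' (rung y) r' = wid l (mg (opp x)) r' \<circle> wid l (comb x 0) (opp x # r')"
    using wid_eq[OF cap_rung_left[of x], of l r'] right by (simp add: y wid_comp)
  moreover have "descent_span k (l' @ [y, opp y] @ r') (l @ r) (wid l (mg (opp x)) r' \<circle> wid l (comb x 0) (opp x # r'))"
    by (rule descent_span.comp[of _ "l @ [opp x, opp x] @ r'"])
      (use right len in \<open>auto intro!: descent_combI narrow_piece simp: y simp del: comb.simps\<close>)
  ultimately show ?thesis by simp
qed

text \<open>The lower rung is inverse to the first rung of the comb up to a cup-cap term. The main
  term is the comb with one rung less; the other one starts with a cap, and its cup meets the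
  shorter comb, where \<open>comb_up\<close> applies.\<close>

lemma comb_rung_left_inverse:
  assumes "length (l @ (x # replicate (Suc n) (opp x) @ [x]) @ r) = Suc k"
  shows "descent_span k (l @ (opp x # x # replicate n (opp x) @ [x]) @ r) (l @ (opp x # replicate (Suc n) (opp x)) @ r)
    (wid l (comb x (Suc n)) r \<circle> wid l (rung (opp x)) (replicate n (opp x) @ x # r))"
proof -
  let ?w = "replicate n (opp x) @ [x]" and ?C = "wid (l @ [opp x]) (comb x n) r"
  have "comb x (Suc n) \<circle> wid [] (rung (opp x)) ?w =
      wid [opp x] (comb x n) [] \<circle> wid [] (rung (opp (opp x)) \<circle> rung (opp x)) ?w"
    by (simp add: wid_comp comp_skein_assoc)
  also have "\<dots> = wid [opp x] (comb x n) [] \<circle> id_skein (opp x # x # ?w) +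
      (wid [opp x] (comb x n) [] \<circle> wid [] (cup (opp x)) ?w) \<circle> wid [] (cap (opp x)) ?w"
    by (subst rung_rung) (simp add: wid_add wid_comp comp_add_right comp_skein_assoc)
  also have "wid [opp x] (comb x n) [] \<circle> id_skein (opp x # x # ?w) = wid [opp x] (comb x n) []"
    by (rule Hom_comp_id[OF Hom_widI[OF comb_Hom]]) auto
  finally have e: "comb x (Suc n) \<circle> wid [] (rung (opp x)) ?w = wid [opp x] (comb x n) [] +
      (wid [opp x] (comb x n) [] \<circle> wid [] (cup (opp x)) ?w) \<circle> wid [] (cap (opp x)) ?w" .
  have "wid l (comb x (Suc n)) r \<circle> wid l (rung (opp x)) (?w @ r) =
      ?C + (?C \<circle> wid l (cup (opp x)) (?w @ r)) \<circle> wid l (cap (opp x)) (?w @ r)"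
    using arg_cong[OF e, of "\<lambda>f. wid l f r"] by (simp add: wid_comp wid_add del: comb.simps)
  moreover have "descent_span k (l @ (opp x # x # ?w) @ r) (l @ (opp x # replicate (Suc n) (opp x)) @ r) ?C"
    by (rule descent_span_descent) (use assms in \<open>auto intro!: descent_combI\<close>)
  moreover have "narrow k (l @ ?w @ r) (l @ (opp x # replicate (Suc n) (opp x)) @ r) (?C \<circle> wid l (cup (opp x)) (?w @ r))"
    using comb_up[of "Cup (opp x)" "l @ [opp x]" x n r l "?w @ r" k] assms by simp
  then have "descent_span k (l @ (opp x # x # ?w) @ r) (l @ (opp x # replicate (Suc n) (opp x)) @ r)
      ((?C \<circle> wid l (cup (opp x)) (?w @ r)) \<circle> wid l (cap (opp x)) (?w @ r))"
    by (rule descent_span.comp[rotated]) (auto intro!: descent_capI)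
  ultimately show ?thesis
    using descent_span.add by (simp del: comb.simps)
qed

lemma comb_rung_right_inverse:
  assumes "length (l @ (x # replicate (Suc n) (opp x) @ [x]) @ r) = Suc k"
  shows "descent_span k (l @ (x # replicate n (opp x) @ [x, opp x]) @ r) (l @ (opp x # replicate (Suc n) (opp x)) @ r)
    (wid l (comb x (Suc n)) r \<circle> wid (l @ x # replicate n (opp x)) (rung x) r)"
proof -
  let ?w = "x # replicate n (opp x)" and ?C = "wid l (comb x n) (opp x # r)"
  have "comb x (Suc n) \<circle> wid ?w (rung x) [] =
      wid [] (comb x n) [opp x] \<circle> wid ?w (rung (opp x) \<circle> rung x) []"
    by (simp add: comb_Suc_right wid_comp comp_skein_assoc del: comb.simps)
  also have "\<dots> = wid [] (comb x n) [opp x] \<circle> id_skein (?w @ [x, opp x]) +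
      (wid [] (comb x n) [opp x] \<circle> wid ?w (cup x) []) \<circle> wid ?w (cap x) []"
    by (simp add: rung_rung wid_add wid_comp comp_add_right comp_skein_assoc)
  also have "wid [] (comb x n) [opp x] \<circle> id_skein (?w @ [x, opp x]) = wid [] (comb x n) [opp x]"
    by (rule Hom_comp_id[OF Hom_widI[OF comb_Hom]]) auto
  finally have e: "comb x (Suc n) \<circle> wid ?w (rung x) [] = wid [] (comb x n) [opp x] +
      (wid [] (comb x n) [opp x] \<circle> wid ?w (cup x) []) \<circle> wid ?w (cap x) []" .
  have "wid l (comb x (Suc n)) r \<circle> wid (l @ ?w) (rung x) r =
      ?C + (?C \<circle> wid (l @ ?w) (cup x) r) \<circle> wid (l @ ?w) (cap x) r"
    using arg_cong[OF e, of "\<lambda>f. wid l f r"] by (simp add: wid_comp wid_add del: comb.simps)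
  moreover have "descent_span k (l @ (?w @ [x, opp x]) @ r) (l @ (opp x # replicate (Suc n) (opp x)) @ r) ?C"
    by (rule descent_span_descent) (use assms in \<open>auto intro!: descent_combI\<close>)
  moreover have "narrow k (l @ ?w @ r) (l @ (opp x # replicate (Suc n) (opp x)) @ r) (?C \<circle> wid (l @ ?w) (cup x) r)"
    using comb_up[of "Cup x" l x n "opp x # r" "l @ ?w" r k] assms by simp
  then have "descent_span k (l @ (?w @ [x, opp x]) @ r) (l @ (opp x # replicate (Suc n) (opp x)) @ r)
      ((?C \<circle> wid (l @ ?w) (cup x) r) \<circle> wid (l @ ?w) (cap x) r)"
    by (rule descent_span.comp[rotated]) (auto intro!: descent_capI)
  ultimately show ?thesis
    using descent_span.add by (simp del: comb.simps)
qed

lemma comb_rung_descent_span: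
  assumes t: "l @ (x # replicate n (opp x) @ [x]) @ r = l' @ [opp y, y] @ r'"
    and len: "length (l @ (x # replicate n (opp x) @ [x]) @ r) = Suc k"
  shows "descent_span k (l' @ [y, opp y] @ r') (l @ (opp x # replicate n (opp x)) @ r)
    (wid l (comb x n) r \<circle> wid l' (rung y) r')"
proof -
  let ?o = "replicate n (opp x)"
  consider (far_left) "length l' + 2 \<le> length l" | (left) "length l' + 1 = length l" | (inv_left) "length l' = length l"
    | (mid) "length l < length l'" "length l' < length l + n"
    | (inv_right) "length l < length l'" "length l' = length l + n"
    | (right) "length l' = length l + n + 1" | (far_right) "length l' \<ge> length l + n + 2" by linarith
  then show ?thesis
  proof cases
    case far_left
    then obtain m where m: "l = l' @ [opp y, y] @ m" "r' = m @ (x # ?o @ [x]) @ r"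
      using append_eq_prefix[of "l' @ [opp y, y]" r' l "(x # ?o @ [x]) @ r"] t by auto
    show ?thesis
      using far_left_rung[of l' y m "x # ?o @ [x]" r "opp x # ?o" "comb x n" k] len
        descent.comb[of "l' @ [opp y, y] @ m" x n r] descent.comb[of "l' @ [y, opp y] @ m" x n r] by (simp add: m)
  next
    \<comment> \<open>The rung prolongs the comb by one, so combs of every length have to be counted
      as descents.\<close>
    case left
    then have m: "l = l' @ [opp x]" "y = x" "r' = ?o @ x # r"
      using append_eq_prefix[of "l' @ [opp y]" "y # r'" l "(x # ?o @ [x]) @ r"] t by auto
    have "wid l (comb x n) r \<circle> wid l' (rung y) r' = wid l' (comb x (Suc n)) r"
      by (simp add: m wid_comp)
    then show ?thesis
      using len by (auto simp: m simp del: comb.simps intro!: descent_span_descent descent_combI)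
  next
    case inv_left
    with t have m: "l' = l" "y = opp x" "x # ?o @ [x] @ r = [x, opp x] @ r'" by auto
    then obtain j where j: "n = Suc j" by (cases n) auto
    show ?thesis
      using comb_rung_left_inverse[of l x j r k] len m by (simp add: j del: comb.simps)
  next
    \<comment> \<open>Strictly inside the comb both letters are \<open>opp x\<close>, but the upper
      letters of a rung differ.\<close>
    case mid
    define j where "j = length l' - length l - 1"
    have e: "length l' = length l + Suc j" "Suc j < n"
      using mid by (auto simp: j_def)
    have "(l' @ [opp y, y] @ r') ! length l' = opp y" "(l' @ [opp y, y] @ r') ! Suc (length l') = y"
      by (simp_all add: nth_append)
    moreover have "(l @ (x # ?o @ [x]) @ r) ! length l' = opp x" "(l @ (x # ?o @ [x]) @ r) ! Suc (length l') = opp x"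
      using e by (simp_all add: nth_append)
    ultimately show ?thesis
      unfolding t by simp
  next
    case inv_right
    then obtain j where j: "n = Suc j" by (cases n) auto
    have "(l @ x # replicate j (opp x)) @ [opp x, x] @ r = l' @ [opp y, y] @ r'"
      using t by (simp add: j replicate_append_same)
    with inv_right have m: "l' = l @ x # replicate j (opp x)" "y = x" "r' = r"
      using append_eq_prefix[of "l @ x # replicate j (opp x)" "[opp x, x] @ r" l' "[opp y, y] @ r'"] by (auto simp: j)
    show ?thesis
      using comb_rung_right_inverse[of l x j r k] len m by (simp add: j del: comb.simps)
  next
    case right
    have "(l @ x # ?o) @ x # r = l' @ [opp y, y] @ r'"
      using t by simp
    with right have m: "l' = l @ x # ?o" "y = opp x" "r = opp x # r'"
      using append_eq_prefix[of "l @ x # ?o" "x # r" l' "[opp y, y] @ r'"] by auto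
    have "wid l (comb x n) r \<circle> wid l' (rung y) r' = wid l (comb x (Suc n)) r'"
      by (simp add: m comb_Suc_right wid_comp del: comb.simps)
    then show ?thesis
      using len by (auto simp: m simp del: comb.simps intro!: descent_span_descent descent_combI)
  next
    case far_right
    then obtain m where m: "l' = l @ (x # ?o @ [x]) @ m" "r = m @ [opp y, y] @ r'"
      using append_eq_prefix[of "l @ (x # ?o @ [x])" r l' "[opp y, y] @ r'"] t by auto
    show ?thesis
      using far_right_rung[of l "x # ?o @ [x]" m y r' "opp x # ?o" "comb x n" k] len
        descent.comb[of l x n "m @ [opp y, y] @ r'"] descent.comb[of l x n "m @ [y, opp y] @ r'"] by (simp add: m)
  qed
qed

lemma descent_rung:
  assumes "descent t v d" "t = l' @ [opp y, y] @ r'" "length t = Suc k"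
  shows "descent_span k (l' @ [y, opp y] @ r') v (d \<circle> wid l' (rung y) r')"
  using assms(1)
proof cases
  case (cap l x r)
  then show ?thesis using cap_rung_descent_span[of l x r l' y r' k] assms by simp
next
  case (comb l x n r)
  then show ?thesis using comb_rung_descent_span[of l x n r l' y r' k] assms by simp
qed

lemma descent_span_rung:
  assumes "descent_span k t v f" "t = l' @ [opp y, y] @ r'" "length t = Suc k"
  shows "descent_span k (l' @ [y, opp y] @ r') v (f \<circle> wid l' (rung y) r')"
  using assms(1)
proof (induction rule: descent_span.induct)
  case (comp u d h)
  then show ?case
    using descent_span_comp[OF descent_rung[OF comp(1) assms(2,3)] comp(2)] by (simp add: comp_skein_assoc)
qed (auto simp: comp_add_left intro: descent_span.intros)

inductive rungs :: "sword \<Rightarrow> sword \<Rightarrow> skein \<Rightarrow> bool" for s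
  where
    refl: "rungs s s (id_skein s)"
  | step: "rungs s (l @ [x, opp x] @ r) f \<Longrightarrow> rungs s (l @ [opp x, x] @ r) (wid l (rung x) r \<circle> f)"

lemma rungs_Hom: "rungs s t f \<Longrightarrow> f \<in> Hom s t"
  by (induction rule: rungs.induct) (auto intro!: Hom_comp Hom_wid rung_Hom simp del: append_Cons)

lemma descent_span_rungs: "rungs s t g \<Longrightarrow> descent_span k t v f \<Longrightarrow> length t = Suc k \<Longrightarrow> descent_span k s v (f \<circle> g)"
proof (induction arbitrary: f rule: rungs.induct)
  case refl
  then show ?case by (simp add: Hom_comp_id[OF descent_span_Hom[OF refl(1)]])
next
  case (step l x r g)
  then show ?case
    using step.IH[OF descent_span_rung[OF step.prems(1) HOL.refl step.prems(2)]]
    by (simp add: comp_skein_assoc)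
qed


subsection \<open>The width of a web is bounded by its ends\<close>

text \<open>Normal form of a composite that has reached a word of the critical length
  \<open>Suc k\<close>: after the last word of length at most \<open>k\<close> comes one cup or
  split, and from then on only rungs.\<close>

inductive peaked :: "nat \<Rightarrow> sword \<Rightarrow> sword \<Rightarrow> skein \<Rightarrow> bool" for k s t
  where
    zero: "peaked k s t 0"
  | add: "peaked k s t f \<Longrightarrow> peaked k s t g \<Longrightarrow> peaked k s t (f + g)"
  | peak: "narrow k s (l @ piece_bot p @ r) g \<Longrightarrow> is_up p \<Longrightarrow> rungs (l @ piece_top p @ r) t f \<Longrightarrow>
      length t = Suc k \<Longrightarrow> peaked k s t (f \<circle> wid l (piece_skein p) r \<circle> g)"

lemma peaked_scale: "peaked k s t f \<Longrightarrow> peaked k s t (c \<cdot> f)"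
proof (induction rule: peaked.induct)
  case (peak l p r g f)
  then show ?case
    using peaked.peak[OF narrow.scale[OF peak(1), of c] peak(2-4)] by simp
qed (auto simp: skein.scale_right_distrib intro: peaked.intros)

lemma peaked_rung:
  "peaked k s (l' @ [y, opp y] @ r') f \<Longrightarrow> peaked k s (l' @ [opp y, y] @ r') (wid l' (rung y) r' \<circle> f)"
proof (induction rule: peaked.induct)
  case (peak l p r g f)
  then show ?case
    using peaked.peak[OF peak(1,2) rungs.step[OF peak(3)]] by (simp add: comp_skein_assoc)
qed (auto simp: comp_add_right intro: peaked.intros)

lemma descent_span_up:
  assumes "descent_span k t v f" "is_up p" "t = l' @ piece_top p @ r'" "length t = Suc k"
  shows "narrow k (l' @ piece_bot p @ r') v (f \<circle> wid l' (piece_skein p) r')"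
  using assms(1)
proof (induction rule: descent_span.induct)
  case (comp u d h)
  then show ?case
    using narrow_comp[OF comp(2) descent_up[OF comp(1) assms(2-4)]] by (simp add: comp_skein_assoc)
qed (auto simp: comp_add_left intro: narrow.intros)

lemma rungs_length: "rungs s t f \<Longrightarrow> length s = length t"
  by (induction rule: rungs.induct) auto

text \<open>The descent is pushed down through the rungs to the cup or split that opened the peak
  and is cancelled there, which removes the whole excursion to length \<open>Suc k\<close>.\<close>

lemma peaked_descent:
  assumes "descent t v d" "peaked k s t f"
  shows "narrow k s v (d \<circle> f)"
  using assms(2)
proof (induction rule: peaked.induct)
  case (peak l p r g f)
  have "descent_span k (l @ piece_top p @ r) v (d \<circle> f)"
    by (rule descent_span_rungs[OF peak(3) descent_span_descent[OF assms(1) peak(4)] peak(4)])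
  from narrow_comp[OF descent_span_up[OF this peak(2) HOL.refl] peak(1)] show ?case
    using rungs_length[OF peak(3)] peak(4) by (simp add: comp_skein_assoc)
qed (auto simp: comp_add_right intro: narrow.intros)

text \<open>Lowers the width bound by one, with an invariant for each possible length of the current
  word. The clause \<open>f = 0\<close> belongs to words beyond the bound, which
  \<open>narrow.zero\<close> and steps above it can still reach.\<close>

lemma narrow_Suc:
  assumes "narrow (Suc k) s t f" "length s \<le> k"
  shows "(length t \<le> k \<longrightarrow> narrow k s t f) \<and> (length t = Suc k \<longrightarrow> peaked k s t f) \<and> (Suc k < length t \<longrightarrow> f = 0)"
  using assms(1)
proof (induction rule: narrow.induct)
  case id
  then show ?case using assms(2) by (auto intro: narrow.id)
next
  case (step t f t' m)
  show ?case
  proof (cases "length t \<le> Suc k")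
    case False
    then show ?thesis
      using step by (auto intro: narrow.zero peaked.zero)
  next
  case True
  then have "length t \<le> Suc k" .
  show ?thesis
    using step(2)
  proof cases
    case (rung l x r)
    then show ?thesis
      using step.IH narrow.step[of k s t f t' m] step(2) peaked_rung[of k s l x r f] by auto
  next
    case (piece l p r)
    show ?thesis
    proof (cases "is_up p")
      case True
      then have lt: "length (piece_bot p) < length (piece_top p)"
        by (cases rule: is_up_cases) auto
      then have t: "length t \<le> k"
        using piece step(3) by auto
      show ?thesis
      proof (intro conjI impI)
        show "narrow k s t' (m \<circle> f)" if "length t' \<le> k"
          using that t step by (auto intro: narrow.step)
        show "m \<circle> f = 0" if "Suc k < length t'"
          using that step(3) by simp
        show "peaked k s t' (m \<circle> f)" if "length t' = Suc k"
          using peaked.peak[of k s l p r f t' "id_skein t'"] piece step.IH t that True rungs.refl[of t']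
          by (simp add: Hom_id_comp[OF Hom_widI[OF piece_skein_Hom]] flip: comp_skein_assoc)
      qed
    next
      case False
      then have d: "descent t t' m"
        using descent.cap[of l _ r] descent.comb[of l _ 0 r] piece by (cases p) auto
      then have "length t' \<le> k"
        using descent_length[OF d] \<open>length t \<le> Suc k\<close> by simp
      moreover have "narrow k s t' (m \<circle> f)"
      proof (cases "length t \<le> k")
        case True
        then show ?thesis using step \<open>length t' \<le> k\<close> by (auto intro: narrow.step)
      next
        case False
        then have "length t = Suc k" using \<open>length t \<le> Suc k\<close> by simp
        then show ?thesis using peaked_descent[OF d] step.IH by auto
      qed
      ultimately show ?thesis by simp
    qed
  qed
  qed
qed (auto intro: narrow.intros peaked.intros peaked_scale)

lemma narrow_mono: "narrow k s t f \<Longrightarrow> k \<le> k' \<Longrightarrow> narrow k' s t f"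
  by (induction rule: narrow.induct) (auto intro: narrow.intros)

lemma narrow_diagram: "is_diagram s ds t \<Longrightarrow> \<exists>k. narrow k s t (web_class (web_of s ds t))"
proof (induction s ds t rule: is_diagram.induct)
  case (1 s t)
  then show ?case
    using narrow.id[of s "length s"] by (auto simp: web_class_web_of_Nil)
next
  case (2 s l p r ds t)
  then obtain k where k: "narrow k (l @ piece_top p @ r) t (web_class (web_of (l @ piece_top p @ r) ds t))"
    by auto
  let ?k = "k + length s + length (l @ piece_top p @ r)"
  have "narrow ?k s (l @ piece_top p @ r) (wid l (piece_skein p) r)"
    using 2(2) by (intro narrow_piece) auto
  from narrow_comp[OF narrow_mono[OF k, of ?k] this] show ?case
    using 2(2) web_class_web_of_Cons[OF 2(2)] by auto
qed

text \<open>Every diagram has some finite width, and the bound is then lowered one unit at a time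
  down to the longer end word. It takes the role that an Euler characteristic argument plays for
  non-elliptic webs.\<close>

theorem Hom_narrow:
  assumes "f \<in> Hom s t" "length s \<le> k" "length t \<le> k"
  shows "narrow k s t f"
  using assms(1)
proof (induction rule: Hom_induct)
  case (web w)
  obtain s' ds t' where w: "is_diagram s' ds t'" "w = web_of s' ds t'" by (rule web_cases)
  then obtain j where "narrow j s t (web_class w)"
    using narrow_diagram[OF w(1)] web by auto
  then have "narrow (k + j) s t (web_class w)"
    by (rule narrow_mono) simp
  then show ?case
    by (induction j) (use narrow_Suc assms(2,3) in auto)
qed (auto intro: narrow.intros)

section \<open>Elements that kill all descents\<close>

text \<open>
  Both signs are needed although the theorem only mentions \<open>sg Pos a b\<close>: the partial trace is
  computed in a word in which the two segments are exchanged.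
\<close>

definition sg :: "sgn \<Rightarrow> nat \<Rightarrow> nat \<Rightarrow> sword"
  where "sg x a b = replicate a x @ replicate b (opp x)"

lemma length_sg [simp]: "length (sg x a b) = a + b"
  by (simp add: sg_def)

lemma nth_sg: "i < a + b \<Longrightarrow> sg x a b ! i = (if i < a then x else opp x)"
  by (simp add: sg_def nth_append)

text \<open>A comb with at least one rung changes sign twice, a segregated word at most once.
  Killing caps and merges hence suffices to kill every descent.\<close>

lemma sg_no_comb: "l @ (y # replicate (Suc n) (opp y) @ [y]) @ r \<noteq> sg x a b"
proof
  assume e: "l @ (y # replicate (Suc n) (opp y) @ [y]) @ r = sg x a b"
  let ?s = "l @ (y # replicate (Suc n) (opp y) @ [y]) @ r"
  have len: "length ?s = a + b" using e by simp
  have "?s ! length l = y" "?s ! (length l + 1) = opp y" "?s ! (length l + n + 2) = y"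
    by (simp_all add: nth_append)
  moreover have "length l + n + 2 < a + b" using len by simp
  ultimately show False
    unfolding e by (auto simp: nth_sg split: if_splits)
qed

lemma sg_no_descending: "l @ [opp x, x] @ r \<noteq> sg x a b"
proof
  assume e: "l @ [opp x, x] @ r = sg x a b"
  let ?s = "l @ [opp x, x] @ r"
  have len: "length ?s = a + b" using e by simp
  have "?s ! length l = opp x" "?s ! (length l + 1) = x"
    by (simp_all add: nth_append)
  moreover have "length l + 1 < a + b" using len by simp
  ultimately show False
    unfolding e by (auto simp: nth_sg split: if_splits)
qed

definition kills :: "sword \<Rightarrow> skein \<Rightarrow> bool"
  where "kills s p \<longleftrightarrow> (\<forall>l x r. (s = l @ [x, opp x] @ r \<longrightarrow> wid l (cap x) r \<circle> p = 0) \<and>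
    (s = l @ [x, x] @ r \<longrightarrow> wid l (mg x) r \<circle> p = 0))"

lemma killsD:
  assumes "kills s p"
  shows "s = l @ [x, opp x] @ r \<Longrightarrow> wid l (cap x) r \<circle> p = 0"
    and "s = l @ [x, x] @ r \<Longrightarrow> wid l (mg x) r \<circle> p = 0"
proof -
  note * = assms[unfolded kills_def, THEN spec, THEN spec, THEN spec]
  show "s = l @ [x, opp x] @ r \<Longrightarrow> wid l (cap x) r \<circle> p = 0"
    by (rule *[THEN conjunct1, THEN mp])
  show "s = l @ [x, x] @ r \<Longrightarrow> wid l (mg x) r \<circle> p = 0"
    by (rule *[THEN conjunct2, THEN mp])
qed

lemma descent_kills:
  assumes "kills s p" "s = sg x a b" "descent s v d"
  shows "d \<circle> p = 0"
  using assms(3)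
proof cases
  case (cap l y r)
  then show ?thesis using killsD(1)[OF assms(1)] by simp
next
  case (comb l y n r)
  show ?thesis
  proof (cases n)
    case 0
    then show ?thesis using killsD(2)[OF assms(1)] comb by simp
  next
    case (Suc m)
    then show ?thesis using sg_no_comb[of l y m r x a b] comb assms(2) by simp
  qed
qed

lemma descent_span_kills:
  assumes "kills s p" "s = sg x a b" "descent_span k s v f"
  shows "f \<circle> p = 0"
  using assms(3)
proof (induction rule: descent_span.induct)
  case (comp u d h)
  then show ?case
    using descent_kills[OF assms(1,2) comp(1)] by (simp add: comp_skein_assoc)
qed (simp_all add: comp_add_left)

text \<open>
  Paths of rungs that move the letters \<open>x\<close> to the right only. A rung in the other direction either
  cancels against an earlier one, up to a cap, or commutes past it.
\<close>

inductive adds :: "sgn \<Rightarrow> sword \<Rightarrow> sword \<Rightarrow> skein \<Rightarrow> bool" for x s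
  where
    refl: "adds x s s (id_skein s)"
  | step: "adds x s (l @ [x, opp x] @ r) f \<Longrightarrow> adds x s (l @ [opp x, x] @ r) (wid l (rung x) r \<circle> f)"

lemma adds_rungs: "adds x s t f \<Longrightarrow> rungs s t f"
  by (induction rule: adds.induct) (auto intro: rungs.intros rungs.step[simplified])

lemma rungs_descent_kills:
  assumes "kills s p" "s = sg x a b" "rungs s t f" "descent t v d"
  shows "d \<circle> (f \<circle> p) = 0"
proof -
  obtain k where k: "length t = Suc k"
    using descent_length[OF assms(4)] by (cases "length t") auto
  have "descent_span k s v (d \<circle> f)"
    by (rule descent_span_rungs[OF assms(3) descent_span_descent[OF assms(4) k] k])
  then show ?thesis
    using descent_span_kills[OF assms(1,2)] by (simp flip: comp_skein_assoc)
qed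

text \<open>The new rung is compared with the last one of the path. Both occupy letters
  \<open>[opp x, x]\<close>, so they cannot share exactly one letter. At distant places they
  commute; at the same place the square relation cancels them, and its cup-cap term dies on
  \<open>p\<close> because its cap can be pushed down through the rest of the path. A segregated
  start word offers no place for the rung.\<close>

lemma rung_adds:
  assumes "kills s p" "s = sg x a b" "adds x s t f" "t = l @ [opp x, x] @ r"
  shows "\<exists>g. adds x s (l @ [x, opp x] @ r) g \<and> wid l (rung (opp x)) r \<circle> (f \<circle> p) = g \<circle> p"
  using assms(3,4)
proof (induction arbitrary: l r rule: adds.induct)
  case refl
  then show ?case using sg_no_descending[of l x r a b] assms(2) by simp
next
  case (step l0 r0 f)
  from step.prems show ?case
  proof (cases rule: overlap_pair)
    case (far_right m)
    obtain g where g: "adds x s ((l0 @ [x, opp x] @ m) @ [x, opp x] @ r) g"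
      "wid (l0 @ [x, opp x] @ m) (rung (opp x)) r \<circle> (f \<circle> p) = g \<circle> p"
      using step.IH[of "l0 @ [x, opp x] @ m" r] far_right by auto
    have "wid l (rung (opp x)) r \<circle> wid l0 (rung x) r0 = wid l0 (rung x) (m @ [x, opp x] @ r) \<circle> wid (l0 @ [x, opp x] @ m) (rung (opp x)) r"
      unfolding far_right by (rule wid_exchange[symmetric]) auto
    then have "wid l (rung (opp x)) r \<circle> (wid l0 (rung x) r0 \<circle> f \<circle> p) = (wid l0 (rung x) (m @ [x, opp x] @ r) \<circle> g) \<circle> p"
      using g(2) by (simp add: comp_skein_assoc flip: comp_skein_assoc[of "wid l _ r"])
    moreover have "adds x s (l @ [x, opp x] @ r) (wid l0 (rung x) (m @ [x, opp x] @ r) \<circle> g)"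
      using adds.step[of x s l0 "m @ [x, opp x] @ r" g] g(1) far_right by simp
    ultimately show ?thesis by blast
  next
    case (far_left m)
    obtain g where g: "adds x s (l @ [x, opp x] @ (m @ [x, opp x] @ r0)) g"
      "wid l (rung (opp x)) (m @ [x, opp x] @ r0) \<circle> (f \<circle> p) = g \<circle> p"
      using step.IH[of l "m @ [x, opp x] @ r0"] far_left by auto
    have "wid l (rung (opp x)) r \<circle> wid l0 (rung x) r0 = wid (l @ [x, opp x] @ m) (rung x) r0 \<circle> wid l (rung (opp x)) (m @ [x, opp x] @ r0)"
      unfolding far_left by (rule wid_exchange) auto
    then have "wid l (rung (opp x)) r \<circle> (wid l0 (rung x) r0 \<circle> f \<circle> p) = (wid (l @ [x, opp x] @ m) (rung x) r0 \<circle> g) \<circle> p"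
      using g(2) by (simp add: comp_skein_assoc flip: comp_skein_assoc[of "wid l _ r"])
    moreover have "adds x s (l @ [x, opp x] @ r) (wid (l @ [x, opp x] @ m) (rung x) r0 \<circle> g)"
      using adds.step[of x s "l @ [x, opp x] @ m" r0 g] g(1) far_left by simp
    ultimately show ?thesis by blast
  next
    case same
    have f: "f \<in> Hom s (l @ [x, opp x] @ r)"
      using rungs_Hom[OF adds_rungs[OF step(1)]] same(1,2) by simp
    have "wid l (rung (opp x)) r \<circle> (wid l0 (rung x) r0 \<circle> f \<circle> p) = wid l (rung (opp x) \<circle> rung x) r \<circle> (f \<circle> p)"
      unfolding same(1,2) wid_comp comp_skein_assoc ..
    also have "\<dots> = (id_skein (l @ [x, opp x] @ r) \<circle> f) \<circle> p + wid l (cup x) r \<circle> (wid l (cap x) r \<circle> (f \<circle> p))"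
      unfolding rung_rung wid_add wid_comp comp_add_left comp_skein_assoc wid_id ..
    also have "wid l (cap x) r \<circle> (f \<circle> p) = 0"
      by (rule rungs_descent_kills[OF assms(1,2) adds_rungs[OF step(1)]]) (use descent.cap[of l x r] same(1,2) in simp)
    also have "id_skein (l @ [x, opp x] @ r) \<circle> f = f"
      by (rule Hom_id_comp[OF f])
    finally show ?thesis
      using step(1) same(1,2) by auto
  qed auto
qed

lemma rungs_adds:
  assumes "kills s p" "s = sg x a b" "rungs s t f"
  shows "\<exists>g. adds x s t g \<and> f \<circle> p = g \<circle> p"
  using assms(3)
proof (induction rule: rungs.induct)
  case refl
  then show ?case using adds.refl by blast
next
  case (step l y r f)
  then obtain g where g: "adds x s (l @ [y, opp y] @ r) g" "f \<circle> p = g \<circle> p" by blast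
  show ?case
  proof (cases "y = x")
    case True
    then have "adds x s (l @ [opp y, y] @ r) (wid l (rung y) r \<circle> g)"
      using adds.step g(1) by blast
    then show ?thesis using g(2) by (auto simp: comp_skein_assoc)
  next
    case False
    then have "y = opp x" using eq_or_opp by blast
    then show ?thesis
      using rung_adds[OF assms(1,2), of "l @ [opp x, x] @ r" g l r] g by (simp add: comp_skein_assoc)
  qed
qed

fun inversions :: "sgn \<Rightarrow> sword \<Rightarrow> nat"
  where
    "inversions x [] = 0"
  | "inversions x (y # ys) = (if y = x then 0 else count_list ys x) + inversions x ys"

lemma inversions_append:
  "inversions x (u @ v) = inversions x u + length (filter (\<lambda>y. y \<noteq> x) u) * count_list v x + inversions x v"
  by (induction u) auto

text \<open>Each step creates exactly one inversion, so a path that returns to its start has no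
  steps.\<close>

lemma adds_inversions: "adds x s t f \<Longrightarrow> inversions x s \<le> inversions x t \<and> (t = s \<longrightarrow> f = id_skein s)"
  by (induction rule: adds.induct) (auto simp: inversions_append algebra_simps)

lemma rungs_id:
  assumes "kills s p" "s = sg x a b" "rungs s s f" "p \<in> Hom u s"
  shows "f \<circle> p = p"
  using rungs_adds[OF assms(1-3)] adds_inversions[of x s s] Hom_id_comp[OF assms(4)] by auto

lemma rungs_count: "rungs s t f \<Longrightarrow> count_list t y = count_list s y"
  by (induction rule: rungs.induct) auto

inductive rung_span :: "sword \<Rightarrow> sword \<Rightarrow> skein \<Rightarrow> skein \<Rightarrow> bool" for s t p
  where
    zero: "rung_span s t p 0"
  | add: "rung_span s t p f \<Longrightarrow> rung_span s t p g \<Longrightarrow> rung_span s t p (f + g)"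
  | base: "rungs s t g \<Longrightarrow> rung_span s t p (c \<cdot> (g \<circle> p))"

lemma rung_span_scale: "rung_span s t p f \<Longrightarrow> rung_span s t p (c \<cdot> f)"
  by (induction rule: rung_span.induct) (auto simp: skein.scale_right_distrib intro: rung_span.intros)

text \<open>With the bound equal to the length of the start word there is no room for a cup or split
  before a descent, and the first descent above the rungs already gives 0 on \<open>p\<close>. Only
  rungs survive.\<close>

lemma narrow_rung_span:
  assumes "kills s p" "s = sg x a b" "narrow (length s) s t f"
  shows "rung_span s t p (f \<circle> p)"
  using assms(3)
proof (induction rule: narrow.induct)
  case id
  then show ?case
    using rung_span.base[OF rungs.refl, of s p 1] by simp
next
  case (step t f t' m)
  have "rung_span s t' p (m \<circle> h)" if "rung_span s t p h" for h
    using that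
  proof (induction rule: rung_span.induct)
    case (base g c)
    have len: "length t = length s" using rungs_length[OF base] by simp
    show ?case
      using step(2)
    proof cases
      case (rung l y r)
      then show ?thesis
        using rung_span.base[OF rungs.step[of s l y r g], of p c] base by (simp add: comp_skein_assoc)
    next
      case (piece l q r)
      have "length (piece_top q) \<le> length (piece_bot q)"
        using step(3) len piece by simp
      then have "descent t t' m"
        using descent.cap[of l _ r] descent.comb[of l _ 0 r] piece by (cases q) auto
      from rungs_descent_kills[OF assms(1,2) base this] show ?thesis
        by (simp add: rung_span.zero)
    qed
  qed (auto simp: comp_add_right intro: rung_span.intros)
  then show ?case using step.IH by (simp add: comp_skein_assoc)
qed (auto simp: comp_add_left intro: rung_span.intros rung_span_scale)


subsection \<open>The order on weights\<close>

text \<open>Closed form of the order: \<open>i\<close> and \<open>j\<close> count the two elementary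
  steps, which are commuting translations. Intermediate weights that are not dominant then need no
  attention.\<close>

definition below :: "sword \<Rightarrow> sword \<Rightarrow> bool"
  where "below t s \<longleftrightarrow> (\<exists>i j::nat. i + j > 0 \<and>
    int (count_list t Pos) = int (count_list s Pos) + int i - 2 * int j \<and>
    int (count_list t Neg) = int (count_list s Neg) - 2 * int i + int j)"

definition same_weight :: "sword \<Rightarrow> sword \<Rightarrow> bool"
  where "same_weight t s \<longleftrightarrow> (\<forall>y. count_list t y = count_list s y)"

lemma belowI:
  assumes "i + j > (0::nat)" "count_list t x + 2 * j = count_list s x + i"
    "count_list t (opp x) + 2 * i = count_list s (opp x) + j"
  shows "below t s"
proof (cases x)
  case Pos
  then show ?thesis
    unfolding below_def by (intro exI[of _ i] exI[of _ j]) (use assms in auto)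
next
  case Neg
  then show ?thesis
    unfolding below_def by (intro exI[of _ j] exI[of _ i]) (use assms in auto)
qed

lemma below_same_weight: "below t s \<Longrightarrow> same_weight s r \<Longrightarrow> below t r"
  by (auto simp: below_def same_weight_def)

lemma same_weightI: "count_list t x = count_list s x \<Longrightarrow> count_list t (opp x) = count_list s (opp x) \<Longrightarrow> same_weight t s"
  unfolding same_weight_def by (metis eq_or_opp)

lemma below_append: "below t s \<Longrightarrow> below (t @ u) (s @ u)"
  by (simp add: below_def algebra_simps)

lemma length_count: "length (s :: sword) = count_list s Pos + count_list s Neg"
proof (induction s)
  case (Cons y s)
  then show ?case by (cases y) auto
qed simp

lemma below_length: "below t s \<Longrightarrow> length t < length s"
  by (auto simp: below_def length_count)

lemma weight_less_below: "weight_less (weight t) (weight s) \<longleftrightarrow> below t s"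
proof
  have "\<exists>i j::nat. i + j > 0 \<and> fst v = fst w + int i - 2 * int j \<and> snd v = snd w - 2 * int i + int j"
    if "weight_less v w" for v w
    using that
  proof (induction rule: weight_less.induct)
    case (step1 a b)
    then show ?case by (intro exI[of _ 1] exI[of _ 0]) auto
  next
    case (step2 a b)
    then show ?case by (intro exI[of _ 0] exI[of _ 1]) auto
  next
    case (trans x y z)
    from trans.IH show ?case
    proof (elim exE conjE)
      fix i j i' j' :: nat
      assume "0 < i + j" "fst x = fst y + int i - 2 * int j" "snd x = snd y - 2 * int i + int j"
        "fst y = fst z + int i' - 2 * int j'" "snd y = snd z - 2 * int i' + int j'"
      then show ?thesis by (intro exI[of _ "i + i'"] exI[of _ "j + j'"]) auto
    qed
  qed
  from this[of "weight t" "weight s"] show "below t s" if "weight_less (weight t) (weight s)"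
    using that by (simp add: below_def weight_def)
  have 1: "i > 0 \<Longrightarrow> weight_less (a + int i, b - 2 * int i) (a, b)" for i a b
  proof (induction i)
    case (Suc i)
    show ?case
    proof (cases "i = 0")
      case True
      then show ?thesis using weight_less.step1[of a b] by simp
    next
      case False
      then show ?thesis
        using weight_less.trans[OF weight_less.step1[of "a + int i" "b - 2 * int i"] Suc.IH]
        by (simp add: algebra_simps)
    qed
  qed simp
  have 2: "i + j > 0 \<Longrightarrow> weight_less (a + int i - 2 * int j, b - 2 * int i + int j) (a, b)" for i j a b
  proof (induction j)
    case 0
    then show ?case using 1 by simp
  next
    case (Suc j)
    show ?case
    proof (cases "i + j = 0")
      case True
      then show ?thesis using weight_less.step2[of a b] by simp
    next
      case False
      then show ?thesis
        using weight_less.trans[OF weight_less.step2[of "a + int i - 2 * int j" "b - 2 * int i + int j"] Suc.IH]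
        by (simp add: algebra_simps)
    qed
  qed
  show "weight_less (weight t) (weight s)" if "below t s"
    using that unfolding below_def
  proof (elim exE conjE)
    fix i j :: nat
    assume "0 < i + j" "int (count_list t Pos) = int (count_list s Pos) + int i - 2 * int j"
      "int (count_list t Neg) = int (count_list s Neg) - 2 * int i + int j"
    then show ?thesis
      using 2[of i j "int (count_list s Pos)" "int (count_list s Neg)"] by (simp add: weight_def)
  qed
qed

lemma cap_below: "below (l @ r) (l @ [x, opp x] @ r)"
  by (rule belowI[of 1 1 _ x]) auto

lemma mg_below: "below (l @ [opp x] @ r) (l @ [x, x] @ r)"
  by (rule belowI[of 0 1 _ x]) auto

text \<open>A lower weight means a shorter word, but rungs preserve the length, so the span of rung
  paths ending at \<open>t\<close> is 0.\<close>

lemma kills_below: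
  assumes "kills s p" "s = sg x a b" "f \<in> Hom s t" "below t s"
  shows "f \<circle> p = 0"
proof -
  have "rung_span s t p (f \<circle> p)"
    by (rule narrow_rung_span[OF assms(1,2) Hom_narrow]) (use assms(3) below_length[OF assms(4)] in auto)
  moreover have "h = 0" if "rung_span s t p h" for h
    using that
  proof (induction rule: rung_span.induct)
    case (base g c)
    then show ?case using below_length[OF assms(4)] rungs_length by fastforce
  qed auto
  ultimately show ?thesis by blast
qed

text \<open>What survives on \<open>p\<close> are closed rung paths, and these fix
  \<open>p\<close>.\<close>

lemma kills_End:
  assumes "kills s p" "s = sg x a b" "f \<in> Hom s s" "p \<in> Hom u s"
  shows "\<exists>c. f \<circle> p = c \<cdot> p"
proof -
  have "rung_span s s p (f \<circle> p)"
    by (rule narrow_rung_span[OF assms(1,2) Hom_narrow]) (use assms(3) in auto)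
  then show ?thesis
  proof (induction rule: rung_span.induct)
    case zero
    then show ?case by (metis skein.scale_zero_left)
  next
    case (add f g)
    then show ?case by (metis skein.scale_left_distrib)
  next
    case (base g c)
    then show ?case using rungs_id[OF assms(1,2) _ assms(4)] by auto
  qed
qed


subsection \<open>Strong clasps\<close>

inductive starts_down :: "sword \<Rightarrow> sword \<Rightarrow> skein \<Rightarrow> bool" for s u
  where
    zero: "starts_down s u 0"
  | add: "starts_down s u f \<Longrightarrow> starts_down s u g \<Longrightarrow> starts_down s u (f + g)"
  | cap: "s = l @ [x, opp x] @ r \<Longrightarrow> f \<in> Hom (l @ r) u \<Longrightarrow> starts_down s u (f \<circle> wid l (cap x) r)"
  | mg: "s = l @ [x, x] @ r \<Longrightarrow> f \<in> Hom (l @ [opp x] @ r) u \<Longrightarrow> starts_down s u (f \<circle> wid l (mg x) r)"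

lemma starts_down_comp: "starts_down s u f \<Longrightarrow> g \<in> Hom u v \<Longrightarrow> starts_down s v (g \<circle> f)"
proof (induction rule: starts_down.induct)
  case (cap l x r f)
  then show ?case
    using starts_down.cap[OF cap(1) Hom_comp[OF cap(2,3)]] by (simp add: comp_skein_assoc)
next
  case (mg l x r f)
  then show ?case
    using starts_down.mg[OF mg(1) Hom_comp[OF mg(2,3)]] by (simp add: comp_skein_assoc)
qed (auto simp: comp_add_right intro: starts_down.intros)

lemma starts_down_scale: "starts_down s u f \<Longrightarrow> starts_down s u (c \<cdot> f)"
proof (induction rule: starts_down.induct)
  case (cap l x r f)
  then show ?case
    using starts_down.cap[OF cap(1) Hom_scale[OF cap(2), of c]] by simp
next
  case (mg l x r f)
  then show ?case
    using starts_down.mg[OF mg(1) Hom_scale[OF mg(2), of c]] by simp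
qed (auto simp: skein.scale_right_distrib intro: starts_down.intros)

lemma starts_down_wid: "starts_down s u f \<Longrightarrow> starts_down (s @ v) (u @ v) (wid [] f v)"
proof (induction rule: starts_down.induct)
  case (cap l x r f)
  then show ?case
    using starts_down.cap[of "s @ v" l x "r @ v" "wid [] f v" "u @ v"] Hom_wid[OF cap(2), of "[]" v]
    by (simp add: wid_comp)
next
  case (mg l x r f)
  then show ?case
    using starts_down.mg[of "s @ v" l x "r @ v" "wid [] f v" "u @ v"] Hom_wid[OF mg(2), of "[]" v]
    by (simp add: wid_comp)
qed (auto simp: wid_add intro: starts_down.intros)

lemma starts_down_kills: "starts_down s u f \<Longrightarrow> kills s p \<Longrightarrow> f \<circle> p = 0"
  by (induction rule: starts_down.induct) (auto simp: comp_add_left comp_skein_assoc dest: killsD)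

text \<open>The invariant of the induction. The third condition gives
  \<open>p \<circle> g = g\<close> for every killed \<open>g\<close>, in particular idempotence;
  reflection invariance carries each statement about the top of \<open>p\<close> over to its
  bottom.\<close>

definition strong :: "sword \<Rightarrow> skein \<Rightarrow> bool"
  where "strong s p \<longleftrightarrow> p \<in> Hom s s \<and> kills s p \<and> starts_down s s (p - id_skein s) \<and> flip_skein p = p"

lemma strongD:
  assumes "strong s p"
  shows "p \<in> Hom s s" "kills s p" "starts_down s s (p - id_skein s)" "flip_skein p = p"
  using assms by (auto simp: strong_def)

lemma strong_absorb:
  assumes "strong s p" "kills s g" "g \<in> Hom u s"
  shows "p \<circle> g = g"
  using starts_down_kills[OF strongD(3)[OF assms(1)] assms(2)] Hom_id_comp[OF assms(3)]
  by (simp add: comp_diff_left)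

lemma strong_idem: "strong s p \<Longrightarrow> p \<circle> p = p"
  using strong_absorb strongD by blast

lemma strong_below:
  assumes "strong s p" "s = sg x a b" "f \<in> Hom s t" "below t s"
  shows "f \<circle> p = 0"
  using kills_below[OF strongD(2)[OF assms(1)] assms(2-4)] .

lemma strong_below':
  assumes "strong s p" "s = sg x a b" "f \<in> Hom t s" "below t s"
  shows "p \<circle> f = 0"
  using arg_cong[OF strong_below[OF assms(1,2) Hom_flip[OF assms(3)] assms(4)], of flip_skein]
  by (simp add: flip_comp strongD(4)[OF assms(1)])

lemma strong_absorb_right:
  assumes "strong s p" "kills s (flip_skein g)" "g \<in> Hom s u"
  shows "g \<circle> p = g"
  using arg_cong[OF strong_absorb[OF assms(1,2) Hom_flip[OF assms(3)]], of flip_skein]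
  by (simp add: flip_comp strongD(4)[OF assms(1)])

lemma strong_kills:
  assumes "strong s p" "s = sg x a b" "h \<in> Hom s t" "same_weight t s"
  shows "kills t (h \<circle> p)"
  unfolding kills_def
proof (intro allI conjI impI)
  fix l y r
  show "wid l (cap y) r \<circle> (h \<circle> p) = 0" if t: "t = l @ [y, opp y] @ r"
    using strong_below[OF assms(1,2) Hom_comp[OF assms(3) Hom_widI[of "cap y" "[y, opp y]" "[]" t l r "l @ r"]]]
      below_same_weight[OF cap_below[of l r y], of s] assms(4) t by (simp add: comp_skein_assoc)
  show "wid l (mg y) r \<circle> (h \<circle> p) = 0" if t: "t = l @ [y, y] @ r"
    using strong_below[OF assms(1,2) Hom_comp[OF assms(3) Hom_widI[of "mg y" "[y, y]" "[opp y]" t l r "l @ [opp y] @ r"]]]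
      below_same_weight[OF mg_below[of l y r], of s] assms(4) t by (simp add: comp_skein_assoc)
qed

text \<open>Here \<open>p\<close> covers all strands but the last, so a comparison of weights does
  not apply to \<open>f\<close> itself. Bending the last strand upwards turns \<open>f\<close> into
  an element of \<open>Hom s (t @ [opp y])\<close> placed above \<open>p\<close>, and a zigzag
  undoes the bending.\<close>

lemma bend_last:
  assumes "f \<in> Hom (s @ [y]) t" "p \<in> Hom u s"
  shows "f \<circle> wid [] p [y] = wid t (cap (opp y)) [] \<circle> wid [] ((wid [] f [opp y] \<circle> wid s (cup y) []) \<circle> p) [y]"
proof -
  have "wid t (cap (opp y)) [] \<circle> wid [] f [opp y, y] = f \<circle> wid (s @ [y]) (cap (opp y)) []"
    using wid_exchange[OF assms(1) cap_opp_Hom(1)[of y], of "[]" "[]" "[]"] by simp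
  from comp_eq_extend[OF this]
  have "wid t (cap (opp y)) [] \<circle> wid [] (wid [] f [opp y] \<circle> wid s (cup y) []) [y] =
      f \<circle> (wid (s @ [y]) (cap (opp y)) [] \<circle> wid s (cup y) [y])"
    by (simp add: wid_comp)
  also have "wid (s @ [y]) (cap (opp y)) [] \<circle> wid s (cup y) [y] = id_skein (s @ [y])"
    using wid_eq[OF zigzag_left[of y], of s "[]"] by simp
  finally have "wid t (cap (opp y)) [] \<circle> wid [] (wid [] f [opp y] \<circle> wid s (cup y) []) [y] = f"
    using Hom_comp_id[OF assms(1)] by simp
  then show ?thesis
    by (simp add: wid_comp[of _ _ p] flip: comp_skein_assoc)
qed

lemma strong_below_bend:
  assumes "strong s p" "s = sg x a b" "f \<in> Hom (s @ [y]) t" "below (t @ [opp y]) s"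
  shows "f \<circle> wid [] p [y] = 0"
proof -
  have "wid [] f [opp y] \<circle> wid s (cup y) [] \<in> Hom s (t @ [opp y])"
    by (rule Hom_comp[OF Hom_widI[OF piece_Hom(1)] Hom_widI[OF assms(3)]]) auto
  from strong_below[OF assms(1,2) this assms(4)] show ?thesis
    unfolding bend_last[OF assms(3) strongD(1)[OF assms(1)]] by simp
qed

lemma strong_kills_bend:
  assumes "strong s p" "s = sg x a b" "h \<in> Hom (s @ [y]) t" "same_weight (t @ [opp y]) s"
  shows "kills t (h \<circle> wid [] p [y])"
  unfolding kills_def
proof (intro allI conjI impI)
  fix l z r
  show "wid l (cap z) r \<circle> (h \<circle> wid [] p [y]) = 0" if t: "t = l @ [z, opp z] @ r"
    using strong_below_bend[OF assms(1,2) Hom_comp[OF assms(3) Hom_widI[of "cap z" "[z, opp z]" "[]" t l r "l @ r"]]]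
      below_same_weight[OF below_append[OF cap_below[of l r z]], of "[opp y]" s] assms(4) t by (simp add: comp_skein_assoc)
  show "wid l (mg z) r \<circle> (h \<circle> wid [] p [y]) = 0" if t: "t = l @ [z, z] @ r"
    using strong_below_bend[OF assms(1,2) Hom_comp[OF assms(3) Hom_widI[of "mg z" "[z, z]" "[opp z]" t l r "l @ [opp z] @ r"]]]
      below_same_weight[OF below_append[OF mg_below[of l z r]], of "[opp y]" s] assms(4) t by (simp add: comp_skein_assoc)
qed

text \<open>For a second clasp \<open>p'\<close> the product \<open>p' \<circle> p\<close> is
  evaluated twice. As \<open>p - id\<close> factors through lower weights, it equals
  \<open>p'\<close>; as endomorphisms act on \<open>p\<close> by scalars, it equals
  \<open>c \<cdot> p\<close>. Idempotence of both leaves \<open>c * c = c\<close>.\<close>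

lemma clasp_eq_strong:
  assumes "strong s p" "s = sg x a b" "p \<noteq> 0"
  shows "clasp s = p"
  unfolding clasp_def
proof (rule the_equality)
  show "is_clasp s p"
    unfolding is_clasp_def weight_less_below
    by (intro conjI allI impI ballI strongD(1)[OF assms(1)] strong_idem[OF assms(1)] assms(3)
        strong_below[OF assms(1,2)] strong_below'[OF assms(1,2)])
next
  fix p'
  assume p': "is_clasp s p'"
  have kl: "f \<in> Hom t s \<Longrightarrow> below t s \<Longrightarrow> p' \<circle> f = 0" for f t
    using p' unfolding is_clasp_def weight_less_below by blast
  have *: "p' \<circle> f = 0" if "starts_down s s f" for f
    using that
  proof (induction rule: starts_down.induct)
    case (cap l x r f)
    then show ?case using kl[OF cap(2)] cap_below[of l r x] by (simp flip: comp_skein_assoc)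
  next
    case (mg l x r f)
    then show ?case using kl[OF mg(2)] mg_below[of l x r] by (simp flip: comp_skein_assoc)
  qed (auto simp: comp_add_right)
  have H: "p' \<in> Hom s s" and "p' \<noteq> 0" and idem: "p' \<circle> p' = p'"
    using p' by (auto simp: is_clasp_def)
  have "p' \<circle> p = p'"
    using *[OF strongD(3)[OF assms(1)]] Hom_comp_id[OF H] by (simp add: comp_diff_right)
  moreover obtain c where c: "p' \<circle> p = c \<cdot> p"
    using kills_End[OF strongD(2)[OF assms(1)] assms(2) H strongD(1)[OF assms(1)]] by blast
  ultimately have e: "p' = c \<cdot> p" by simp
  with idem strong_idem[OF assms(1)] have "(c * c) \<cdot> p = c \<cdot> p" by simp
  then have "c * c = c"
    using assms(3) skein.scale_cancel_right by blast
  moreover have "c \<noteq> 0" using \<open>p' \<noteq> 0\<close> e by auto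
  ultimately show "p' = p" using e by simp
qed

section \<open>Quantum integers\<close>

lemma q_half_power: "q_half ^ n = Fract ([:0, 1:] ^ n) 1"
  by (induction n) (simp_all add: q_half_def One_fract_def)

lemma q_half_nonzero [simp]: "q_half \<noteq> 0"
  by (simp add: q_half_def Zero_fract_def eq_fract)

lemma q_half_power_neq_one: "n > 0 \<Longrightarrow> q_half ^ n \<noteq> 1"
proof
  assume n: "n > 0" and "q_half ^ n = 1"
  then have "[:0, 1::complex:] ^ n = 1"
    by (simp add: q_half_power One_fract_def eq_fract)
  then have "degree ([:0, 1::complex:] ^ n) = 0" by simp
  then show False using n by (simp add: degree_power_eq)
qed

lemma q_half_diff: "q_half - inverse q_half \<noteq> 0"
proof
  assume "q_half - inverse q_half = 0"
  then have "q_half ^ 2 = 1"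
    by (simp add: power2_eq_square field_simps)
  then show False using q_half_power_neq_one[of 2] by simp
qed

lemma qint_nonzero [simp]: "n > 0 \<Longrightarrow> qint n \<noteq> 0"
proof
  assume n: "n > 0" and "qint n = 0"
  then have "q_half ^ n = inverse q_half ^ n"
    using q_half_diff by (simp add: qint_def)
  then have "q_half ^ n * q_half ^ n = 1"
    by (simp add: field_simps)
  then show False
    using q_half_power_neq_one[of "n + n"] n by (simp add: power_add)
qed

lemma qint_0 [simp]: "qint 0 = 0"
  and qint_1 [simp]: "qint (Suc 0) = 1"
  using q_half_diff by (simp_all add: qint_def)

lemma qint_two_times: "qint 2 * qint (Suc n) = qint (n + 2) + qint n"
proof -
  have "qint 2 = q_half + inverse q_half"
    using q_half_diff by (simp add: qint_def field_simps power2_eq_square)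
  moreover have *: "q_half * (inverse q_half * z) = z" for z
    by (simp flip: mult.assoc)
  have "(q_half + inverse q_half) * (q_half ^ Suc n - inverse q_half ^ Suc n) =
      (q_half ^ (n + 2) - inverse q_half ^ (n + 2)) + (q_half ^ n - inverse q_half ^ n)"
    by (simp add: algebra_simps *)
  ultimately show ?thesis
    by (simp add: qint_def add_divide_distrib[symmetric])
qed

text \<open>Brings the trace of the last strand of a one-letter clasp,
  \<open>[3] - [2][n]/[n+1]\<close>, to the form \<open>[n+3]/[n+1]\<close>.\<close>

lemma qint_three_times: "qint 3 * qint (Suc n) = qint 2 * qint n + qint (n + 3)"
  using qint_two_times[of 1] qint_two_times[of n] qint_two_times[of "Suc n"]
  by (simp add: numeral_3_eq_3 numeral_2_eq_2) algebra

text \<open>Responsible for the denominators \<open>[a+b+1]\<close>: it makes the coefficients of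
  consecutive steps of the recursion compatible in \<open>last_merge_numbers\<close>.\<close>

lemma qint_exchange: "qint (Suc b) * qint (Suc (a + b)) = qint b * qint (a + b + 2) + qint (Suc a)"
proof (induction b)
  case (Suc b)
  have "qint 2 * qint (Suc b) = qint (b + 2) + qint b"
    "qint 2 * qint (Suc (a + b + 1)) = qint (a + b + 3) + qint (a + b + 1)"
    using qint_two_times[of b] qint_two_times[of "a + b + 1"] by (simp_all add: numeral_3_eq_3 numeral_2_eq_2)
  then have "qint (b + 2) * qint (a + b + 2) = qint (Suc b) * qint (a + b + 3) + qint (Suc b) * qint (a + b + 1) - qint b * qint (a + b + 2)"
    by simp algebra
  with Suc show ?case by (simp add: numeral_3_eq_3 numeral_2_eq_2)
qed simp


section \<open>Paths of rungs\<close>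

lemma rungs_trans: "rungs t u g \<Longrightarrow> rungs s t f \<Longrightarrow> rungs s u (g \<circle> f)"
proof (induction rule: rungs.induct)
  case refl
  then show ?case by (simp add: Hom_id_comp[OF rungs_Hom])
next
  case (step l x r g)
  then show ?case using rungs.step[of s l x r "g \<circle> f"] by (simp add: comp_skein_assoc)
qed

lemma rungs_transI: "rungs s t f \<Longrightarrow> rungs t' u g \<Longrightarrow> t = t' \<Longrightarrow> rungs s u (g \<circle> f)"
  using rungs_trans by blast

lemma rungs_wid: "rungs s t f \<Longrightarrow> rungs (l @ s @ r) (l @ t @ r) (wid l f r)"
proof (induction rule: rungs.induct)
  case (step l' x r' f)
  then show ?case using rungs.step[of "l @ s @ r" "l @ l'" x "r' @ r" "wid l f r"] by (simp add: wid_comp)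
qed (simp add: rungs.refl)

lemma rungs_rung: "rungs (l @ [x, opp x] @ r) (l @ [opp x, x] @ r) (wid l (rung x) r)"
  using rungs.step[OF rungs.refl, of l x r] Hom_comp_id[OF Hom_wid[OF rung_Hom, of l x r]] by simp

lemma rungs_flip: "rungs s t f \<Longrightarrow> rungs t s (flip_skein f)"
proof (induction rule: rungs.induct)
  case (step l x r f)
  then show ?case
    using rungs_transI[OF rungs_rung[of l "opp x" r] step.IH]
    by (simp add: flip_comp flip_wid flip_rung)
qed (simp add: rungs.refl)

lemma rungs_same_weight: "rungs s t f \<Longrightarrow> same_weight t s"
  by (auto simp: same_weight_def rungs_count)

primrec pass :: "sgn \<Rightarrow> nat \<Rightarrow> skein"
  where
    "pass x 0 = id_skein [x]"
  | "pass x (Suc n) = wid [opp x] (pass x n) [] \<circle> wid [] (rung x) (replicate n (opp x))"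

lemma rungs_pass: "rungs (x # replicate n (opp x)) (replicate n (opp x) @ [x]) (pass x n)"
proof (induction n)
  case (Suc n)
  show ?case
    using rungs_transI[OF rungs_rung[of "[]" x "replicate n (opp x)"] rungs_wid[OF Suc.IH, of "[opp x]" "[]"]] by simp
qed (simp add: rungs.refl)

text \<open>The innermost \<open>x\<close> moves first, so \<open>pass x c\<close> is the lowest
  factor; in \<open>twisted_trace\<close> it meets the arc \<open>alpha\<close> there.\<close>

primrec sweep :: "sgn \<Rightarrow> nat \<Rightarrow> nat \<Rightarrow> skein"
  where
    "sweep x 0 c = id_skein (replicate c (opp x))"
  | "sweep x (Suc j) c = wid [] (sweep x j c) [x] \<circle> wid (replicate j x) (pass x c) []"

lemma rungs_sweep: "rungs (sg x j c) (sg (opp x) c j) (sweep x j c)"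
proof (induction j)
  case (Suc j)
  have "rungs (sg x (Suc j) c) (sg x j c @ [x]) (wid (replicate j x) (pass x c) [])"
    using rungs_wid[OF rungs_pass[of x c], of "replicate j x" "[]"] by (simp add: sg_def)
  from rungs_transI[OF this rungs_wid[OF Suc.IH, of "[]" "[x]"]] show ?case
    by (simp add: sg_def replicate_append_same)
qed (simp add: sg_def rungs.refl)


section \<open>The webs in the recursion\<close>

definition Hweb :: "sgn \<Rightarrow> skein"
  where "Hweb y = sp (opp y) \<circle> mg y"

primrec alpha :: "sgn \<Rightarrow> nat \<Rightarrow> skein"
  where
    "alpha x 0 = cup x"
  | "alpha x (Suc n) = wid (x # replicate n (opp x)) (Hweb (opp x)) [] \<circle> wid [] (alpha x n) [opp x]"

definition beta :: "sgn \<Rightarrow> nat \<Rightarrow> skein"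
  where "beta x n = flip_skein (alpha x n)"

lemma Hweb_Hom [intro, simp]: "Hweb y \<in> Hom [y, y] [y, y]"
  unfolding Hweb_def by (rule Hom_comp[of _ _ "[opp y]"]) auto

lemma flip_Hweb [simp]: "flip_skein (Hweb y) = Hweb y"
  by (simp add: Hweb_def flip_comp flip_piece_skein)

lemma alpha_Hom [intro, simp]: "alpha x n \<in> Hom (replicate n (opp x)) (x # opp x # replicate n (opp x))"
proof (induction n)
  case (Suc n)
  show ?case
    unfolding alpha.simps
    by (rule Hom_comp[OF Hom_widI[OF Suc.IH] Hom_widI[OF Hweb_Hom]]) (auto simp: replicate_append_same)
qed auto

lemma beta_Hom [intro, simp]: "beta x n \<in> Hom (x # opp x # replicate n (opp x)) (replicate n (opp x))"
  unfolding beta_def by (rule Hom_flip[OF alpha_Hom])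

lemma flip_alpha: "flip_skein (alpha x n) = beta x n" "flip_skein (beta x n) = alpha x n"
  by (simp_all add: beta_def)

lemma beta_simps:
  "beta x 0 = cap x"
  "beta x (Suc n) = wid [] (beta x n) [opp x] \<circle> wid (x # replicate n (opp x)) (Hweb (opp x)) []"
  by (simp_all add: beta_def flip_piece_skein flip_comp flip_wid)

lemma alpha_one: "alpha x (Suc 0) = wid [x] (sp x) [] \<circle> sp (opp x)"
  using mg_cup_left[of "opp x"] by (simp add: Hweb_def wid_comp comp_skein_assoc)

text \<open>The leftmost crossing may instead be placed on the rising part of the arc, where it
  resolves to a rung and not to an H. The base case is \<open>rung_cup_right\<close>; the other
  crossings are far away.\<close>

lemma alpha_Suc_left:
  "alpha x (Suc n) = wid [] (rung (opp x)) (opp x # replicate n (opp x)) \<circle> wid [opp x] (alpha x n) []"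
proof (induction n)
  case 0
  show ?case
    using alpha_one[of x] rung_cup_right[of "opp x"] by simp
next
  case (Suc n)
  let ?o = "replicate n (opp x)"
  have "alpha x (Suc (Suc n)) = (wid (x # opp x # ?o) (Hweb (opp x)) [] \<circle> wid [] (rung (opp x)) (opp x # opp x # ?o)) \<circle> wid [opp x] (alpha x n) [opp x]"
    by (subst alpha.simps(2), subst Suc.IH) (simp add: wid_comp comp_skein_assoc replicate_append_same)
  also have "wid (x # opp x # ?o) (Hweb (opp x)) [] \<circle> wid [] (rung (opp x)) (opp x # opp x # ?o) =
      wid [] (rung (opp x)) (opp x # opp x # ?o) \<circle> wid (opp x # x # ?o) (Hweb (opp x)) []"
    by (rule wid_exchangeI[of _ "[opp x, x]" "[x, opp x]" _ "[opp x, opp x]" "[opp x, opp x]", symmetric]) auto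
  finally show ?case
    by (simp add: wid_comp comp_skein_assoc)
qed

lemma beta_Suc_left:
  "beta x (Suc n) = wid [opp x] (beta x n) [] \<circle> wid [] (rung x) (opp x # replicate n (opp x))"
  unfolding beta_def alpha_Suc_left by (simp add: flip_comp flip_wid flip_rung)

text \<open>With all crossings on its rising part, the arc is a path of rungs closed by a
  cap.\<close>

lemma beta_pass: "beta x n = wid (replicate n (opp x)) (cap x) [] \<circle> wid [] (pass x n) [opp x]"
proof (induction n)
  case 0
  show ?case using Hom_comp_id[OF piece_Hom(2), of x] by (simp add: beta_simps)
next
  case (Suc n)
  show ?case
    by (subst beta_Suc_left, subst Suc.IH) (simp add: wid_comp comp_skein_assoc replicate_append_same)
qed

text \<open>The cap over the first rung of the arc gives two merges. What matters is that one of
  them slides to the very bottom, so that the composite vanishes on clasps.\<close>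

lemma cap_alpha:
  "wid [] (cap (opp x)) (opp x # opp x # replicate n (opp x)) \<circle> wid [opp x] (alpha x (Suc n)) [] =
    wid [] (mg x) (opp x # replicate n (opp x)) \<circle> wid [x] (alpha x n) [] \<circle> wid [] (mg (opp x)) (replicate n (opp x))"
proof -
  let ?o = "replicate n (opp x)"
  have "wid [] (cap (opp x)) (opp x # opp x # ?o) \<circle> wid [opp x] (alpha x (Suc n)) [] =
      wid [] (wid [] (cap (opp x)) [opp x] \<circle> wid [opp x] (rung (opp x)) []) (opp x # ?o) \<circle> wid [opp x, opp x] (alpha x n) []"
    by (subst alpha_Suc_left) (simp add: wid_comp comp_skein_assoc)
  also have "wid [] (cap (opp x)) [opp x] \<circle> wid [opp x] (rung (opp x)) [] = mg x \<circle> wid [] (mg (opp x)) [x]"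
    using cap_rung_left[of "opp x"] by simp
  also have "wid [] \<dots> (opp x # ?o) \<circle> wid [opp x, opp x] (alpha x n) [] =
      wid [] (mg x) (opp x # ?o) \<circle> (wid [] (mg (opp x)) (x # opp x # ?o) \<circle> wid [opp x, opp x] (alpha x n) [])"
    by (simp add: wid_comp comp_skein_assoc)
  also have "wid [] (mg (opp x)) (x # opp x # ?o) \<circle> wid [opp x, opp x] (alpha x n) [] =
      wid [x] (alpha x n) [] \<circle> wid [] (mg (opp x)) ?o"
    by (rule wid_exchangeI[of _ "[opp x, opp x]" "[x]" _ ?o "x # opp x # ?o"]) auto
  finally show ?thesis by (simp add: comp_skein_assoc)
qed

lemma starts_down_widen: "starts_down s u f \<Longrightarrow> starts_down (v @ s @ w) (v @ u @ w) (wid v f w)"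
proof (induction rule: starts_down.induct)
  case (cap l x r f)
  then show ?case
    using starts_down.cap[of "v @ s @ w" "v @ l" x "r @ w" "wid v f w" "v @ u @ w"] Hom_wid[OF cap(2), of v w]
    by (simp add: wid_comp)
next
  case (mg l x r f)
  then show ?case
    using starts_down.mg[of "v @ s @ w" "v @ l" x "r @ w" "wid v f w" "v @ u @ w"] Hom_wid[OF mg(2), of v w]
    by (simp add: wid_comp)
qed (auto simp: wid_add intro: starts_down.intros)

lemma cap_alpha_starts_down:
  "starts_down (opp x # opp x # replicate n (opp x)) (opp x # opp x # replicate n (opp x))
    (wid [] (cap (opp x)) (opp x # opp x # replicate n (opp x)) \<circle> wid [opp x] (alpha x (Suc n)) [])"
  unfolding cap_alpha
  by (rule starts_down.mg[of _ "[]" "opp x" "replicate n (opp x)"], simp,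
      rule Hom_comp[OF Hom_widI[OF alpha_Hom] Hom_widI[OF piece_Hom(3)]]) auto

lemma pass_alpha_Suc:
  "wid [] (pass x (Suc n)) (opp x # r) \<circle> wid [] (alpha x (Suc n)) r =
    wid [opp x] (wid [] (pass x n) (opp x # r) \<circle> wid [] (alpha x n) r) [] +
    wid [opp x] (pass x n) (opp x # r) \<circle> (wid [] (cup (opp x)) (opp x # replicate n (opp x) @ r) \<circle>
      (wid [] (cap (opp x)) (opp x # replicate n (opp x) @ r) \<circle> wid [opp x] (alpha x n) r))"
proof -
  let ?o = "opp x # replicate n (opp x) @ r"
  have "wid [] (pass x (Suc n)) (opp x # r) \<circle> wid [] (alpha x (Suc n)) r =
      wid [opp x] (pass x n) (opp x # r) \<circle> (wid [] (rung (opp (opp x)) \<circle> rung (opp x)) ?o \<circle> wid [opp x] (alpha x n) r)"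
    by (subst alpha_Suc_left) (simp add: wid_comp comp_skein_assoc replicate_append_same)
  also have "\<dots> = wid [opp x] (pass x n) (opp x # r) \<circle> (id_skein (opp x # x # ?o) \<circle> wid [opp x] (alpha x n) r) +
    wid [opp x] (pass x n) (opp x # r) \<circle> (wid [] (cup (opp x)) ?o \<circle> (wid [] (cap (opp x)) ?o \<circle> wid [opp x] (alpha x n) r))"
    unfolding rung_rung by (simp add: wid_add wid_comp comp_add_left comp_add_right comp_skein_assoc)
  also have "id_skein (opp x # x # ?o) \<circle> wid [opp x] (alpha x n) r = wid [opp x] (alpha x n) r"
    by (rule Hom_id_comp[OF Hom_widI[OF alpha_Hom]]) auto
  finally show ?thesis by (simp add: wid_comp)
qed

text \<open>The rungs of \<open>pass\<close> cancel against those of the arc. Each cancellation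
  leaves a cup-cap term that starts with a merge by \<open>cap_alpha\<close>. The arc has one
  crossing more than the path has rungs, and this crossing survives.\<close>

lemma pass_alpha_long:
  "starts_down (opp x # replicate c (opp x)) (replicate c (opp x) @ [x, opp x, opp x])
    (wid [] (pass x c) [opp x, opp x] \<circle> alpha x (Suc c) - wid (replicate c (opp x)) (alpha x (Suc 0)) [])"
proof (induction c)
  case 0
  have "alpha x (Suc 0) \<in> Hom [opp x] [x, opp x, opp x]" using alpha_Hom[of x 1] by simp
  then show ?case by (simp add: Hom_id_comp starts_down.zero del: alpha.simps)
next
  case (Suc c)
  let ?o = "replicate c (opp x)"
  have pass: "pass x c \<in> Hom (x # ?o) (?o @ [x])" by (rule rungs_Hom[OF rungs_pass])
  have "wid [] (pass x (Suc c)) [opp x, opp x] \<circle> alpha x (Suc (Suc c)) =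
      wid [] (pass x (Suc c)) [opp x, opp x] \<circle> (wid [] (rung (opp x)) (opp x # opp x # ?o) \<circle> wid [opp x] (alpha x (Suc c)) [])"
    by (subst alpha_Suc_left) simp
  also have "\<dots> = wid [opp x] (pass x c) [opp x, opp x] \<circle> (wid [] (rung (opp (opp x)) \<circle> rung (opp x)) (opp x # opp x # ?o) \<circle> wid [opp x] (alpha x (Suc c)) [])"
    by (simp add: wid_comp comp_skein_assoc replicate_append_same del: alpha.simps)
  also have "\<dots> = wid [opp x] (pass x c) [opp x, opp x] \<circle> (id_skein (opp x # x # opp x # opp x # ?o) \<circle> wid [opp x] (alpha x (Suc c)) []) +
    wid [opp x] (pass x c) [opp x, opp x] \<circle> (wid [] (cup (opp x)) (opp x # opp x # ?o) \<circle> (wid [] (cap (opp x)) (opp x # opp x # ?o) \<circle> wid [opp x] (alpha x (Suc c)) []))"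
    unfolding rung_rung by (simp add: wid_add wid_comp comp_add_left comp_add_right comp_skein_assoc del: alpha.simps)
  also have "id_skein (opp x # x # opp x # opp x # ?o) \<circle> wid [opp x] (alpha x (Suc c)) [] = wid [opp x] (alpha x (Suc c)) []"
    by (rule Hom_id_comp[OF Hom_widI[OF alpha_Hom]]) auto
  finally have e: "wid [] (pass x (Suc c)) [opp x, opp x] \<circle> alpha x (Suc (Suc c)) - wid (replicate (Suc c) (opp x)) (alpha x (Suc 0)) [] =
      wid [opp x] (wid [] (pass x c) [opp x, opp x] \<circle> alpha x (Suc c) - wid ?o (alpha x (Suc 0)) []) [] +
      (wid [opp x] (pass x c) [opp x, opp x] \<circle> wid [] (cup (opp x)) (opp x # opp x # ?o)) \<circle> (wid [] (cap (opp x)) (opp x # opp x # ?o) \<circle> wid [opp x] (alpha x (Suc c)) [])"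
    by (simp add: wid_diff wid_comp comp_skein_assoc del: alpha.simps)
  have "wid [opp x] (pass x c) [opp x, opp x] \<circle> wid [] (cup (opp x)) (opp x # opp x # ?o) \<in>
      Hom (opp x # opp x # ?o) (opp x # ?o @ [x, opp x, opp x])"
    by (rule Hom_comp[OF Hom_widI[OF cap_opp_Hom(2)] Hom_widI[OF pass]]) auto
  from starts_down_comp[OF cap_alpha_starts_down this]
  show ?case
    unfolding e using starts_down_widen[OF Suc.IH, of "[opp x]" "[]"]
    by (simp add: starts_down.add del: alpha.simps)
qed

text \<open>With equally many crossings the last cancellation meets a bare cup: there the cap
  produces no merge but a zigzag, which accounts for the second surviving term.\<close>

lemma pass_alpha_short:
  "starts_down (replicate (Suc c) (opp x)) (replicate (Suc c) (opp x) @ [x, opp x])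
    (wid [] (pass x (Suc c)) [opp x] \<circle> alpha x (Suc c) - wid (replicate (Suc c) (opp x)) (cup x) []
      - wid (replicate c (opp x)) (cup (opp x)) [opp x])"
proof (induction c)
  case 0
  have "wid [] (cap (opp x)) [opp x] \<circle> wid [opp x] (cup x) [] = id_skein [opp x]"
    using zigzag_right[of "opp x"] by simp
  moreover have "id_skein [x, opp x] \<circle> cup x = cup x" by (rule Hom_id_comp[OF piece_Hom(1)])
  moreover have "wid [opp x] (cup x) [] \<in> Hom [opp x] [opp x, x, opp x]" "wid [] (cup (opp x)) [opp x] \<in> Hom [opp x] [opp x, x, opp x]"
    by (rule Hom_widI[OF piece_Hom(1)] Hom_widI[OF cap_opp_Hom(2)]; simp)+
  ultimately show ?case
    using pass_alpha_Suc[of x 0 "[]"] by (simp add: Hom_id_comp Hom_comp_id starts_down.zero del: alpha.simps(2) pass.simps(2))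
next
  case (Suc c)
  let ?o = "replicate (Suc c) (opp x)"
  have pass: "pass x (Suc c) \<in> Hom (x # ?o) (?o @ [x])" by (rule rungs_Hom[OF rungs_pass])
  have e: "wid [] (pass x (Suc (Suc c))) [opp x] \<circle> alpha x (Suc (Suc c)) - wid (replicate (Suc (Suc c)) (opp x)) (cup x) []
      - wid ?o (cup (opp x)) [opp x] =
      wid [opp x] (wid [] (pass x (Suc c)) [opp x] \<circle> alpha x (Suc c) - wid ?o (cup x) [] - wid (replicate c (opp x)) (cup (opp x)) [opp x]) [] +
      (wid [opp x] (pass x (Suc c)) [opp x] \<circle> wid [] (cup (opp x)) (opp x # ?o)) \<circle> (wid [] (cap (opp x)) (opp x # ?o) \<circle> wid [opp x] (alpha x (Suc c)) [])"
    using pass_alpha_Suc[of x "Suc c" "[]"] by (simp add: wid_diff wid_comp comp_skein_assoc del: alpha.simps pass.simps)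
  have "wid [opp x] (pass x (Suc c)) [opp x] \<circle> wid [] (cup (opp x)) (opp x # ?o) \<in>
      Hom (opp x # ?o) (opp x # ?o @ [x, opp x])"
    by (rule Hom_comp[OF Hom_widI[OF cap_opp_Hom(2)] Hom_widI[OF pass]]) auto
  from starts_down_comp[OF _ this, of "opp x # ?o"] cap_alpha_starts_down[of x c]
  show ?case
    unfolding e using starts_down_widen[OF Suc.IH, of "[opp x]" "[]"]
    by (simp add: starts_down.add del: alpha.simps pass.simps)
qed

section \<open>Small webs evaluated in the last merge and in the traces\<close>

lemma mg_Hweb: "mg (opp x) \<circle> Hweb (opp x) = (- qint 2) \<cdot> mg (opp x)"
  using comp_eq_absorb[OF bigon, of x "mg (opp x)"] Hom_id_comp[OF cap_opp_Hom(3), of x]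
  by (simp add: Hweb_def del: skein.scale_minus_left)

lemma mg_Hweb_Hweb:
  "wid [opp x] (mg (opp x)) [] \<circle> (wid [] (Hweb (opp x)) [opp x] \<circle> wid [opp x] (Hweb (opp x)) []) =
    wid [opp x] (mg (opp x)) [] + cup (opp x) \<circle> (cap (opp x) \<circle> wid [opp x] (mg (opp x)) [])"
proof -
  have "wid [opp x] (mg (opp x)) [] \<circle> (wid [] (Hweb (opp x)) [opp x] \<circle> wid [opp x] (Hweb (opp x)) []) =
    (wid [opp x] (mg (opp x)) [] \<circle> wid [] (sp x) [opp x]) \<circle> ((wid [] (mg (opp x)) [opp x] \<circle> wid [opp x] (sp x) []) \<circle> wid [opp x] (mg (opp x)) [])"
    by (simp add: Hweb_def wid_comp comp_skein_assoc)
  also have "\<dots> = (rung (opp (opp x)) \<circle> rung (opp x)) \<circle> wid [opp x] (mg (opp x)) []"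
    using rung_left[of x] rung_right[of "opp x"] by (simp add: comp_skein_assoc)
  also have "\<dots> = id_skein [opp x, x] \<circle> wid [opp x] (mg (opp x)) [] + cup (opp x) \<circle> (cap (opp x) \<circle> wid [opp x] (mg (opp x)) [])"
    unfolding rung_rung by (simp add: comp_add_left comp_skein_assoc)
  also have "id_skein [opp x, x] \<circle> wid [opp x] (mg (opp x)) [] = wid [opp x] (mg (opp x)) []"
    by (rule Hom_id_comp[OF Hom_widI[OF cap_opp_Hom(3)]]) auto
  finally show ?thesis .
qed

lemma mg_Hweb_sp:
  "wid [opp x] (mg (opp x)) [] \<circle> (wid [] (Hweb (opp x)) [opp x] \<circle> wid [opp x] (sp x) []) =
    id_skein [opp x, x] + cup (opp x) \<circle> cap (opp x)"
proof -
  have "wid [opp x] (mg (opp x)) [] \<circle> (wid [] (Hweb (opp x)) [opp x] \<circle> wid [opp x] (sp x) []) =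
    (wid [opp x] (mg (opp x)) [] \<circle> wid [] (sp x) [opp x]) \<circle> (wid [] (mg (opp x)) [opp x] \<circle> wid [opp x] (sp x) [])"
    by (simp add: Hweb_def wid_comp comp_skein_assoc)
  also have "\<dots> = rung (opp (opp x)) \<circle> rung (opp x)"
    using rung_left[of x] rung_right[of "opp x"] by simp
  finally show ?thesis by (simp add: rung_rung del: opp_opp, simp)
qed

lemma trace_Hweb: "wid [x] (cap x) [] \<circle> (wid [] (Hweb x) [opp x] \<circle> wid [x] (cup x) []) = (- qint 2) \<cdot> id_skein [x]"
proof -
  have "wid [x] (cap x) [] \<circle> (wid [] (Hweb x) [opp x] \<circle> wid [x] (cup x) []) =
      (wid [x] (cap x) [] \<circle> wid [] (sp (opp x)) [opp x]) \<circle> (wid [] (mg x) [opp x] \<circle> wid [x] (cup x) [])"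
    by (simp add: Hweb_def wid_comp comp_skein_assoc)
  also have "\<dots> = mg (opp x) \<circle> sp x"
    using cap_sp_right[of "opp x"] by (simp add: mg_cup_right)
  finally show ?thesis by (simp add: bigon del: skein.scale_minus_left)
qed

lemma cap_alpha_one: "wid [] (cap x) [opp x] \<circle> alpha x (Suc 0) = (- qint 2) \<cdot> id_skein [opp x]"
proof -
  have "wid [] (cap x) [opp x] \<circle> alpha x (Suc 0) = (wid [] (cap x) [opp x] \<circle> wid [x] (sp x) []) \<circle> sp (opp x)"
    by (simp add: alpha_one comp_skein_assoc del: alpha.simps)
  then show ?thesis
    using bigon[of "opp x"] by (simp add: cap_sp_left del: skein.scale_minus_left)
qed

lemma cap_Hweb_alpha_one:
  "wid [x] (cap x) [opp x] \<circle> (wid [] (Hweb x) [opp x, opp x] \<circle> wid [x] (alpha x (Suc 0)) []) = id_skein [x, opp x] + cup x \<circle> cap x"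
proof -
  have "wid [x] (cap x) [opp x] \<circle> (wid [] (Hweb x) [opp x, opp x] \<circle> wid [x] (alpha x (Suc 0)) []) =
      wid [] (wid [x] (cap x) [] \<circle> wid [] (sp (opp x)) [opp x]) [opp x] \<circle>
      ((wid [] (mg x) [opp x, opp x] \<circle> wid [x, x] (sp x) []) \<circle> wid [x] (sp (opp x)) [])"
    by (simp add: alpha_one Hweb_def wid_comp comp_skein_assoc del: alpha.simps)
  also have "wid [] (mg x) [opp x, opp x] \<circle> wid [x, x] (sp x) [] = wid [opp x] (sp x) [] \<circle> wid [] (mg x) [x]"
    by (rule wid_exchangeI[of _ "[x, x]" "[opp x]" _ "[x]" "[opp x, opp x]"]) auto
  also have "wid [x] (cap x) [] \<circle> wid [] (sp (opp x)) [opp x] = mg (opp x)"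
    using cap_sp_right[of "opp x"] by simp
  also have "wid [] (mg (opp x)) [opp x] \<circle> (wid [opp x] (sp x) [] \<circle> wid [] (mg x) [x] \<circle> wid [x] (sp (opp x)) []) =
      rung (opp x) \<circle> rung x"
    using rung_right[of x] rung_right[of "opp x"] by (simp add: comp_skein_assoc)
  finally show ?thesis by (simp add: rung_rung)
qed

section \<open>The recursion\<close>

primrec sclasp :: "sgn \<Rightarrow> nat \<Rightarrow> skein"
  where
    "sclasp y 0 = id_skein []"
  | "sclasp y (Suc n) = wid [] (sclasp y n) [y] + (qint n / qint (Suc n)) \<cdot>
      (wid [] (sclasp y n) [y] \<circle> (wid (replicate (n - 1) y) (Hweb y) [] \<circle> wid [] (sclasp y n) [y]))"

text \<open>The truncated \<open>b - 1\<close> and \<open>a - 1\<close> do no harm, since the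
  coefficient in front is then \<open>qint 0\<close>. The values at \<open>b = 0\<close> come from
  the one-letter recursion, which is the case \<open>a = 0\<close> of the other sign.\<close>

primrec rclasp :: "sgn \<Rightarrow> nat \<Rightarrow> nat \<Rightarrow> skein"
  where
    "rclasp x a 0 = sclasp x a"
  | "rclasp x a (Suc b) = wid [] (rclasp x a b) [opp x]
      + (qint b / qint (Suc b)) \<cdot>
        (wid [] (rclasp x a b) [opp x] \<circle> (wid (sg x a (b - 1)) (Hweb (opp x)) [] \<circle> wid [] (rclasp x a b) [opp x]))
      - (qint a / (qint (Suc b) * qint (a + b + 2))) \<cdot>
        (wid [] (rclasp x a b) [opp x] \<circle> (wid (replicate (a - 1) x) (alpha x b \<circle> beta x b) [] \<circle> wid [] (rclasp x a b) [opp x]))"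

lemma sclasp_eq_rclasp: "sclasp (opp x) n = rclasp x 0 n"
  by (induction n) (simp_all add: sg_def)

lemma sg_Suc: "sg x a (Suc b) = sg x a b @ [opp x]"
  by (simp add: sg_def replicate_append_same)

lemma sg_Suc_left: "sg x (Suc j) c = replicate j x @ x # replicate c (opp x)"
  by (simp add: sg_def)

lemma sg_zero: "sg x a 0 = sg (opp x) 0 a"
  by (simp add: sg_def)

lemma strong_absorb_wid:
  assumes "strong s p" "kills (s @ v) g" "g \<in> Hom u (s @ v)"
  shows "wid [] p v \<circle> g = g"
proof -
  have "starts_down (s @ v) (s @ v) (wid [] (p - id_skein s) v)"
    by (rule starts_down_wid[OF strongD(3)[OF assms(1)]])
  from starts_down_kills[OF this assms(2)] Hom_id_comp[OF assms(3)] show ?thesis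
    by (simp add: wid_diff comp_diff_left)
qed

lemma strong_absorb_strong:
  assumes "strong s p" "strong (s @ v) p'"
  shows "wid [] p v \<circle> p' = p'"
  using strong_absorb_wid[OF assms(1)] strongD[OF assms(2)] by blast

lemma wid_idem: "p \<circle> p = p \<Longrightarrow> wid l p r \<circle> wid l p r = wid l p r"
  by (simp flip: wid_comp)

text \<open>Let \<open>f\<close> be the sweep. Both \<open>e \<circle> f\<close> and
  \<open>f \<circle> p\<close> equal \<open>e \<circle> (f \<circle> p)\<close>, because each one is
  killed by descents on the side where the other clasp is missing. Then \<open>f\<close> cancels on
  the left, since with its reflection it forms a closed path of rungs.\<close>

lemma sweep_conjugation:
  assumes p: "strong (sg x j c) p" and e: "strong (sg (opp x) c j) e"
  shows "p = flip_skein (sweep x j c) \<circle> (e \<circle> sweep x j c)"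
proof -
  let ?s = "sg x j c" and ?t = "sg (opp x) c j" and ?f = "sweep x j c"
  note H = rungs_Hom[OF rungs_sweep[of x j c]] and w = rungs_same_weight[OF rungs_sweep[of x j c]]
  note H' = rungs_Hom[OF rungs_flip[OF rungs_sweep[of x j c]]] and w' = rungs_same_weight[OF rungs_flip[OF rungs_sweep[of x j c]]]
  have "e \<circle> (?f \<circle> p) = ?f \<circle> p"
    by (rule strong_absorb[OF e strong_kills[OF p HOL.refl H w] Hom_comp[OF strongD(1)[OF p] H]])
  moreover have "(e \<circle> ?f) \<circle> p = e \<circle> ?f"
  proof (rule strong_absorb_right[OF p])
    show "kills ?s (flip_skein (e \<circle> ?f))"
      using strong_kills[OF e HOL.refl H' w'] by (simp add: flip_comp strongD(4)[OF e])
    show "e \<circle> ?f \<in> Hom ?s ?t"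
      by (rule Hom_comp[OF H strongD(1)[OF e]])
  qed
  ultimately have "e \<circle> ?f = ?f \<circle> p" by (simp add: comp_skein_assoc)
  moreover have "(flip_skein ?f \<circle> ?f) \<circle> p = p"
    by (rule rungs_id[OF strongD(2)[OF p] HOL.refl rungs_trans[OF rungs_flip[OF rungs_sweep] rungs_sweep] strongD(1)[OF p]])
  ultimately show ?thesis by (simp add: comp_skein_assoc)
qed

text \<open>
  The inner partial trace is computed in the word \<open>sg (opp x) c j\<close>, whose clasp has the
  innermost strand of the original word as its last strand, so that its recursion applies.
\<close>

lemma twisted_trace:
  assumes p: "strong (sg x (Suc j) c) p" and p1: "strong (sg x j (Suc c)) p1"
    and e: "strong (sg (opp x) c j) (rclasp (opp x) c j)"
    and e': "strong (sg (opp x) c (Suc j)) (rclasp (opp x) c (Suc j))"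
  shows "wid (replicate j x) (beta x c) [opp x] \<circle> (wid [] p [opp x, opp x] \<circle> (wid (replicate j x) (alpha x (Suc c)) [] \<circle> p1)) =
    (qint j / qint (Suc j) - qint 2) \<cdot> p1"
proof -
  define o' where "o' = opp x"
  define E where "E = rclasp o' c (Suc j)"
  define e0 where "e0 = rclasp o' c j"
  define R where "R = sweep x j c"
  let ?s1 = "sg x j (Suc c)" and ?t = "sg o' c j" and ?u = "sg x (Suc j) c"
  have E: "strong (sg o' c (Suc j)) E" and e0: "strong ?t e0"
    using e e' by (simp_all only: o'_def E_def e0_def)
  have R: "rungs (sg x j c) ?t R" unfolding R_def o'_def by (rule rungs_sweep)
  have Rs: "sweep x (Suc j) c = wid [] R [x] \<circle> wid (replicate j x) (pass x c) []"
    by (simp add: R_def)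
  have s1: "?s1 = sg x j c @ [o']" by (simp add: sg_Suc o'_def)
  define g where "g = wid [] R [o'] \<circle> p1"
  have Ro: "rungs ?s1 (?t @ [o']) (wid [] R [o'])"
    using rungs_wid[OF R, of "[]" "[o']"] by (simp add: s1)
  have gH: "g \<in> Hom ?s1 (?t @ [o'])"
    unfolding g_def by (rule Hom_comp[OF strongD(1)[OF p1] rungs_Hom[OF Ro]])
  have gk: "kills (?t @ [o']) g"
    unfolding g_def by (rule strong_kills[OF p1 HOL.refl rungs_Hom[OF Ro] rungs_same_weight[OF Ro]])
  have al: "alpha x (Suc 0) \<in> Hom [o'] [x, o', o']"
    using alpha_Hom[of x "Suc 0"] by (simp add: o'_def)

  \<comment> \<open>Modulo terms killed by \<open>p1\<close>, the innermost pass reduces the arc to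
    a single crossing, and \<open>R\<close>, acting on other strands, slides below it.\<close>
  have lower: "wid [] (sweep x (Suc j) c) [o', o'] \<circle> (wid (replicate j x) (alpha x (Suc c)) [] \<circle> p1) =
      wid ?t (alpha x (Suc 0)) [] \<circle> g"
  proof -
    have "starts_down ?s1 (replicate j x @ replicate c o' @ [x, o', o'])
        (wid (replicate j x) (wid [] (pass x c) [o', o'] \<circle> alpha x (Suc c) - wid (replicate c o') (alpha x (Suc 0)) []) [])"
      using starts_down_widen[OF pass_alpha_long[where x = x and c = c], of "replicate j x" "[]"] by (simp add: sg_def o'_def)
    from starts_down_kills[OF this strongD(2)[OF p1]]
    have *: "wid (replicate j x) (pass x c) [o', o'] \<circle> (wid (replicate j x) (alpha x (Suc c)) [] \<circle> p1) =
        wid (replicate j x @ replicate c o') (alpha x (Suc 0)) [] \<circle> p1"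
      by (simp add: wid_diff comp_diff_left wid_comp comp_skein_assoc del: alpha.simps)
    have ex: "wid [] R [x, o', o'] \<circle> wid (sg x j c) (alpha x (Suc 0)) [] = wid ?t (alpha x (Suc 0)) [] \<circle> wid [] R [o']"
      by (rule wid_exchangeI[OF rungs_Hom[OF R] al, of _ _ "[]"]) auto
    show ?thesis
      unfolding Rs g_def wid_comp wid_wid comp_skein_assoc
      using * comp_eq_extend[OF ex, of p1] by (simp add: sg_def o'_def del: alpha.simps)
  qed

  have upper: "p1 \<circle> (wid (replicate j x) (beta x c) [o'] \<circle> (wid [] (flip_skein (sweep x (Suc j) c)) [o', o'] \<circle> wid [] E [o', o'])) =
      flip_skein g \<circle> (wid ?t (cap x) [o'] \<circle> wid [] E [o', o'])"
  proof -
    \<comment> \<open>The reflected composite is evaluated and the result flipped. For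
      \<open>c = 0\<close> nothing is crossed and no correction term arises.\<close>
    define Y where "Y = wid [] (sweep x (Suc j) c) [o', o'] \<circle> (wid (replicate j x) (alpha x c) [o'] \<circle> p1)"
    have cx: "cup x \<in> Hom [] [x, o']" by (simp add: o'_def)
    have ex: "wid [] R [x, o', o'] \<circle> wid (sg x j c) (cup x) [o'] = wid ?t (cup x) [o'] \<circle> wid [] R [o']"
      by (rule wid_exchangeI[OF rungs_Hom[OF R] cx, of _ _ "[]"]) auto
    have FE: "flip_skein E = E" by (rule strongD(4)[OF E])
    have "wid [] E [o', o'] \<circle> Y = wid [] E [o', o'] \<circle> (wid ?t (cup x) [o'] \<circle> g)"
    proof (cases c)
      case 0
      have "wid (replicate j x) (pass x c) [o', o'] = id_skein (replicate j x @ [x, o', o'])"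
        by (simp add: 0)
      moreover have "id_skein (replicate j x @ [x, o', o']) \<circle> (wid (replicate j x) (cup x) [o'] \<circle> p1) = wid (replicate j x) (cup x) [o'] \<circle> p1"
        by (rule Hom_id_comp[OF Hom_comp[OF strongD(1)[OF p1] Hom_widI[OF cx]]]) (auto simp: 0 sg_def o'_def)
      ultimately have "Y = wid [] R [x, o', o'] \<circle> (wid (sg x j c) (cup x) [o'] \<circle> p1)"
        unfolding Y_def Rs wid_comp wid_wid comp_skein_assoc by (simp add: 0 sg_def)
      then show ?thesis
        unfolding g_def using comp_eq_extend[OF ex, of p1] by simp
    next
      case (Suc d)
      \<comment> \<open>The second term of \<open>pass_alpha_short\<close>. Its cup starts from a
        word of lower weight, so composing with the clasp \<open>E\<close> gives 0.\<close>
      let ?V = "wid (replicate j x @ replicate d o') (cup o') [o', o']"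
      have "starts_down ?s1 (replicate j x @ replicate c o' @ [x, o', o'])
          (wid (replicate j x) (wid [] (pass x c) [o'] \<circle> alpha x c - wid (replicate c o') (cup x) [] - wid (replicate d o') (cup o') [o']) [o'])"
        using starts_down_widen[OF pass_alpha_short[where x = x and c = d], of "replicate j x" "[o']"]
        by (simp add: sg_def o'_def Suc replicate_append_same del: alpha.simps pass.simps)
      from starts_down_kills[OF this strongD(2)[OF p1]]
      have *: "wid (replicate j x) (pass x c) [o', o'] \<circle> (wid (replicate j x) (alpha x c) [o'] \<circle> p1) =
          wid (sg x j c) (cup x) [o'] \<circle> p1 + ?V \<circle> p1"
        by (simp add: wid_diff wid_add comp_add_left comp_diff_left wid_comp comp_skein_assoc sg_def o'_def algebra_simps del: alpha.simps)
      have "Y = wid [] R [x, o', o'] \<circle> (wid (sg x j c) (cup x) [o'] \<circle> p1) + wid [] R [x, o', o'] \<circle> (?V \<circle> p1)"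
        unfolding Y_def Rs wid_comp wid_wid comp_skein_assoc using * by (simp add: comp_add_right)
      moreover have "wid [] E [o', o'] \<circle> (wid [] R [x, o', o'] \<circle> ?V) = 0"
      proof -
        have "wid [] R [x] \<circle> wid (replicate j x @ replicate d o') (cup o') [] \<in> Hom (replicate j x @ replicate d o') (sg o' c (Suc j))"
          by (rule Hom_comp[OF Hom_widI[OF _ _ HOL.refl] Hom_widI[OF rungs_Hom[OF R]]])
            (use piece_Hom(1)[of o'] in \<open>auto simp: sg_def o'_def Suc replicate_append_same\<close>)
        moreover have "below (replicate j x @ replicate d o') (sg o' c (Suc j))"
          by (rule belowI[of 1 1 _ x]) (auto simp: sg_def o'_def Suc)
        ultimately have "E \<circle> (wid [] R [x] \<circle> wid (replicate j x @ replicate d o') (cup o') []) = 0"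
          using strong_below'[OF E HOL.refl] by blast
        from arg_cong[OF this, of "\<lambda>f. wid [] f [o', o']"] show ?thesis
          by (simp add: wid_comp)
      qed
      ultimately have "wid [] E [o', o'] \<circle> Y = wid [] E [o', o'] \<circle> (wid [] R [x, o', o'] \<circle> (wid (sg x j c) (cup x) [o'] \<circle> p1))"
        by (simp add: comp_add_right flip: comp_skein_assoc)
      then show ?thesis
        unfolding g_def comp_eq_extend[OF ex, of p1] .
    qed
    from arg_cong[OF this, of flip_skein] show ?thesis
      unfolding Y_def by (simp add: flip_comp flip_wid flip_alpha flip_piece_skein FE strongD(4)[OF p1] comp_skein_assoc)
  qed

  define J where "J = wid ?t (cap x) [o'] \<circle> (wid [] E [o', o'] \<circle> (wid ?t (alpha x (Suc 0)) [] \<circle> g))"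
  have eg: "wid [] e0 [o'] \<circle> g = g"
    by (rule strong_absorb_wid[OF e0 gk gH])
  have e0H: "e0 \<in> Hom ?t ?t" by (rule strongD(1)[OF e0])
  have capex: "wid ?t (cap x) [o'] \<circle> wid [] e0 [x, o', o'] = wid [] e0 [o'] \<circle> wid ?t (cap x) [o']"
    using wid_exchange[OF e0H piece_Hom(2)[of x], of "[]" "[]" "[o']"] by (simp add: o'_def)
  have alex: "wid [] e0 [x, o', o'] \<circle> wid ?t (alpha x (Suc 0)) [] = wid ?t (alpha x (Suc 0)) [] \<circle> wid [] e0 [o']"
    by (rule wid_exchangeI[OF e0H al, of _ _ "[]"]) auto
  have alg: "wid [] e0 [x, o', o'] \<circle> (wid ?t (alpha x (Suc 0)) [] \<circle> g) = wid ?t (alpha x (Suc 0)) [] \<circle> g"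
    using comp_eq_extend[OF alex, of g] eg by simp
  \<comment> \<open>Plain term of the recursion for \<open>E\<close>: the cap closes the remaining
    crossing to a bigon.\<close>
  have J1: "wid ?t (cap x) [o'] \<circle> (wid ?t (alpha x (Suc 0)) [] \<circle> g) = (- qint 2) \<cdot> g"
  proof -
    have "wid ?t (wid [] (cap x) [o'] \<circle> alpha x (Suc 0)) [] \<circle> g = (- qint 2) \<cdot> (id_skein (?t @ [o']) \<circle> g)"
      by (simp add: o'_def cap_alpha_one del: alpha.simps skein.scale_minus_left)
    then show ?thesis
      by (simp add: Hom_id_comp[OF gH] wid_comp comp_skein_assoc del: alpha.simps skein.scale_minus_left)
  qed
  \<comment> \<open>H term: a square face appears. One smoothing is the identity, the other one has
    a cap directly above \<open>g\<close> and vanishes.\<close>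
  have J2: "wid ?t (cap x) [o'] \<circle> (wid (sg o' c (j - 1)) (Hweb x) [o', o'] \<circle> (wid ?t (alpha x (Suc 0)) [] \<circle> g)) = g" if nz: "j \<noteq> 0"
  proof -
    obtain i where i: "j = Suc i" using nz by (cases j) auto
    have t: "?t = sg o' c i @ [x]" by (simp add: i sg_Suc o'_def)
    have ji: "j - Suc 0 = i" by (simp add: i)
    let ?r = "sg o' c i"
    have "wid ?t (cap x) [o'] \<circle> (wid (sg o' c (j - 1)) (Hweb x) [o', o'] \<circle> (wid ?t (alpha x (Suc 0)) [] \<circle> g)) =
      wid ?r (wid [x] (cap x) [o'] \<circle> (wid [] (Hweb x) [o', o'] \<circle> wid [x] (alpha x (Suc 0)) [])) [] \<circle> g"
      by (simp add: t ji wid_comp comp_skein_assoc del: alpha.simps)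
    also have "\<dots> = id_skein (?t @ [o']) \<circle> g + wid ?r (cup x) [] \<circle> (wid ?r (cap x) [] \<circle> g)"
      unfolding o'_def cap_Hweb_alpha_one wid_add wid_comp comp_add_left comp_skein_assoc
      by (simp add: t[unfolded o'_def])
    also have "wid ?r (cap x) [] \<circle> g = 0"
      by (rule killsD(1)[OF gk]) (use t in \<open>simp add: o'_def\<close>)
    finally show ?thesis by (simp add: Hom_id_comp[OF gH])
  qed
  \<comment> \<open>X term: the arc \<open>beta\<close> ends in a cap next to \<open>alpha\<close>,
    which leaves a merge below; this merge leads to a lower weight and vanishes on
    \<open>p1\<close>.\<close>
  have J3: "wid (replicate (c - 1) o') (beta o' j) [o', o'] \<circle> (wid ?t (alpha x (Suc 0)) [] \<circle> g) = 0" if nz: "c \<noteq> 0"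
  proof -
    obtain d where d: "c = Suc d" using nz by (cases c) auto
    let ?w = "replicate d o'" and ?x = "replicate j x"
    have t: "?t = ?w @ o' # ?x" by (simp add: d sg_Suc_left o'_def)
    have pass: "rungs (o' # ?x) (?x @ [o']) (pass o' j)"
      using rungs_pass[of o' j] by (simp add: o'_def)
    have ex: "wid ?w (pass o' j) [x, o', o'] \<circle> wid ?t (alpha x (Suc 0)) [] =
        wid (?w @ ?x @ [o']) (alpha x (Suc 0)) [] \<circle> wid ?w (pass o' j) [o']"
      by (rule wid_exchangeI[OF rungs_Hom[OF pass] al, of _ _ "[]"]) (auto simp: t)
    have "wid [] (cap o') [o', o'] \<circle> wid [o'] (alpha x (Suc 0)) [] = wid [] (mg x) [o'] \<circle> wid [x] (cup x) [] \<circle> mg o'"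
      using cap_alpha[of x 0] by (simp add: o'_def del: alpha.simps(2))
    from wid_eq[OF this, of "?w @ ?x" "[]"]
    have c: "wid (?w @ ?x) (cap o') [o', o'] \<circle> wid (?w @ ?x @ [o']) (alpha x (Suc 0)) [] =
        wid (?w @ ?x) (wid [] (mg x) [o'] \<circle> wid [x] (cup x) []) [] \<circle> wid (?w @ ?x) (mg o') []"
      by (simp add: wid_comp comp_skein_assoc del: alpha.simps)
    have "wid (replicate (c - 1) o') (beta o' j) [o', o'] = wid (?w @ ?x) (cap o') [o', o'] \<circle> wid ?w (pass o' j) [x, o', o']"
      by (simp add: beta_pass d o'_def wid_comp)
    then have "wid (replicate (c - 1) o') (beta o' j) [o', o'] \<circle> (wid ?t (alpha x (Suc 0)) [] \<circle> g) =
      wid (?w @ ?x) (wid [] (mg x) [o'] \<circle> wid [x] (cup x) []) [] \<circle> ((wid (?w @ ?x) (mg o') [] \<circle> (wid ?w (pass o' j) [o'] \<circle> wid [] R [o'])) \<circle> p1)"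
      using comp_eq_extend[OF ex, of g] comp_eq_extend[OF c, of "wid ?w (pass o' j) [o'] \<circle> g"]
      by (simp add: g_def comp_skein_assoc del: alpha.simps)
    moreover have "(wid (?w @ ?x) (mg o') [] \<circle> (wid ?w (pass o' j) [o'] \<circle> wid [] R [o'])) \<circle> p1 = 0"
    proof -
      have r: "rungs ?s1 (?w @ ?x @ [o', o']) (wid ?w (pass o' j) [o'] \<circle> wid [] R [o'])"
        using rungs_transI[OF Ro rungs_wid[OF pass, of ?w "[o']"]] by (simp add: t)
      have "below (?w @ ?x @ [opp o']) ?s1"
        using below_same_weight[OF mg_below[of "?w @ ?x" o' "[]"]] rungs_same_weight[OF r] by simp
      moreover have "wid (?w @ ?x) (mg o') [] \<circle> (wid ?w (pass o' j) [o'] \<circle> wid [] R [o']) \<in> Hom ?s1 (?w @ ?x @ [opp o'])"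
        by (rule Hom_comp[OF rungs_Hom[OF r] Hom_widI[OF piece_Hom(3)]]) auto
      ultimately show ?thesis
        using strong_below[OF p1 HOL.refl] by blast
    qed
    ultimately show ?thesis by simp
  qed
  have "E = wid [] e0 [x] + (qint j / qint (Suc j)) \<cdot> (wid [] e0 [x] \<circle> (wid (sg o' c (j - 1)) (Hweb x) [] \<circle> wid [] e0 [x]))
      - (qint c / (qint (Suc j) * qint (c + j + 2))) \<cdot> (wid [] e0 [x] \<circle> (wid (replicate (c - 1) o') (alpha o' j \<circle> beta o' j) [] \<circle> wid [] e0 [x]))"
    by (simp add: E_def e0_def o'_def)
  then have "J = wid ?t (cap x) [o'] \<circle> (wid [] e0 [x, o', o'] \<circle> (wid ?t (alpha x (Suc 0)) [] \<circle> g))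
      + (qint j / qint (Suc j)) \<cdot> (wid ?t (cap x) [o'] \<circle> (wid [] e0 [x, o', o'] \<circle> (wid (sg o' c (j - 1)) (Hweb x) [o', o'] \<circle> (wid [] e0 [x, o', o'] \<circle> (wid ?t (alpha x (Suc 0)) [] \<circle> g)))))
      - (qint c / (qint (Suc j) * qint (c + j + 2))) \<cdot> (wid ?t (cap x) [o'] \<circle> (wid [] e0 [x, o', o'] \<circle> (wid (replicate (c - 1) o') (alpha o' j) [o', o'] \<circle> (wid (replicate (c - 1) o') (beta o' j) [o', o'] \<circle> (wid [] e0 [x, o', o'] \<circle> (wid ?t (alpha x (Suc 0)) [] \<circle> g))))))"
    unfolding J_def by (simp add: wid_add wid_diff wid_comp comp_add_left comp_diff_left comp_add_right comp_diff_right comp_skein_assoc del: alpha.simps)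
  also have "\<dots> = (- qint 2) \<cdot> g + (qint j / qint (Suc j)) \<cdot> g"
  proof -
    have a: "wid ?t (cap x) [o'] \<circle> (wid [] e0 [x, o', o'] \<circle> z) = wid [] e0 [o'] \<circle> (wid ?t (cap x) [o'] \<circle> z)" for z
      by (rule comp_eq_extend[OF capex])
    have 2: "(qint j / qint (Suc j)) \<cdot> (wid ?t (cap x) [o'] \<circle> (wid [] e0 [x, o', o'] \<circle> (wid (sg o' c (j - 1)) (Hweb x) [o', o'] \<circle> (wid [] e0 [x, o', o'] \<circle> (wid ?t (alpha x (Suc 0)) [] \<circle> g)))))
       = (qint j / qint (Suc j)) \<cdot> g"
    proof (cases "j = 0")
      case False
      show ?thesis unfolding alg a J2[OF False] eg ..
    qed simp
    have 3: "(qint c / (qint (Suc j) * qint (c + j + 2))) \<cdot> (wid ?t (cap x) [o'] \<circle> (wid [] e0 [x, o', o'] \<circle> (wid (replicate (c - 1) o') (alpha o' j) [o', o'] \<circle> (wid (replicate (c - 1) o') (beta o' j) [o', o'] \<circle> (wid [] e0 [x, o', o'] \<circle> (wid ?t (alpha x (Suc 0)) [] \<circle> g)))))) = 0"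
    proof (cases "c = 0")
      case False
      show ?thesis unfolding alg J3[OF False] by simp
    qed simp
    show ?thesis
      unfolding 2 3 unfolding alg J1 by simp
  qed
  finally have J: "J = (qint j / qint (Suc j) - qint 2) \<cdot> g"
    by (simp add: skein.scale_left_diff_distrib)

  define F where "F = wid (replicate j x) (beta x c) [o'] \<circle> (wid [] p [o', o'] \<circle> wid (replicate j x) (alpha x (Suc c)) [])"
  have FH: "F \<in> Hom ?s1 ?s1"
    unfolding F_def
    by (rule Hom_comp[OF Hom_comp[OF Hom_widI[OF alpha_Hom] Hom_widI[OF strongD(1)[OF p]]] Hom_widI[OF beta_Hom]])
      (auto simp: sg_def o'_def replicate_append_same)
  \<comment> \<open>Being a multiple of \<open>p1\<close>, the trace does not change when
    \<open>p1\<close> is put on top; only then can both halves be reduced.\<close>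
  obtain k where k: "F \<circle> p1 = k \<cdot> p1"
    using kills_End[OF strongD(2)[OF p1] HOL.refl FH strongD(1)[OF p1]] by blast
  then have "F \<circle> p1 = p1 \<circle> (F \<circle> p1)"
    using strong_idem[OF p1] by simp
  also have "\<dots> = (p1 \<circle> (wid (replicate j x) (beta x c) [o'] \<circle> (wid [] (flip_skein (sweep x (Suc j) c)) [o', o'] \<circle> wid [] E [o', o']))) \<circle>
      (wid [] (sweep x (Suc j) c) [o', o'] \<circle> (wid (replicate j x) (alpha x (Suc c)) [] \<circle> p1))"
    unfolding F_def sweep_conjugation[OF p e'] E_def o'_def
    by (simp add: wid_comp comp_skein_assoc del: alpha.simps sweep.simps rclasp.simps)
  also have "\<dots> = flip_skein g \<circle> J"
    unfolding upper lower J_def by (simp add: comp_skein_assoc del: alpha.simps)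
  also have "\<dots> = (qint j / qint (Suc j) - qint 2) \<cdot> (flip_skein g \<circle> g)"
    by (simp add: J)
  also have "flip_skein g \<circle> g = p1 \<circle> ((flip_skein (wid [] R [o']) \<circle> wid [] R [o']) \<circle> p1)"
    by (simp add: g_def flip_comp strongD(4)[OF p1] comp_skein_assoc)
  also have "(flip_skein (wid [] R [o']) \<circle> wid [] R [o']) \<circle> p1 = p1"
    by (rule rungs_id[OF strongD(2)[OF p1] HOL.refl rungs_trans[OF rungs_flip[OF Ro] Ro] strongD(1)[OF p1]])
  finally show ?thesis
    using strong_idem[OF p1] by (simp add: F_def o'_def comp_skein_assoc del: alpha.simps)
qed

subsection \<open>The last merge\<close>

lemma count_list_replicate [simp]: "count_list (replicate n y) z = (if y = z then n else 0)"
  by (induction n) auto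

text \<open>The computation stripped of words. Pushing the merge \<open>M\<close> through one copy
  of \<open>Q\<close> expresses everything by \<open>M \<circle> Q\<close> and one further element
  \<open>Y\<close>; the two numerical assumptions are the vanishing of their coefficients. Several
  assumptions are guarded by non-zero coefficients, because for \<open>c = 0\<close> or
  \<open>a = 0\<close> the webs in question do not fit the words.\<close>

lemma last_merge_algebra:
  fixes t c1 c1' c2 c2' k :: K
  assumes Q: "Q = P2 + c1' \<cdot> (P2 \<circle> (H' \<circle> P2)) - c2' \<cdot> (P2 \<circle> (A0 \<circle> (B0 \<circle> P2)))"
    and MP: "M \<circle> P2 = Px \<circle> M" and PS: "P2 \<circle> Sp = Sp \<circle> Px" and PxPx: "Px \<circle> Px = Px"
    and PQ: "P2 \<circle> Q = Q" and IM: "I \<circle> M = M" and H: "Sp \<circle> M = H" and PH: "P2 \<circle> H = H \<circle> P2"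
    and MH: "M \<circle> H = (- t) \<cdot> M"
    and H'1: "c1' \<noteq> 0 \<Longrightarrow> M \<circle> (H' \<circle> Sp) = I + U \<circle> V" "c1' \<noteq> 0 \<Longrightarrow> V \<circle> (M \<circle> Q) = 0"
    and H'2: "c1' \<noteq> 0 \<Longrightarrow> M \<circle> (H' \<circle> H) = M + U \<circle> (V \<circle> M)"
      "c1' \<noteq> 0 \<Longrightarrow> c2 \<noteq> 0 \<Longrightarrow> V \<circle> (Px \<circle> (M \<circle> (A0 \<circle> (B \<circle> Q)))) = 0"
    and B: "c2' \<noteq> 0 \<Longrightarrow> B0 \<circle> H = B" and A: "c2 \<noteq> 0 \<Longrightarrow> A = H \<circle> A0"
    and k: "c2 \<noteq> 0 \<Longrightarrow> B0 \<circle> (P2 \<circle> (A \<circle> (B \<circle> Q))) = k \<cdot> (B \<circle> Q)"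
    and num: "1 + c1 * (c1' - t) = 0" "c1 * c2' + c2 * (c1' - t - c2' * k) = 0"
  shows "M \<circle> (Q + c1 \<cdot> (Q \<circle> (H \<circle> Q)) - c2 \<cdot> (Q \<circle> (A \<circle> (B \<circle> Q)))) = 0"
proof -
  define Y where "Y = Px \<circle> (M \<circle> (A0 \<circle> (B \<circle> Q)))"
  have PMQ: "Px \<circle> (M \<circle> Q) = M \<circle> Q"
    using comp_eq_extend[OF MP, of Q] PQ by simp
  have MQz: "M \<circle> (Q \<circle> z) = Px \<circle> (M \<circle> z) + c1' \<cdot> (Px \<circle> (M \<circle> (H' \<circle> (P2 \<circle> z))))
      - c2' \<cdot> (Px \<circle> (M \<circle> (A0 \<circle> (B0 \<circle> (P2 \<circle> z)))))" for z
    using comp_eq_extend[OF MP]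
    by (subst Q) (simp add: comp_add_left comp_add_right comp_diff_left comp_diff_right comp_skein_assoc)
  have 1: "M \<circle> (Q \<circle> (H \<circle> Q)) = (c1' - t) \<cdot> (M \<circle> Q) - c2' \<cdot> Y"
  proof -
    have z: "P2 \<circle> (H \<circle> Q) = H \<circle> Q"
      using comp_eq_extend[OF PH, of Q] PQ by simp
    have a: "Px \<circle> (M \<circle> (H \<circle> Q)) = (- t) \<cdot> (M \<circle> Q)"
      using comp_eq_absorb[OF MH, of Q] PMQ by (simp del: skein.scale_minus_left)
    have b: "c1' \<cdot> (Px \<circle> (M \<circle> (H' \<circle> (H \<circle> Q)))) = c1' \<cdot> (M \<circle> Q)"
    proof (cases "c1' = 0")
      case False
      have "M \<circle> (H' \<circle> (H \<circle> Q)) = (M \<circle> (H' \<circle> Sp)) \<circle> (M \<circle> Q)"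
        by (simp add: H[symmetric] comp_skein_assoc)
      also have "\<dots> = M \<circle> Q"
        using comp_eq_absorb[OF IM, of Q] by (simp add: H'1[OF False] comp_add_left comp_skein_assoc)
      finally show ?thesis by (simp add: PMQ)
    qed simp
    have c: "c2' \<cdot> (Px \<circle> (M \<circle> (A0 \<circle> (B0 \<circle> (H \<circle> Q))))) = c2' \<cdot> Y"
    proof (cases "c2' = 0")
      case False
      show ?thesis unfolding Y_def comp_eq_absorb[OF B[OF False]] ..
    qed simp
    show ?thesis
      unfolding MQz z a b c by (simp add: skein.scale_left_diff_distrib)
  qed
  have 2: "c2 \<cdot> (M \<circle> (Q \<circle> (A \<circle> (B \<circle> Q)))) = (c2 * (c1' - t - c2' * k)) \<cdot> Y"
  proof (cases "c2 = 0")
    case False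
    note A = A[OF False]
    have a: "Px \<circle> (M \<circle> (A \<circle> (B \<circle> Q))) = (- t) \<cdot> Y"
      using comp_eq_absorb[OF MH] by (simp add: A Y_def comp_skein_assoc del: skein.scale_minus_left)
    have b: "c1' \<cdot> (Px \<circle> (M \<circle> (H' \<circle> (P2 \<circle> (A \<circle> (B \<circle> Q)))))) = c1' \<cdot> Y"
    proof (cases "c1' = 0")
      case c1': False
      have "M \<circle> (H' \<circle> (P2 \<circle> (A \<circle> (B \<circle> Q)))) = (M \<circle> (H' \<circle> H)) \<circle> (P2 \<circle> (A0 \<circle> (B \<circle> Q)))"
        using comp_eq_extend[OF PH] by (simp add: A comp_skein_assoc)
      also have "\<dots> = Y + U \<circle> (V \<circle> Y)"
        using comp_eq_extend[OF MP] by (simp add: H'2(1)[OF c1'] comp_add_left comp_skein_assoc Y_def)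
      also have "V \<circle> Y = 0"
        unfolding Y_def by (rule H'2(2)[OF c1' False])
      finally show ?thesis
        using comp_eq_absorb[OF PxPx] by (simp add: Y_def)
    qed simp
    have c: "Px \<circle> (M \<circle> (A0 \<circle> (B0 \<circle> (P2 \<circle> (A \<circle> (B \<circle> Q)))))) = k \<cdot> Y"
      by (simp add: k[OF False] Y_def)
    show ?thesis
      unfolding MQz a b c by (simp add: skein.scale_left_diff_distrib skein.scale_right_diff_distrib skein.scale_right_distrib algebra_simps)
  qed simp
  have "M \<circle> (Q + c1 \<cdot> (Q \<circle> (H \<circle> Q)) - c2 \<cdot> (Q \<circle> (A \<circle> (B \<circle> Q)))) =
      (M \<circle> Q + c1 \<cdot> ((c1' - t) \<cdot> (M \<circle> Q) - c2' \<cdot> Y)) - (c2 * (c1' - t - c2' * k)) \<cdot> Y"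
    by (simp add: comp_add_right comp_diff_right 1 2)
  also have "\<dots> = (1 + c1 * (c1' - t)) \<cdot> (M \<circle> Q) - (c1 * c2' + c2 * (c1' - t - c2' * k)) \<cdot> Y"
    by (simp only: skein.scale_left_distrib skein.scale_right_diff_distrib skein.scale_scale skein.scale_one)
      (simp add: algebra_simps)
  finally show ?thesis
    unfolding num by simp
qed

text \<open>\<open>k\<close> is the factor from \<open>twisted_trace\<close>, and
  \<open>[a] k = -[a+1]\<close>. With \<open>qint_exchange\<close> the bracket in the second
  equation becomes \<open>-[a+c+3]/[a+c+2]\<close>, which balances the first summand.\<close>

lemma last_merge_numbers:
  fixes a c :: nat
  defines "k \<equiv> qint (a - 1) / qint a - qint 2"
  shows "1 + qint (Suc c) / qint (Suc (Suc c)) * (qint c / qint (Suc c) - qint 2) = 0"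
    and "qint (Suc c) / qint (Suc (Suc c)) * (qint a / (qint (Suc c) * qint (a + c + 2))) +
      qint a / (qint (Suc (Suc c)) * qint (a + Suc c + 2)) *
        (qint c / qint (Suc c) - qint 2 - qint a / (qint (Suc c) * qint (a + c + 2)) * k) = 0"
proof -
  have c: "qint c = qint 2 * qint (Suc c) - qint (Suc (Suc c))"
    using qint_two_times[of c] by (simp add: numeral_2_eq_2)
  have "qint (Suc c) * (qint c / qint (Suc c) - qint 2) = qint c - qint (Suc c) * qint 2"
    by (simp add: right_diff_distrib)
  also have "\<dots> = - qint (Suc (Suc c))"
    by (simp add: c)
  finally show "1 + qint (Suc c) / qint (Suc (Suc c)) * (qint c / qint (Suc c) - qint 2) = 0"
    by (simp add: times_divide_eq_left)
  show "qint (Suc c) / qint (Suc (Suc c)) * (qint a / (qint (Suc c) * qint (a + c + 2))) +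
      qint a / (qint (Suc (Suc c)) * qint (a + Suc c + 2)) *
        (qint c / qint (Suc c) - qint 2 - qint a / (qint (Suc c) * qint (a + c + 2)) * k) = 0"
  proof (cases a)
    case (Suc j)
    define A B C D E where "A = qint a" and "B = qint (Suc c)" and "C = qint (Suc (Suc c))"
      and "D = qint (a + c + 2)" and "E = qint (a + Suc c + 2)"
    have nz: "A \<noteq> 0" "B \<noteq> 0" "C \<noteq> 0" "D \<noteq> 0" "E \<noteq> 0"
      by (simp_all add: A_def B_def C_def D_def E_def Suc)
    have A2: "qint 2 * A = qint (Suc a) + qint j"
      using qint_two_times[of j] by (simp add: A_def Suc numeral_2_eq_2)
    have k: "A * k = - qint (Suc a)"
    proof -
      have "k = qint j / A - qint 2" by (simp add: k_def A_def Suc)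
      then have "A * k = qint j - qint 2 * A" using nz(1) by (simp add: right_diff_distrib)
      then show ?thesis using A2 by simp
    qed
    have ex: "C * D = B * E + qint (Suc a)"
      using qint_exchange[of "Suc c" a] by (simp add: B_def C_def D_def E_def)
    have "qint c / B - qint 2 - A / (B * D) * k = - (C / B) + qint (Suc a) / (B * D)"
      using nz k by (simp add: c B_def[symmetric] C_def[symmetric] diff_divide_distrib)
    also have "\<dots> = (qint (Suc a) - C * D) / (B * D)"
      using nz by (simp add: field_simps)
    also have "\<dots> = - (E / D)"
      using nz by (simp add: ex)
    finally have e: "qint c / B - qint 2 - A / (B * D) * k = - (E / D)" .
    have "B / C * (A / (B * D)) + A / (C * E) * (- (E / D)) = 0"
      using nz by (simp add: field_simps)
    then show ?thesis
      unfolding e[symmetric] by (simp only: A_def B_def C_def D_def E_def)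
  qed simp
qed

text \<open>The assumed clasps all belong to words shorter than \<open>sg x a (Suc (Suc c))\<close>.
  Those of sign \<open>opp x\<close> are there for the evaluation of the trace.\<close>

lemma last_merge:
  assumes p2: "strong (sg x a c) (rclasp x a c)"
    and p': "strong (sg x a (Suc c)) (rclasp x a (Suc c))"
    and p1: "\<And>j. a = Suc j \<Longrightarrow> strong (sg x j (Suc c)) (rclasp x j (Suc c))"
    and e: "\<And>j. a = Suc j \<Longrightarrow> strong (sg (opp x) c j) (rclasp (opp x) c j)"
    and e': "\<And>j. a = Suc j \<Longrightarrow> strong (sg (opp x) c (Suc j)) (rclasp (opp x) c (Suc j))"
  shows "wid (sg x a c) (mg (opp x)) [] \<circle> rclasp x a (Suc (Suc c)) = 0"
proof -
  let ?u = "sg x a c" and ?s = "sg x a (Suc c)" and ?o = "opp x"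
  define p where "p = rclasp x a c"
  define Q where "Q = wid [] (rclasp x a (Suc c)) [?o]"
  define P2 where "P2 = wid [] p [?o, ?o]"
  define Px where "Px = wid [] p [x]"
  define M where "M = wid ?u (mg ?o) []"
  define Sp where "Sp = wid ?u (sp x) []"
  define H where "H = wid ?u (Hweb ?o) []"
  define H' where "H' = wid (sg x a (c - 1)) (Hweb ?o) [?o]"
  define U where "U = wid (sg x a (c - 1)) (cup ?o) []"
  define V where "V = wid (sg x a (c - 1)) (cap ?o) []"
  define A0 where "A0 = wid (replicate (a - 1) x) (alpha x c) [?o]"
  define B0 where "B0 = wid (replicate (a - 1) x) (beta x c) [?o]"
  define A where "A = wid (replicate (a - 1) x) (alpha x (Suc c)) []"
  define B where "B = wid (replicate (a - 1) x) (beta x (Suc c)) []"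
  have s: "?s = ?u @ [?o]" by (simp add: sg_Suc)
  have pH: "p \<in> Hom ?u ?u" unfolding p_def by (rule strongD(1)[OF p2])
  have QH: "Q \<in> Hom (?s @ [?o]) (?s @ [?o])"
    unfolding Q_def using Hom_wid[OF strongD(1)[OF p'], of "[]" "[?o]"] by simp
  have MH: "M \<in> Hom (?s @ [?o]) (?u @ [x])"
    unfolding M_def by (rule Hom_widI[OF cap_opp_Hom(3)]) (auto simp: s)
  have x: "?u = replicate (a - 1) x @ x # replicate c ?o" if "a \<noteq> 0"
    using that by (cases a) (auto simp: sg_Suc_left)
  have cx: "sg x a (c - 1) @ [?o] = ?u" if "c \<noteq> 0"
    using that by (cases c) (auto simp: sg_Suc)
  have VH: "V \<in> Hom (?u @ [x]) (sg x a (c - 1))" if "c \<noteq> 0"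
    unfolding V_def by (rule Hom_widI[OF cap_opp_Hom(1)]) (use cx[OF that] in \<open>auto simp flip: append_assoc\<close>)
  have PQ: "P2 \<circle> Q = Q"
    using arg_cong[OF strong_absorb_strong[OF p2 p'[unfolded s]], of "\<lambda>f. wid [] f [?o]"]
    by (simp add: P2_def Q_def p_def wid_comp del: rclasp.simps)
  \<comment> \<open>Every cap and merge above \<open>B \<circle> Q\<close> gives 0, as bending the
    last strand shows, so a shorter clasp can be inserted on top. This brings the trace and later a
    weight comparison into play.\<close>
  have BQ: "wid [] (rclasp x j (Suc c)) [] \<circle> (B \<circle> Q) = B \<circle> Q" and BQH: "B \<circle> Q \<in> Hom (?s @ [?o]) (sg x j (Suc c))"
    if j: "a = Suc j" for j
  proof -
    have BH: "B \<in> Hom (?s @ [?o]) (sg x j (Suc c))"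
      unfolding B_def by (rule Hom_widI[OF beta_Hom]) (auto simp: j sg_def replicate_append_same)
    then show h: "B \<circle> Q \<in> Hom (?s @ [?o]) (sg x j (Suc c))"
      by (rule Hom_comp[OF QH])
    have "same_weight (sg x j (Suc c) @ [opp ?o]) ?s"
      by (rule same_weightI[of _ x]) (auto simp: sg_def j)
    from strong_kills_bend[OF p' HOL.refl BH this]
    have "kills (sg x j (Suc c)) (B \<circle> Q)" by (simp add: Q_def)
    from strong_absorb[OF p1[OF j] this h] show "wid [] (rclasp x j (Suc c)) [] \<circle> (B \<circle> Q) = B \<circle> Q" by simp
  qed
  have "M \<circle> (Q + (qint (Suc c) / qint (Suc (Suc c))) \<cdot> (Q \<circle> (H \<circle> Q))
      - (qint a / (qint (Suc (Suc c)) * qint (a + Suc c + 2))) \<cdot> (Q \<circle> (A \<circle> (B \<circle> Q)))) = 0"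
  proof (rule last_merge_algebra[where t = "qint 2" and I = "id_skein (?u @ [x])" and Sp = Sp and Px = Px])
    show "Q = P2 + (qint c / qint (Suc c)) \<cdot> (P2 \<circle> (H' \<circle> P2)) - (qint a / (qint (Suc c) * qint (a + c + 2))) \<cdot> (P2 \<circle> (A0 \<circle> (B0 \<circle> P2)))"
      by (simp add: Q_def P2_def H'_def A0_def B0_def p_def wid_add wid_diff wid_comp comp_skein_assoc)
    show "M \<circle> P2 = Px \<circle> M"
      unfolding M_def P2_def Px_def using wid_exchange[OF pH cap_opp_Hom(3)[of x], of "[]" "[]" "[]"] by simp
    show "P2 \<circle> Sp = Sp \<circle> Px"
      unfolding Sp_def P2_def Px_def using wid_exchange[OF pH piece_Hom(4)[of x], of "[]" "[]" "[]"] by simp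
    show "Px \<circle> Px = Px"
      unfolding Px_def p_def by (rule wid_idem[OF strong_idem[OF p2]])
    show "P2 \<circle> Q = Q" by (rule PQ)
    show "id_skein (?u @ [x]) \<circle> M = M" by (rule Hom_id_comp[OF MH])
    show "Sp \<circle> M = H" by (simp add: Sp_def M_def H_def Hweb_def wid_comp)
    show "P2 \<circle> H = H \<circle> P2"
      unfolding P2_def H_def using wid_exchange[OF pH Hweb_Hom[of ?o], of "[]" "[]" "[]"] by simp
    show "M \<circle> H = (- qint 2) \<cdot> M"
      unfolding M_def H_def using wid_eq[OF mg_Hweb, of ?u x "[]"] by (simp del: skein.scale_minus_left)
    show "M \<circle> (H' \<circle> Sp) = id_skein (?u @ [x]) + U \<circle> V" if "qint c / qint (Suc c) \<noteq> 0"
    proof -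
      have c: "c \<noteq> 0" using that by (cases c) auto
      have "M \<circle> (H' \<circle> Sp) = wid (sg x a (c - 1)) (wid [?o] (mg ?o) [] \<circle> (wid [] (Hweb ?o) [?o] \<circle> wid [?o] (sp x) [])) []"
        unfolding M_def H'_def Sp_def cx[OF c, symmetric] by (simp add: wid_comp)
      also have "\<dots> = id_skein (?u @ [x]) + U \<circle> V"
        unfolding mg_Hweb_sp U_def V_def cx[OF c, symmetric] by (simp add: wid_add wid_comp)
      finally show ?thesis .
    qed
    show "V \<circle> (M \<circle> Q) = 0" if "qint c / qint (Suc c) \<noteq> 0"
    proof -
      have c: "c \<noteq> 0" using that by (cases c) auto
      \<comment> \<open>Compared with the word of the clasp, the bent strand adds a letter
        \<open>x\<close>, while two letters \<open>opp x\<close> are lost: one elementary step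
        down.\<close>
      have "below (sg x a (c - 1) @ [opp ?o]) ?s"
        by (rule belowI[of 1 0 _ x]) (use c in \<open>auto simp: sg_def\<close>)
      from strong_below_bend[OF p' HOL.refl Hom_comp[OF MH VH[OF c]] this] show ?thesis
        by (simp add: Q_def comp_skein_assoc)
    qed
    show "M \<circle> (H' \<circle> H) = M + U \<circle> (V \<circle> M)" if "qint c / qint (Suc c) \<noteq> 0"
    proof -
      have c: "c \<noteq> 0" using that by (cases c) auto
      have "M \<circle> (H' \<circle> H) = wid (sg x a (c - 1)) (wid [?o] (mg ?o) [] \<circle> (wid [] (Hweb ?o) [?o] \<circle> wid [?o] (Hweb ?o) [])) []"
        unfolding M_def H'_def H_def cx[OF c, symmetric] by (simp add: wid_comp)
      also have "\<dots> = M + U \<circle> (V \<circle> M)"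
        unfolding mg_Hweb_Hweb U_def V_def M_def cx[OF c, symmetric] by (simp add: wid_add wid_comp)
      finally show ?thesis .
    qed
    show "V \<circle> (Px \<circle> (M \<circle> (A0 \<circle> (B \<circle> Q)))) = 0"
      if nz: "qint c / qint (Suc c) \<noteq> 0" "qint a / (qint (Suc (Suc c)) * qint (a + Suc c + 2)) \<noteq> 0"
    proof -
      have c: "c \<noteq> 0" using nz by (cases c) auto
      obtain j where j: "a = Suc j" using nz(2) by (cases a) auto
      have A0H: "A0 \<in> Hom (sg x j (Suc c)) (?s @ [?o])"
        unfolding A0_def by (rule Hom_widI[OF alpha_Hom]) (auto simp: j sg_def replicate_append_same)
      have PxH: "Px \<in> Hom (?u @ [x]) (?u @ [x])"
        unfolding Px_def by (rule Hom_widI[OF pH]) auto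
      have "below (sg x a (c - 1)) (sg x j (Suc c))"
        by (rule belowI[of 1 0 _ x]) (use c in \<open>auto simp: sg_def j\<close>)
      from strong_below[OF p1[OF j] HOL.refl Hom_comp[OF A0H Hom_comp[OF MH Hom_comp[OF PxH VH[OF c]]]] this]
      have "V \<circle> (Px \<circle> (M \<circle> (A0 \<circle> (rclasp x j (Suc c) \<circle> (B \<circle> Q))))) = 0"
        by (simp flip: comp_skein_assoc)
      then show ?thesis using BQ[OF j] by simp
    qed
    show "B0 \<circle> H = B" if "qint a / (qint (Suc c) * qint (a + c + 2)) \<noteq> 0"
    proof -
      have "a \<noteq> 0" using that by (cases a) auto
      then show ?thesis
        unfolding B0_def B_def H_def by (simp add: x beta_simps wid_comp)
    qed
    show "A = H \<circle> A0" if "qint a / (qint (Suc (Suc c)) * qint (a + Suc c + 2)) \<noteq> 0"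
    proof -
      have "a \<noteq> 0" using that by (cases a) auto
      then show ?thesis
        unfolding A0_def A_def H_def by (simp add: x wid_comp)
    qed
    show "B0 \<circle> (P2 \<circle> (A \<circle> (B \<circle> Q))) = (qint (a - 1) / qint a - qint 2) \<cdot> (B \<circle> Q)"
      if nz: "qint a / (qint (Suc (Suc c)) * qint (a + Suc c + 2)) \<noteq> 0"
    proof -
      obtain j where j: "a = Suc j" using nz by (cases a) auto
      let ?p1 = "rclasp x j (Suc c)"
      have "B0 \<circle> (P2 \<circle> (A \<circle> (?p1 \<circle> (B \<circle> Q)))) = (B0 \<circle> (P2 \<circle> (A \<circle> ?p1))) \<circle> (B \<circle> Q)"
        by (simp add: comp_skein_assoc)
      also have "B0 \<circle> (P2 \<circle> (A \<circle> ?p1)) = (qint j / qint (Suc j) - qint 2) \<cdot> ?p1"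
        using twisted_trace[OF p2[unfolded j] p1[OF j] e[OF j] e'[OF j]]
        by (simp add: B0_def P2_def A_def p_def j)
      finally show ?thesis using BQ[OF j] by (simp add: j)
    qed
  qed (rule last_merge_numbers)+
  then show ?thesis
    by (simp add: M_def Q_def H_def A_def B_def wid_comp comp_skein_assoc del: rclasp.simps(2) alpha.simps)
      (simp add: wid_comp comp_skein_assoc del: alpha.simps)
qed


subsection \<open>The last cap\<close>

text \<open>The plain term closes to a loop, \<open>[3]\<close>, and the H term to a bigon,
  \<open>-[2]\<close>; \<open>qint_three_times\<close> adds them up.\<close>

lemma partial_trace:
  assumes e: "strong (sg x j 0) (sclasp x j)"
  shows "wid (replicate j x) (cap x) [] \<circle> (wid [] (sclasp x (Suc j)) [opp x] \<circle> wid (replicate j x) (cup x) []) =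
    (qint (j + 3) / qint (Suc j)) \<cdot> sclasp x j"
proof -
  let ?w = "replicate j x" and ?o = "opp x"
  define p where "p = sclasp x j"
  define C where "C = wid ?w (cap x) []"
  define D where "D = wid ?w (cup x) []"
  define P where "P = wid [] p [x, ?o]"
  have pH: "p \<in> Hom ?w ?w" using strongD(1)[OF e] by (simp add: p_def sg_def)
  have CP: "C \<circle> P = p \<circle> C"
    unfolding C_def P_def using wid_exchange[OF pH piece_Hom(2)[of x], of "[]" "[]" "[]"] by simp
  have PD: "P \<circle> D = D \<circle> p"
    unfolding D_def P_def using wid_exchange[OF pH piece_Hom(1)[of x], of "[]" "[]" "[]"] by simp
  have CD: "C \<circle> D = qint 3 \<cdot> id_skein ?w"
    unfolding C_def D_def using wid_eq[OF loop[of x], of ?w "[]"] by simp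
  have H: "(qint j / qint (Suc j)) \<cdot> (C \<circle> (wid (replicate (j - 1) x) (Hweb x) [?o] \<circle> D)) = (qint j / qint (Suc j)) \<cdot> ((- qint 2) \<cdot> id_skein ?w)"
  proof (cases j)
    case (Suc i)
    have "C \<circle> (wid (replicate (j - 1) x) (Hweb x) [?o] \<circle> D) =
        wid (replicate i x) (wid [x] (cap x) [] \<circle> (wid [] (Hweb x) [?o] \<circle> wid [x] (cup x) [])) []"
      unfolding C_def D_def by (simp add: Suc wid_comp)
    then show ?thesis
      by (simp add: trace_Hweb Suc del: skein.scale_minus_left)
  qed simp
  have "C \<circle> (wid [] (sclasp x (Suc j)) [?o] \<circle> D) = C \<circle> (P \<circle> D) +
      (qint j / qint (Suc j)) \<cdot> (C \<circle> (P \<circle> (wid (replicate (j - 1) x) (Hweb x) [?o] \<circle> (P \<circle> D))))"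
    by (simp add: P_def p_def wid_add wid_comp comp_add_left comp_add_right comp_skein_assoc)
  also have "C \<circle> (P \<circle> D) = qint 3 \<cdot> p"
    using comp_eq_absorb[OF CD, of p] by (simp add: PD Hom_id_comp[OF pH])
  also have "C \<circle> (P \<circle> (wid (replicate (j - 1) x) (Hweb x) [?o] \<circle> (P \<circle> D))) =
      p \<circle> ((C \<circle> (wid (replicate (j - 1) x) (Hweb x) [?o] \<circle> D)) \<circle> p)"
    using comp_eq_extend[OF CP] by (simp add: PD comp_skein_assoc)
  also have "(qint j / qint (Suc j)) \<cdot> (p \<circle> ((C \<circle> (wid (replicate (j - 1) x) (Hweb x) [?o] \<circle> D)) \<circle> p)) =
      p \<circle> (((qint j / qint (Suc j)) \<cdot> (C \<circle> (wid (replicate (j - 1) x) (Hweb x) [?o] \<circle> D))) \<circle> p)"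
    by simp
  also have "\<dots> = (qint j / qint (Suc j) * (- qint 2)) \<cdot> p"
    unfolding H using strong_idem[OF e, folded p_def] by (simp add: Hom_id_comp[OF pH] del: skein.scale_minus_left)
  also have "qint 3 \<cdot> p + \<dots> = (qint 3 + qint j / qint (Suc j) * (- qint 2)) \<cdot> p"
    by (simp only: skein.scale_left_distrib)
  also have "qint 3 + qint j / qint (Suc j) * (- qint 2) = qint (j + 3) / qint (Suc j)"
    using qint_three_times[of j] by (simp add: field_simps)
  finally show ?thesis
    unfolding C_def D_def p_def .
qed

text \<open>The coefficient \<open>[j+1]/[j+3]\<close> is the inverse of the partial trace, so under
  the cap the correction term reproduces \<open>C \<circle> Q\<close> and cancels it.\<close>

lemma last_cap:
  assumes e: "strong (sg x j 0) (sclasp x j)" and e': "strong (sg x (Suc j) 0) (sclasp x (Suc j))"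
  shows "wid (replicate j x) (cap x) [] \<circle> rclasp x (Suc j) (Suc 0) = 0"
proof -
  let ?w = "replicate j x" and ?o = "opp x"
  define C where "C = wid ?w (cap x) []"
  define D where "D = wid ?w (cup x) []"
  define Q where "Q = wid [] (sclasp x (Suc j)) [?o]"
  have pH: "sclasp x j \<in> Hom ?w ?w" using strongD(1)[OF e] by (simp add: sg_def)
  have CP: "C \<circle> wid [] (sclasp x j) [x, ?o] = sclasp x j \<circle> C"
    unfolding C_def using wid_exchange[OF pH piece_Hom(2)[of x], of "[]" "[]" "[]"] by simp
  have "wid [] (sclasp x j) [x] \<circle> sclasp x (Suc j) = sclasp x (Suc j)"
    by (rule strong_absorb_strong[OF e]) (use e' in \<open>simp add: sg_def replicate_append_same\<close>)
  from arg_cong[OF this, of "\<lambda>f. wid [] f [?o]"]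
  have PQ: "wid [] (sclasp x j) [x, ?o] \<circle> Q = Q"
    by (simp add: Q_def wid_comp del: sclasp.simps)
  have "sclasp x j \<circle> (C \<circle> Q) = C \<circle> Q"
    using comp_eq_extend[OF CP, of Q] by (simp add: PQ)
  moreover have "C \<circle> (Q \<circle> D) = (qint (j + 3) / qint (Suc j)) \<cdot> sclasp x j"
    unfolding C_def D_def Q_def by (rule partial_trace[OF e])
  then have "C \<circle> (Q \<circle> (D \<circle> (C \<circle> Q))) = (qint (j + 3) / qint (Suc j)) \<cdot> (sclasp x j \<circle> (C \<circle> Q))"
    by (simp flip: comp_skein_assoc)
  moreover have "rclasp x (Suc j) (Suc 0) = Q - (qint (Suc j) / qint (j + 3)) \<cdot> (Q \<circle> (D \<circle> (C \<circle> Q)))"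
    by (simp add: Q_def C_def D_def beta_simps wid_comp comp_skein_assoc numeral_3_eq_3 del: sclasp.simps)
  ultimately have "C \<circle> rclasp x (Suc j) (Suc 0) = C \<circle> Q - (qint (Suc j) / qint (j + 3) * (qint (j + 3) / qint (Suc j))) \<cdot> (C \<circle> Q)"
    by (simp add: comp_diff_right)
  then show ?thesis by (simp add: C_def)
qed


subsection \<open>The recursion yields strong clasps\<close>

lemma starts_down_mono:
  assumes "starts_down s u f" "starts_down s s (q - id_skein s)" "f \<in> Hom s u"
  shows "starts_down s u (f \<circle> q)"
  using starts_down.add[OF assms(1) starts_down_comp[OF assms(2,3)]] Hom_comp_id[OF assms(3)]
  by (simp add: comp_diff_right)

lemma starts_down_Hweb: "starts_down (l @ [y, y] @ r) (l @ [y, y] @ r) (wid l (Hweb y) r)"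
  using starts_down.mg[of "l @ [y, y] @ r" l y r "wid l (sp (opp y)) r"] Hom_wid[OF cap_opp_Hom(4), of l y r]
  by (simp add: Hweb_def wid_comp)

lemma starts_down_beta: "starts_down (x # opp x # replicate n (opp x)) (replicate n (opp x)) (beta x n)"
proof (cases n)
  case 0
  then show ?thesis
    using starts_down.cap[of "[x, opp x]" "[]" x "[]" "id_skein []" "[]"] Hom_id_comp[OF piece_Hom(2)[of x]]
    by (simp add: beta_simps)
next
  case (Suc m)
  have "wid [] (beta x m) [opp x] \<in> Hom ((x # replicate m (opp x)) @ [opp x, opp x] @ []) (replicate n (opp x))"
    by (rule Hom_widI[OF beta_Hom]) (auto simp: Suc replicate_append_same)
  from starts_down_comp[OF starts_down_Hweb this] show ?thesis
    by (simp add: Suc beta_simps)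
qed

text \<open>Caps and merges that avoid the last letter act on \<open>p\<close>, which
  \<open>P\<close> contains as its top factor. Only those at the end have to be assumed.\<close>

lemma kills_snoc:
  assumes "kills s p" "wid [] p [y] \<circle> P = P"
    and "\<And>l z. s @ [y] = l @ [z, opp z] \<Longrightarrow> wid l (cap z) [] \<circle> P = 0"
    and "\<And>l z. s @ [y] = l @ [z, z] \<Longrightarrow> wid l (mg z) [] \<circle> P = 0"
  shows "kills (s @ [y]) P"
  unfolding kills_def
proof (intro allI conjI impI)
  fix l z r
  show "wid l (cap z) r \<circle> P = 0" if e: "s @ [y] = l @ [z, opp z] @ r"
  proof (cases r rule: rev_cases)
    case Nil
    then show ?thesis using assms(3) e by simp
  next
    case (snoc r' y')
    with e have "s = l @ [z, opp z] @ r'" "y' = y" by simp_all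
    then have "wid l (cap z) r \<circle> wid [] p [y] = 0"
      using arg_cong[OF killsD(1)[OF assms(1)], of l z r' "\<lambda>f. wid [] f [y]"] by (simp add: wid_comp snoc)
    then show ?thesis
      using assms(2) by (metis comp_skein_assoc comp_zero(1))
  qed
  show "wid l (mg z) r \<circle> P = 0" if e: "s @ [y] = l @ [z, z] @ r"
  proof (cases r rule: rev_cases)
    case Nil
    then show ?thesis using assms(4) e by simp
  next
    case (snoc r' y')
    with e have "s = l @ [z, z] @ r'" "y' = y" by simp_all
    then have "wid l (mg z) r \<circle> wid [] p [y] = 0"
      using arg_cong[OF killsD(2)[OF assms(1)], of l z r' "\<lambda>f. wid [] f [y]"] by (simp add: wid_comp snoc)
    then show ?thesis
      using assms(2) by (metis comp_skein_assoc comp_zero(1))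
  qed
qed

text \<open>\<open>Q\<close> is idempotent and stands on top of every term, so only the last two
  letters are new. They carry a cap if \<open>b = 0\<close> and a merge if \<open>b > 0\<close>,
  never both.\<close>

lemma strong_rclasp_Suc:
  assumes p: "strong (sg x a b) (rclasp x a b)"
    and cap: "\<And>j. b = 0 \<Longrightarrow> a = Suc j \<Longrightarrow> wid (replicate j x) (cap x) [] \<circle> rclasp x a (Suc b) = 0"
    and mg: "\<And>c. b = Suc c \<Longrightarrow> wid (sg x a c) (mg (opp x)) [] \<circle> rclasp x a (Suc b) = 0"
  shows "strong (sg x a (Suc b)) (rclasp x a (Suc b))"
proof -
  let ?s = "sg x a (Suc b)"
  define Q where "Q = wid [] (rclasp x a b) [opp x]"
  define H where "H = (qint b / qint (Suc b)) \<cdot> wid (sg x a (b - 1)) (Hweb (opp x)) []"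
  define X where "X = (qint a / (qint (Suc b) * qint (a + b + 2))) \<cdot> wid (replicate (a - 1) x) (alpha x b \<circle> beta x b) []"
  define P where "P = rclasp x a (Suc b)"
  have P: "P = Q + Q \<circle> (H \<circle> Q) - Q \<circle> (X \<circle> Q)"
    by (simp add: P_def Q_def H_def X_def)
  have s: "?s = sg x a b @ [opp x]" by (simp add: sg_Suc)
  have QH: "Q \<in> Hom ?s ?s" unfolding Q_def s using Hom_wid[OF strongD(1)[OF p], of "[]" "[opp x]"] by simp
  have Qd: "starts_down ?s ?s (Q - id_skein ?s)"
    using starts_down_wid[OF strongD(3)[OF p], of "[opp x]"] by (simp add: s Q_def wid_diff)
  have H: "H \<in> Hom ?s ?s \<and> starts_down ?s ?s H"
  proof (cases b)
    case 0
    then show ?thesis by (simp add: H_def starts_down.zero)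
  next
    case (Suc c)
    have w: "?s = sg x a c @ [opp x, opp x] @ []" by (simp add: Suc sg_Suc)
    show ?thesis
      unfolding H_def Suc diff_Suc_1 w[unfolded Suc]
      by (intro conjI Hom_scale starts_down_scale starts_down_Hweb Hom_wid[OF Hweb_Hom])
  qed
  have X: "X \<in> Hom ?s ?s \<and> starts_down ?s ?s X"
  proof (cases a)
    case 0
    then show ?thesis by (simp add: X_def starts_down.zero)
  next
    case (Suc j)
    have w: "?s = replicate j x @ (x # opp x # replicate b (opp x)) @ []" by (simp add: Suc sg_def)
    show ?thesis
      unfolding X_def Suc diff_Suc_1 w[unfolded Suc]
      by (intro conjI Hom_scale starts_down_scale Hom_wid starts_down_widen Hom_comp[OF beta_Hom alpha_Hom]
          starts_down_comp[OF starts_down_beta alpha_Hom])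
  qed
  have PH: "P \<in> Hom ?s ?s"
    unfolding P using QH H X by (auto intro!: Hom_comp)
  have QQ: "Q \<circle> Q = Q"
    unfolding Q_def by (rule wid_idem[OF strong_idem[OF p]])
  have QP: "Q \<circle> P = P"
    unfolding P by (simp add: comp_add_right comp_diff_right QQ flip: comp_skein_assoc)
  have "kills (sg x a b @ [opp x]) P"
  proof (rule kills_snoc[OF strongD(2)[OF p] QP[unfolded Q_def]])
    fix l z assume e: "sg x a b @ [opp x] = l @ [z, opp z]"
    then have z: "z = x" "sg x a b = l @ [x]" by auto
    have b: "b = 0" using z(2) by (cases b) (auto simp: sg_Suc)
    then obtain j where j: "a = Suc j" using z(2) by (cases a) (auto simp: sg_def)
    have "replicate j x @ [x] = l @ [x]"
      using z(2) by (simp add: b j sg_def)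
    then have "l = replicate j x"
      by (simp only: append_same_eq)
    then show "wid l (cap z) [] \<circle> P = 0"
      using cap[OF b j] by (simp add: P_def z del: rclasp.simps)
  next
    fix l z assume e: "sg x a b @ [opp x] = l @ [z, z]"
    then have z: "z = opp x" "sg x a b = l @ [opp x]" by auto
    obtain c where b: "b = Suc c"
    proof (cases b)
      case 0
      then have "opp x \<in> set (replicate a x)" using z(2) by (simp add: sg_def)
      then show ?thesis by simp
    qed
    then have "l = sg x a c" using z(2) by (simp add: sg_Suc)
    then show "wid l (mg z) [] \<circle> P = 0"
      using mg[OF b] by (simp add: P_def z del: rclasp.simps)
  qed
  moreover have "starts_down ?s ?s (P - id_skein ?s)"
  proof -
    have "P - id_skein ?s = (Q - id_skein ?s) + Q \<circle> (H \<circle> Q) + (- 1) \<cdot> (Q \<circle> (X \<circle> Q))"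
      by (simp add: P)
    moreover have "starts_down ?s ?s (Q \<circle> (H \<circle> Q))" "starts_down ?s ?s (Q \<circle> (X \<circle> Q))"
      using H X QH Qd by (auto intro!: starts_down_comp[OF starts_down_mono])
    ultimately show ?thesis
      using Qd by (simp only: starts_down.add starts_down_scale)
  qed
  moreover have "flip_skein Q = Q" "flip_skein H = H" "flip_skein X = X"
    by (simp_all add: Q_def H_def X_def flip_wid flip_scale flip_comp flip_alpha strongD(4)[OF p] del: rclasp.simps)
  then have "flip_skein P = P"
    unfolding P by (simp add: flip_add flip_diff flip_comp comp_skein_assoc)
  ultimately show ?thesis
    using PH unfolding strong_def s P_def by blast
qed

text \<open>Induction on the length for both signs at once, since \<open>last_merge\<close> needs
  shorter words with the segments exchanged. A word of equal letters is read as
  \<open>sg (opp x) 0 a\<close>, so every non-empty word falls under the recursive step.\<close>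

theorem strong_rclasp: "strong (sg x a b) (rclasp x a b)"
proof (induction "a + b" arbitrary: x a b rule: less_induct)
  case less
  have step: "strong (sg y c (Suc d)) (rclasp y c (Suc d))" if cd: "c + Suc d \<le> a + b" for y c d
  proof (cases "c + Suc d = a + b")
    case False
    then show ?thesis using less[of c "Suc d" y] cd by simp
  next
    case True
    have IH: "strong (sg z m n) (rclasp z m n)" if "m + n \<le> c + d" for z m n
      using less[of m n z] that True by simp
    show ?thesis
    proof (rule strong_rclasp_Suc[OF IH])
      fix j assume dj: "d = 0" "c = Suc j"
      show "wid (replicate j y) (cap y) [] \<circle> rclasp y c (Suc d) = 0"
        using last_cap[of y j] IH[of j 0 y] IH[of "Suc j" 0 y] by (simp add: dj del: rclasp.simps(2))
    next
      fix k assume dk: "d = Suc k"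
      show "wid (sg y c k) (mg (opp y)) [] \<circle> rclasp y c (Suc d) = 0"
        unfolding dk by (rule last_merge) (auto intro!: IH simp: dk simp del: rclasp.simps)
    qed simp
  qed
  show ?case
  proof (cases b)
    case (Suc d)
    then show ?thesis using step[of a d x] by simp
  next
    case b: 0
    show ?thesis
    proof (cases a)
      case 0
      have "kills [] (id_skein [])" by (simp add: kills_def)
      then show ?thesis
        by (simp add: b 0 sg_def strong_def starts_down.zero)
    next
      case (Suc j)
      have "rclasp x a 0 = rclasp (opp x) 0 a"
        using sclasp_eq_rclasp[of "opp x" a] by (simp del: sclasp.simps)
      then show ?thesis
        using step[of 0 j "opp x"] by (simp add: b Suc sg_zero del: sclasp.simps rclasp.simps)
    qed
  qed
qed

section \<open>Evaluation of webs in the tensor powers of the vector representation\<close>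

datatype state = S1 | S2 | S3

text \<open>Cup and cap carry the same weight, the square root of the usual pivotal one, so a loop
  receives the sum of the squares, \<open>[3]\<close>.\<close>

primrec state_weight :: "sgn \<Rightarrow> state \<Rightarrow> K"
  where
    "state_weight x S1 = (if x = Pos then q_half else inverse q_half)"
  | "state_weight x S2 = 1"
  | "state_weight x S3 = (if x = Pos then inverse q_half else q_half)"

text \<open>
  State \<open>i\<close> of a strand \<open>opp x\<close> is dual to state \<open>i\<close> of \<open>x\<close>, so a vertex with legs in the states
  \<open>i\<close>, \<open>j\<close>, \<open>k\<close> is an entry of the quantum determinant. It is normalised so that bending its legs
  along cups with the symmetric weights above gives the splits.
\<close>

fun vertex_coef :: "sgn \<Rightarrow> state \<Rightarrow> state \<Rightarrow> state \<Rightarrow> K"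
  where
    "vertex_coef x S1 S2 S3 = 1"
  | "vertex_coef x S2 S3 S1 = 1"
  | "vertex_coef x S3 S1 S2 = state_weight x S3"
  | "vertex_coef x S2 S1 S3 = - state_weight x S3"
  | "vertex_coef x S3 S2 S1 = - state_weight x S3"
  | "vertex_coef x S1 S3 S2 = - 1"
  | "vertex_coef x _ _ _ = 0"

fun piece_coef :: "piece \<Rightarrow> state list \<Rightarrow> state list \<Rightarrow> K"
  where
    "piece_coef (Cup x) [i, j] [] = (if i = j then state_weight x i else 0)"
  | "piece_coef (Cap x) [] [i, j] = (if i = j then state_weight x i else 0)"
  | "piece_coef (Merge x) [k] [i, j] = vertex_coef x i j k"
  | "piece_coef (Split x) [k, j] [i] = vertex_coef x i j k * state_weight x j"
  | "piece_coef _ _ _ = 0"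

primrec sum_states :: "nat \<Rightarrow> (state list \<Rightarrow> K) \<Rightarrow> K"
  where
    "sum_states 0 F = F []"
  | "sum_states (Suc n) F = sum_states n (\<lambda>l. F (S1 # l)) + sum_states n (\<lambda>l. F (S2 # l)) + sum_states n (\<lambda>l. F (S3 # l))"

lemma sum_states_add: "sum_states n (\<lambda>i. F i + G i) = sum_states n F + sum_states n G"
  by (induction n arbitrary: F G) (simp_all add: algebra_simps)

lemma sum_states_mult: "sum_states n (\<lambda>i. c * F i) = c * sum_states n F"
  by (induction n arbitrary: F) (simp_all add: algebra_simps)

lemma sum_states_zero [simp]: "sum_states n (\<lambda>i. 0) = 0"
  by (induction n) simp_all

lemma sum_states_cong: "(\<And>i. length i = n \<Longrightarrow> F i = G i) \<Longrightarrow> sum_states n F = sum_states n G"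
proof (induction n arbitrary: F G)
  case (Suc n)
  have "sum_states n (\<lambda>l. F (a # l)) = sum_states n (\<lambda>l. G (a # l))" for a
    by (rule Suc.IH) (simp add: Suc.prems)
  then show ?case by simp
qed simp

lemma sum_states_swap: "sum_states n (\<lambda>i. sum_states m (\<lambda>j. G i j)) = sum_states m (\<lambda>j. sum_states n (\<lambda>i. G i j))"
  by (induction n arbitrary: G) (simp_all add: sum_states_add)

text \<open>A vector is its coefficient function on state lists. Words are not recorded, only the
  number \<open>n\<close> of strands to the left; values at lists of the wrong length have no
  meaning until \<open>rep\<close> sets them to 0.\<close>

definition act :: "nat \<Rightarrow> piece \<Rightarrow> (state list \<Rightarrow> K) \<Rightarrow> state list \<Rightarrow> K"
  where "act n p f t = sum_states (length (piece_bot p))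
    (\<lambda>i. piece_coef p (take (length (piece_top p)) (drop n t)) i * f (take n t @ i @ drop (n + length (piece_top p)) t))"

primrec acts :: "slice list \<Rightarrow> (state list \<Rightarrow> K) \<Rightarrow> state list \<Rightarrow> K"
  where
    "acts [] f = f"
  | "acts (d # ds) f = acts ds (act (length (fst d)) (fst (snd d)) f)"

lemma act_append:
  assumes "length a = n" "length u = length (piece_top p)"
  shows "act n p f (a @ u @ b) = sum_states (length (piece_bot p)) (\<lambda>i. piece_coef p u i * f (a @ i @ b))"
  using assms by (simp add: act_def)

lemma acts_append: "acts (ds @ es) f = acts es (acts ds f)"
  by (induction ds arbitrary: f) simp_all

lemma length_split: "length t = m + n \<Longrightarrow> \<exists>a b. t = a @ b \<and> length a = m \<and> length b = n"
  by (rule exI[of _ "take m t"], rule exI[of _ "drop m t"]) simp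

lemma length_split_Suc:
  assumes "length t = m + Suc n"
  obtains a i b where "t = a @ i # b" "length a = m"
  using length_split[OF assms] by (auto simp: length_Suc_conv)

lemma length_split_Suc_Suc:
  assumes "length t = m + Suc (Suc n)"
  obtains a i j b where "t = a @ i # j # b" "length a = m"
  using length_split[OF assms] by (auto simp: length_Suc_conv)

lemma act_cong:
  assumes "\<And>t. length t = length (l @ piece_bot p @ r) \<Longrightarrow> f t = g t"
    and "length t = length (l @ piece_top p @ r)"
  shows "act (length l) p f t = act (length l) p g t"
  unfolding act_def by (rule sum_states_cong) (use assms in simp)

lemma acts_cong:
  assumes "is_diagram s ds t" "\<And>i. length i = length s \<Longrightarrow> f i = g i" "length j = length t"
  shows "acts ds f j = acts ds g j"
  using assms
proof (induction s ds t arbitrary: f g rule: is_diagram.induct)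
  case (2 s l p r ds t)
  have "act (length l) p f i = act (length l) p g i" if "length i = length (l @ piece_top p @ r)" for i
    by (rule act_cong[OF _ that]) (use 2(2,3) in auto)
  then have "acts ds (act (length l) p f) j = acts ds (act (length l) p g) j"
    by (intro 2(1)) (use 2(2,4) in auto)
  then show ?case by simp
qed simp

lemma act_sum:
  "act n p (\<lambda>i. \<Sum>v\<in>A. c v * g v i) t = (\<Sum>v\<in>A. c v * act n p (g v) t)"
proof (induction A rule: infinite_finite_induct)
  case (insert v A)
  have "act n p (\<lambda>i. c v * g v i + (\<Sum>v\<in>A. c v * g v i)) t = c v * act n p (g v) t + act n p (\<lambda>i. \<Sum>v\<in>A. c v * g v i) t"
    unfolding act_def by (simp add: distrib_left sum_states_add sum_states_mult[symmetric] mult.left_commute)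
  then show ?case using insert by simp
qed (simp_all add: act_def)

lemma acts_sum:
  "acts ds (\<lambda>i. \<Sum>v\<in>A. c v * g v i) t = (\<Sum>v\<in>A. c v * acts ds (g v) t)"
proof (induction ds arbitrary: g)
  case (Cons d ds)
  have "act (length (fst d)) (fst (snd d)) (\<lambda>i. \<Sum>v\<in>A. c v * g v i) = (\<lambda>t. \<Sum>v\<in>A. c v * act (length (fst d)) (fst (snd d)) (g v) t)"
    by (rule ext) (rule act_sum)
  then show ?case by (simp add: Cons)
qed simp

lemma q_half_cancel [simp]:
  "q_half * (inverse q_half * z) = z" "inverse q_half * (q_half * z) = z"
  by (simp_all flip: mult.assoc)

lemma state_weight_opp: "state_weight x i * state_weight (opp x) i = 1" "state_weight (opp x) i * state_weight x i = 1"
  by (cases i; cases x; simp)+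

text \<open>\<open>Split\<close> is defined by bending a leg around the right side. This identity
  says that bending around the left side gives the same coefficients.\<close>

lemma vertex_coef_rotate: "vertex_coef x k i j * state_weight (opp x) k = vertex_coef x i j k * state_weight x j"
  by (cases i; cases j; cases k; cases x; simp)

lemma act_exchange:
  assumes "length t = length (l @ piece_top p @ m @ piece_top p' @ r)"
  shows "act (length (l @ piece_top p @ m)) p' (act (length l) p f) t =
    act (length l) p (act (length (l @ piece_bot p @ m)) p' f) t"
proof -
  obtain a u c u' b where t: "t = a @ u @ c @ u' @ b" "length a = length l" "length u = length (piece_top p)"
      "length c = length m" "length u' = length (piece_top p')"
    using assms by (auto dest!: length_split)
  have "act (length (l @ piece_top p @ m)) p' (act (length l) p f) t =
      sum_states (length (piece_bot p')) (\<lambda>j. piece_coef p' u' j * sum_states (length (piece_bot p)) (\<lambda>i. piece_coef p u i * f (a @ i @ c @ j @ b)))"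
    using act_append[of "a @ u @ c" "length (l @ piece_top p @ m)" u' p' _ b] t
    by (simp add: act_append)
  also have "\<dots> = sum_states (length (piece_bot p)) (\<lambda>i. sum_states (length (piece_bot p')) (\<lambda>j. piece_coef p u i * (piece_coef p' u' j * f (a @ i @ c @ j @ b))))"
    by (simp add: sum_states_mult[symmetric] sum_states_swap[of "length (piece_bot p')"] mult.left_commute)
  also have "\<dots> = sum_states (length (piece_bot p)) (\<lambda>i. piece_coef p u i * act (length (l @ piece_bot p @ m)) p' f (a @ i @ c @ u' @ b))"
  proof (rule sum_states_cong)
    fix i :: "state list" assume "length i = length (piece_bot p)"
    then have "act (length (l @ piece_bot p @ m)) p' f (a @ i @ c @ u' @ b) = sum_states (length (piece_bot p')) (\<lambda>j. piece_coef p' u' j * f (a @ i @ c @ j @ b))"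
      using act_append[of "a @ i @ c" "length (l @ piece_bot p @ m)" u' p' f b] t by simp
    then show "sum_states (length (piece_bot p')) (\<lambda>j. piece_coef p u i * (piece_coef p' u' j * f (a @ i @ c @ j @ b))) =
        piece_coef p u i * act (length (l @ piece_bot p @ m)) p' f (a @ i @ c @ u' @ b)"
      by (simp add: sum_states_mult)
  qed
  also have "\<dots> = act (length l) p (act (length (l @ piece_bot p @ m)) p' f) t"
    using t by (simp add: act_append)
  finally show ?thesis .
qed

lemma act_Cup: "length a = n \<Longrightarrow> act n (Cup x) f (a @ i # j # b) = (if i = j then state_weight x i * f (a @ b) else 0)"
  using act_append[of a n "[i, j]" "Cup x" f b] by simp

lemma act_Cap: "length a = n \<Longrightarrow> act n (Cap x) f (a @ b) =
    state_weight x S1 * f (a @ S1 # S1 # b) + state_weight x S2 * f (a @ S2 # S2 # b) + state_weight x S3 * f (a @ S3 # S3 # b)"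
  using act_append[of a n "[]" "Cap x" f b] by simp

lemma act_Merge: "length a = n \<Longrightarrow> act n (Merge x) f (a @ k # b) =
    sum_states 2 (\<lambda>i. piece_coef (Merge x) [k] i * f (a @ i @ b))"
  using act_append[of a n "[k]" "Merge x" f b] by (simp add: numeral_2_eq_2)

lemma act_Split: "length a = n \<Longrightarrow> act n (Split x) f (a @ k # j # b) =
    vertex_coef x S1 j k * state_weight x j * f (a @ S1 # b) + vertex_coef x S2 j k * state_weight x j * f (a @ S2 # b) + vertex_coef x S3 j k * state_weight x j * f (a @ S3 # b)"
  using act_append[of a n "[k, j]" "Split x" f b] by simp

lemma act_move:
  assumes "isotopy_move ds es" "is_diagram u ds v" "is_diagram u es v" "length t = length v"
  shows "acts ds f t = acts es f t"
  using assms
proof (induction rule: isotopy_move.induct)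
  case (exchange l p m p' r)
  then show ?case using act_exchange[of t l p m p' r f] by auto
next
  case (zigzag_right l x r)
  then have "length t = length l + Suc (length r)" by auto
  then obtain a i b where t: "t = a @ i # b" "length a = length l" by (rule length_split_Suc)
  have "act (length l) (Cap x) g t = state_weight x S1 * g ((a @ [S1]) @ S1 # i # b) + state_weight x S2 * g ((a @ [S2]) @ S2 # i # b) + state_weight x S3 * g ((a @ [S3]) @ S3 # i # b)" for g
    using act_Cap[of a "length l" x g "i # b"] t by simp
  then show ?case
    using t act_Cup[of "a @ [_]" "Suc (length l)" "opp x" f] state_weight_opp[of x i]
    by (cases i) (simp_all flip: mult.assoc)
next
  case (zigzag_left l x r)
  then have "length t = length l + Suc (length r)" by auto
  then obtain a i b where t: "t = a @ i # b" "length a = length l" by (rule length_split_Suc)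
  have "act (Suc (length l)) (Cap (opp x)) g t = state_weight (opp x) S1 * g (a @ i # S1 # S1 # b) + state_weight (opp x) S2 * g (a @ i # S2 # S2 # b) + state_weight (opp x) S3 * g (a @ i # S3 # S3 # b)" for g
    using act_Cap[of "a @ [i]" "Suc (length l)" "opp x" g b] t by simp
  then show ?case
    using t act_Cup[of a "length l" x f] state_weight_opp[of x i]
    by (cases i) (simp_all flip: mult.assoc)
next
  case (bend_right l x r)
  then have "length t = length l + Suc (Suc (length r))" by auto
  then obtain a k j b where t: "t = a @ k # j # b" "length a = length l" by (rule length_split_Suc_Suc)
  have "act (length l) (Merge x) (act (Suc (length l)) (Cup x) f) t =
      sum_states 2 (\<lambda>i. piece_coef (Merge x) [k] i * act (Suc (length l)) (Cup x) f (a @ i @ j # b))"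
    using act_Merge[of a "length l" x _ k "j # b"] t by simp
  moreover have "act (Suc (length l)) (Cup x) f (a @ [i, i'] @ j # b) = (if i' = j then state_weight x i' * f (a @ i # b) else 0)" for i i'
    using act_Cup[of "a @ [i]" "Suc (length l)" x f i' j b] t by simp
  ultimately show ?case
    using t act_Split[of a "length l" x f k j b] by (cases j) (simp_all add: numeral_2_eq_2)
next
  case (bend_left l x r)
  then have "length t = length l + Suc (Suc (length r))" by auto
  then obtain a k j b where t: "t = a @ k # j # b" "length a = length l" by (rule length_split_Suc_Suc)
  have R: "vertex_coef x k i j * (state_weight (opp x) k * z) = vertex_coef x i j k * state_weight x j * z" for i z
    using vertex_coef_rotate[of x k i j] by (simp flip: mult.assoc)
  have "act (Suc (length l)) (Merge x) (act (length l) (Cup (opp x)) f) t =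
      sum_states 2 (\<lambda>i. piece_coef (Merge x) [j] i * act (length l) (Cup (opp x)) f (a @ k # i @ b))"
    using act_Merge[of "a @ [k]" "Suc (length l)" x _ j b] t by simp
  moreover have "act (length l) (Cup (opp x)) f (a @ k # [i, i'] @ b) = (if k = i then state_weight (opp x) k * f (a @ i' # b) else 0)" for i i'
    using act_Cup[of a "length l" "opp x" f k i "i' # b"] t by simp
  ultimately have "act (Suc (length l)) (Merge x) (act (length l) (Cup (opp x)) f) t =
      vertex_coef x k S1 j * (state_weight (opp x) k * f (a @ S1 # b)) + vertex_coef x k S2 j * (state_weight (opp x) k * f (a @ S2 # b)) +
      vertex_coef x k S3 j * (state_weight (opp x) k * f (a @ S3 # b))"
    by (cases k) (simp_all add: numeral_2_eq_2 del: vertex_coef.simps state_weight.simps)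
  then show ?case
    using t act_Split[of a "length l" x f k j b] by (simp add: R del: vertex_coef.simps state_weight.simps)
qed

lemma acts_isotopic:
  assumes "isotopic d d'"
  shows "\<forall>f t. length t = length (snd (snd d)) \<longrightarrow> acts (fst (snd d)) f t = acts (fst (snd d')) f t"
  using assms
proof (induction)
  case (move ds es s us vs t)
  obtain u v where uv: "is_diagram s us u" "is_diagram u ds v" "is_diagram v vs t"
    using move(2) by (auto simp: is_diagram_append)
  obtain u' v' where uv': "is_diagram s us u'" "is_diagram u' es v'" "is_diagram v' vs t"
    using move(3) by (auto simp: is_diagram_append)
  have det: "is_diagram s ds u \<Longrightarrow> is_diagram s ds v \<Longrightarrow> u = v" for s ds u v
    by (induction s ds u rule: is_diagram.induct) auto
  have e: "u' = u" "v' = v"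
    using det uv(1) uv'(1) det[OF is_diagram_flip[OF uv(3)] is_diagram_flip[OF uv'(3)]] by auto
  have "acts vs (acts ds (acts us f)) i = acts vs (acts es (acts us f)) i" if "length i = length t" for f i
    by (rule acts_cong[OF uv(3) _ that], rule act_move[OF move(1) uv(2)]) (use uv'(2) e in simp_all)
  then show ?case by (simp add: acts_append)
next
  case (sym d d')
  have "snd (snd d) = snd (snd d')" using isotopicD[OF sym.hyps] by blast
  with sym.IH show ?case by metis
next
  case (trans d d' d'')
  have "snd (snd d) = snd (snd d')" using isotopicD[OF trans.hyps(1)] by blast
  with trans.IH show ?case by metis
qed simp

lift_definition rep :: "web \<Rightarrow> (state list \<Rightarrow> K) \<Rightarrow> state list \<Rightarrow> K" is
  "\<lambda>(s, ds, t) f i. if length i = length t then acts ds f i else 0"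
proof -
  fix d d' :: diagram
  assume iso: "isotopic d d'"
  then have "snd (snd d) = snd (snd d')" using isotopicD by blast
  then show "(case d of (s, ds, t) \<Rightarrow> \<lambda>f i. if length i = length t then acts ds f i else 0) =
      (case d' of (s, ds, t) \<Rightarrow> \<lambda>f i. if length i = length t then acts ds f i else 0)"
    using acts_isotopic[OF iso] by (auto simp: fun_eq_iff case_prod_beta)
qed

lemma rep_web_of: "is_diagram s ds t \<Longrightarrow> rep (web_of s ds t) f i = (if length i = length t then acts ds f i else 0)"
  by (simp add: web_of_def isotopic_self rep.abs_eq)

lemma rep_stack:
  assumes "web_bot w = web_top v"
  shows "rep (stack w v) f i = rep w (rep v f) i"
proof -
  obtain s ds t where w: "is_diagram s ds t" "w = web_of s ds t" by (rule web_cases)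
  obtain s' es t' where v: "is_diagram s' es t'" "v = web_of s' es t'" by (rule web_cases)
  have e: "t' = s" using assms w v by auto
  have d: "is_diagram s' (es @ ds) t" using is_diagram_appendI[OF v(1)] w(1) e by simp
  have "acts ds (acts es f) i = acts ds (rep v f) i" if "length i = length t"
    by (rule acts_cong[OF w(1) _ that]) (use rep_web_of[OF v(1)] v(2) e in simp)
  then show ?thesis
    using stack_web_of[OF v(1), of ds t] w(1) by (simp add: w(2) v(2) e rep_web_of[OF d] rep_web_of[OF w(1)] acts_append)
qed

lemma acts_widen_left:
  assumes "is_diagram s ds t" "length i = length t"
  shows "acts (widen [] u ds) f (i @ j) = acts ds (\<lambda>k. f (k @ j)) i"
  using assms
proof (induction s ds t arbitrary: f rule: is_diagram.induct)
  case (2 s l p r ds t)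
  have d: "is_diagram (l @ piece_top p @ r) ds t" using 2(2) by simp
  have "acts (widen [] u ((l, p, r) # ds)) f (i @ j) = acts ds (\<lambda>k. act (length l) p f (k @ j)) i"
    using 2(1)[OF d 2(3)] by simp
  also have "\<dots> = acts ds (act (length l) p (\<lambda>k. f (k @ j))) i"
    by (rule acts_cong[OF d _ 2(3)]) (simp add: act_def)
  finally show ?case by simp
qed simp

lemma acts_widen_right:
  assumes "is_diagram s ds t" "length i = length t" "length j = length u"
  shows "acts (widen u [] ds) f (j @ i) = acts ds (\<lambda>k. f (j @ k)) i"
  using assms
proof (induction s ds t arbitrary: f rule: is_diagram.induct)
  case (2 s l p r ds t)
  have d: "is_diagram (l @ piece_top p @ r) ds t" using 2(2) by simp
  have "acts (widen u [] ((l, p, r) # ds)) f (j @ i) = acts ds (\<lambda>k. act (length (u @ l)) p f (j @ k)) i"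
    using 2(1)[OF d 2(3,4)] by simp
  also have "\<dots> = acts ds (act (length l) p (\<lambda>k. f (j @ k))) i"
    by (rule acts_cong[OF d _ 2(3)]) (simp add: act_def 2(4))
  finally show ?case by simp
qed simp

lemma rep_juxt:
  assumes "length i = length (web_top w)"
  shows "rep (juxt w v) f (i @ j) = rep v (\<lambda>k. rep w (\<lambda>k'. f (k' @ k)) i) j"
proof -
  obtain s ds t where w: "is_diagram s ds t" "w = web_of s ds t" by (rule web_cases)
  obtain s' es t' where v: "is_diagram s' es t'" "v = web_of s' es t'" by (rule web_cases)
  have i: "length i = length t" using assms w by simp
  have "acts (widen t [] es) (acts (widen [] s' ds) f) (i @ j) = acts es (\<lambda>k. rep w (\<lambda>k'. f (k' @ k)) i) j"
    if j: "length j = length t'"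
  proof -
    have "acts (widen t [] es) (acts (widen [] s' ds) f) (i @ j) = acts es (\<lambda>k. acts (widen [] s' ds) f (i @ k)) j"
      by (rule acts_widen_right[OF v(1) j i])
    also have "(\<lambda>k. acts (widen [] s' ds) f (i @ k)) = (\<lambda>k. rep w (\<lambda>k'. f (k' @ k)) i)"
      by (simp add: acts_widen_left[OF w(1) i] w(2) rep_web_of[OF w(1)] i)
    finally show ?thesis .
  qed
  then show ?thesis
    by (simp add: juxt_web_of[OF w(1) v(1)] w(2) v(2) rep_web_of[OF is_diagram_juxt[OF w(1) v(1)]] rep_web_of[OF v(1)] i acts_append)
qed

lemma rep_sum: "rep w (\<lambda>i. \<Sum>v\<in>A. c v * g v i) t = (\<Sum>v\<in>A. c v * rep w (g v) t)"
  by (cases w rule: web_cases) (simp add: rep_web_of acts_sum)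

lemma rep_zero [simp]: "rep w (\<lambda>i. 0) t = 0"
  using rep_sum[of w "\<lambda>_. 0" undefined "{}" t] by simp


subsection \<open>The evaluation respects the relations\<close>

definition ext :: "(web \<Rightarrow> K) \<Rightarrow> lin_web \<Rightarrow> K"
  where "ext g f = (\<Sum>w\<in>Poly_Mapping.keys f. Poly_Mapping.lookup f w * g w)"

lemma ext_superset: "finite A \<Longrightarrow> Poly_Mapping.keys f \<subseteq> A \<Longrightarrow> ext g f = (\<Sum>w\<in>A. Poly_Mapping.lookup f w * g w)"
  unfolding ext_def by (rule sum.mono_neutral_left) (auto simp: in_keys_iff)

lemma ext_zero [simp]: "ext g 0 = 0"
  by (simp add: ext_def)

lemma ext_add: "ext g (f + f') = ext g f + ext g f'"
  using ext_superset[of "Poly_Mapping.keys f \<union> Poly_Mapping.keys f'" _ g] Poly_Mapping.keys_add[of f f']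
  by (simp add: lookup_add distrib_right sum.distrib)

lemma ext_scale: "ext g (scale_lin c f) = c * ext g f"
proof -
  have "Poly_Mapping.keys (scale_lin c f) \<subseteq> Poly_Mapping.keys f"
    by (auto simp: in_keys_iff lookup_scale_lin)
  from ext_superset[OF _ this, of g] show ?thesis
    by (simp add: ext_def lookup_scale_lin sum_distrib_left mult.assoc)
qed

lemma ext_single [simp]: "ext g (Poly_Mapping.single w c) = c * g w"
  using ext_superset[of "{w}" "Poly_Mapping.single w c" g] by simp

lemma ext_diff: "ext g (f - f') = ext g f - ext g f'"
  using ext_add[of g f "scale_lin (- 1) f'"] ext_scale[of g "- 1" f'] by (simp add: scale_lin_minus)

lemma ext_sum: "ext g (\<Sum>x\<in>A. h x) = (\<Sum>x\<in>A. ext g (h x))"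
  by (induction A rule: infinite_finite_induct) (simp_all add: ext_add)

lemma ext_stack: "ext g (stack_lin f f') =
    (\<Sum>w\<in>Poly_Mapping.keys f. \<Sum>v\<in>Poly_Mapping.keys f'. if web_bot w = web_top v
      then Poly_Mapping.lookup f w * Poly_Mapping.lookup f' v * g (stack w v) else 0)"
  unfolding stack_lin_def ext_sum by (intro sum.cong HOL.refl) simp

lemma ext_juxt: "ext g (juxt_lin f f') =
    (\<Sum>w\<in>Poly_Mapping.keys f. \<Sum>v\<in>Poly_Mapping.keys f'.
      Poly_Mapping.lookup f w * Poly_Mapping.lookup f' v * g (juxt w v))"
  unfolding juxt_lin_def ext_sum by (intro sum.cong HOL.refl) simp

definition entry :: "sword \<Rightarrow> sword \<Rightarrow> (state list \<Rightarrow> K) \<Rightarrow> state list \<Rightarrow> web \<Rightarrow> K"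
  where "entry s t f i w = (if web_bot w = s \<and> web_top w = t then rep w f i else 0)"

text \<open>The vector \<open>g\<close> is arbitrary and not just a basis vector, so that a factor
  stacked below can be absorbed into it.\<close>

definition negligible :: "lin_web \<Rightarrow> bool"
  where "negligible f \<longleftrightarrow> (\<forall>s t g i. ext (entry s t g i) f = 0)"

lemma negligible_stack_below: "negligible f \<Longrightarrow> negligible (stack_lin f f')"
  unfolding negligible_def
proof (intro allI)
  fix s t :: sword and g and i :: "state list"
  assume f: "\<forall>s t g i. ext (entry s t g i) f = 0"
  have "ext (entry s t g i) (stack_lin f f') = (\<Sum>v\<in>Poly_Mapping.keys f'. \<Sum>w\<in>Poly_Mapping.keys f. if web_bot w = web_top v
      then Poly_Mapping.lookup f w * Poly_Mapping.lookup f' v * entry s t g i (stack w v) else 0)"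
    unfolding ext_stack by (rule sum.swap)
  also have "\<dots> = (\<Sum>v\<in>Poly_Mapping.keys f'. (if web_bot v = s then Poly_Mapping.lookup f' v else 0) * ext (entry (web_top v) t (rep v g) i) f)"
    unfolding ext_def sum_distrib_left
    by (intro sum.cong HOL.refl) (auto simp: entry_def web_ends_stack rep_stack)
  finally show "ext (entry s t g i) (stack_lin f f') = 0"
    using f by simp
qed

lemma negligible_stack_above: "negligible f \<Longrightarrow> negligible (stack_lin f' f)"
  unfolding negligible_def
proof (intro allI)
  fix s t :: sword and g and i :: "state list"
  assume f: "\<forall>s t g i. ext (entry s t g i) f = 0"
  have "ext (entry s t g i) (stack_lin f' f) = (\<Sum>w\<in>Poly_Mapping.keys f'. (if web_top w = t then Poly_Mapping.lookup f' w else 0) *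
      rep w (\<lambda>j. ext (entry s (web_bot w) g j) f) i)"
    unfolding ext_stack
  proof (intro sum.cong HOL.refl)
    fix w
    have e: "ext (entry s (web_bot w) g j) f = (\<Sum>v\<in>Poly_Mapping.keys f. (if web_bot v = s \<and> web_top v = web_bot w then Poly_Mapping.lookup f v else 0) * rep v g j)" for j
      unfolding ext_def by (intro sum.cong HOL.refl) (simp add: entry_def)
    show "(\<Sum>v\<in>Poly_Mapping.keys f. if web_bot w = web_top v
      then Poly_Mapping.lookup f' w * Poly_Mapping.lookup f v * entry s t g i (stack w v) else 0) =
      (if web_top w = t then Poly_Mapping.lookup f' w else 0) * rep w (\<lambda>j. ext (entry s (web_bot w) g j) f) i"
      unfolding e rep_sum sum_distrib_left
      by (intro sum.cong HOL.refl) (auto simp: entry_def web_ends_stack rep_stack)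
  qed
  moreover have "rep w (\<lambda>j. ext (entry s (web_bot w) g j) f) i = 0" for w
    using f by simp
  ultimately show "ext (entry s t g i) (stack_lin f' f) = 0" by simp
qed

text \<open>The left web alone fixes where words and states are cut. The condition then splits into
  one on \<open>v\<close> and one on \<open>w\<close>, as needed for summing over \<open>v\<close>
  with \<open>w\<close> fixed.\<close>

lemma entry_juxt:
  "entry s t g i (juxt w v) =
    (if web_top v = drop (length (web_top w)) t \<and> web_bot v = drop (length (web_bot w)) s \<and>
        web_top w = take (length (web_top w)) t \<and> web_bot w = take (length (web_bot w)) s \<and> length i = length t
     then rep v (\<lambda>k. rep w (\<lambda>k'. g (k' @ k)) (take (length (web_top w)) i)) (drop (length (web_top w)) i) else 0)"
proof -
  have len: "length i \<noteq> length (web_top w) + length (web_top v) \<Longrightarrow> rep (juxt w v) g i = 0"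
    by (cases w rule: web_cases; cases v rule: web_cases) (simp add: juxt_web_of rep_web_of is_diagram_juxt)
  have eq: "web_top w @ web_top v = t \<longleftrightarrow> web_top v = drop (length (web_top w)) t \<and> web_top w = take (length (web_top w)) t"
    "web_bot w @ web_bot v = s \<longleftrightarrow> web_bot v = drop (length (web_bot w)) s \<and> web_bot w = take (length (web_bot w)) s"
    by (metis append_eq_conv_conj)+
  show ?thesis
  proof (cases "web_bot w @ web_bot v = s \<and> web_top w @ web_top v = t \<and> length i = length t")
    case True
    then have "length i = length (web_top w) + length (web_top v)" by auto
    then obtain a b where i: "i = a @ b" "length a = length (web_top w)"
      using length_split by blast
    then show ?thesis
      using True eq rep_juxt[OF i(2), of v g b] by (simp add: entry_def)
  next
    case False
    then show ?thesis
      using eq len by (auto simp: entry_def)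
  qed
qed

lemma negligible_juxt_right: "negligible f \<Longrightarrow> negligible (juxt_lin f' f)"
  unfolding negligible_def
proof (intro allI)
  fix s t :: sword and g and i :: "state list"
  assume f: "\<forall>s t g i. ext (entry s t g i) f = 0"
  let ?c = "\<lambda>w. web_top w = take (length (web_top w)) t \<and> web_bot w = take (length (web_bot w)) s \<and> length i = length t"
  have "ext (entry s t g i) (juxt_lin f' f) = (\<Sum>w\<in>Poly_Mapping.keys f'. (if ?c w then Poly_Mapping.lookup f' w else 0) *
      ext (entry (drop (length (web_bot w)) s) (drop (length (web_top w)) t)
        (\<lambda>k. rep w (\<lambda>k'. g (k' @ k)) (take (length (web_top w)) i)) (drop (length (web_top w)) i)) f)"
    unfolding ext_juxt unfolding ext_def sum_distrib_left
    by (intro sum.cong HOL.refl) (simp add: entry_juxt, simp add: entry_def)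
  then show "ext (entry s t g i) (juxt_lin f' f) = 0" using f by simp
qed

text \<open>The sum now runs over the left web, so the right one fixes the cut, measured from the
  end of the words.\<close>

lemma negligible_juxt_left: "negligible f \<Longrightarrow> negligible (juxt_lin f f')"
  unfolding negligible_def
proof (intro allI)
  fix s t :: sword and g and i :: "state list"
  assume f: "\<forall>s t g i. ext (entry s t g i) f = 0"
  let ?t = "\<lambda>v. take (length t - length (web_top v)) t" and ?s = "\<lambda>v. take (length s - length (web_bot v)) s"
  let ?i = "\<lambda>v. take (length t - length (web_top v)) i" and ?j = "\<lambda>v. drop (length t - length (web_top v)) i"
  let ?c = "\<lambda>v. t = ?t v @ web_top v \<and> s = ?s v @ web_bot v \<and> length i = length t"
  have "ext (entry s t g i) (juxt_lin f f') = (\<Sum>v\<in>Poly_Mapping.keys f'. \<Sum>w\<in>Poly_Mapping.keys f.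
      Poly_Mapping.lookup f w * Poly_Mapping.lookup f' v * entry s t g i (juxt w v))"
    unfolding ext_juxt by (rule sum.swap)
  also have "\<dots> = (\<Sum>v\<in>Poly_Mapping.keys f'. (if ?c v then Poly_Mapping.lookup f' v else 0) *
      rep v (\<lambda>k. ext (entry (?s v) (?t v) (\<lambda>k'. g (k' @ k)) (?i v)) f) (?j v))"
  proof (intro sum.cong HOL.refl)
    fix v
    have e: "ext (entry (?s v) (?t v) (\<lambda>k'. g (k' @ k)) (?i v)) f =
        (\<Sum>w\<in>Poly_Mapping.keys f. (if web_bot w = ?s v \<and> web_top w = ?t v then Poly_Mapping.lookup f w else 0) * rep w (\<lambda>k'. g (k' @ k)) (?i v))" for k
      unfolding ext_def by (intro sum.cong HOL.refl) (simp add: entry_def)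
    have w: "Poly_Mapping.lookup f w * Poly_Mapping.lookup f' v * entry s t g i (juxt w v) =
        (if ?c v then Poly_Mapping.lookup f' v else 0) *
        ((if web_bot w = ?s v \<and> web_top w = ?t v then Poly_Mapping.lookup f w else 0) * rep v (\<lambda>k. rep w (\<lambda>k'. g (k' @ k)) (?i v)) (?j v))" for w
    proof (cases "s = web_bot w @ web_bot v \<and> t = web_top w @ web_top v \<and> length i = length t")
      case True
      then show ?thesis by (auto simp: entry_juxt)
    next
      case False
      then have "entry s t g i (juxt w v) = 0"
        unfolding entry_juxt by (metis append_take_drop_id)
      moreover have "\<not> (?c v \<and> web_bot w = ?s v \<and> web_top w = ?t v)"
        using False by metis
      ultimately show ?thesis by auto
    qed
    show "(\<Sum>w\<in>Poly_Mapping.keys f. Poly_Mapping.lookup f w * Poly_Mapping.lookup f' v * entry s t g i (juxt w v)) =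
        (if ?c v then Poly_Mapping.lookup f' v else 0) *
        rep v (\<lambda>k. ext (entry (?s v) (?t v) (\<lambda>k'. g (k' @ k)) (?i v)) f) (?j v)"
      unfolding e rep_sum w sum_distrib_left ..
  qed
  also have "\<dots> = 0"
    using f by simp
  finally show "ext (entry s t g i) (juxt_lin f f') = 0" .
qed

lemma qint_two: "qint 2 = q_half + inverse q_half"
  using q_half_diff by (simp add: qint_def field_simps power2_eq_square)

lemma qint_three: "qint 3 = q_half * q_half + 1 + inverse q_half * inverse q_half"
proof -
  have "qint 2 * qint 2 = qint 3 + 1"
    using qint_two_times[of 1] by (simp add: numeral_2_eq_2 numeral_3_eq_3)
  then show ?thesis
    unfolding qint_two by (simp add: algebra_simps)
qed

lemma loop_web_web_of: "loop_web x = web_of [] [([], Cup x, []), ([], Cap x, [])] []"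
  by (simp add: loop_web_def piece_web_web_of stack_web_of)

lemma bigon_web_web_of: "bigon_web x = web_of [x] [([], Split x, []), ([], Merge (opp x), [])] [x]"
  by (simp add: bigon_web_def piece_web_web_of stack_web_of)

lemma rung_web_web_of: "rung_web x = web_of [x, opp x] [([], Split x, [opp x]), ([opp x], Merge (opp x), [])] [opp x, x]"
  by (simp add: rung_web_def piece_web_web_of id_web_web_of juxt_web_of stack_web_of)

lemma square_web_web_of: "square_web x = web_of [x, opp x] [([], Split x, [opp x]), ([opp x], Merge (opp x), []),
    ([], Split (opp x), [x]), ([x], Merge x, [])] [x, opp x]"
  by (simp add: square_web_def rung_web_web_of stack_web_of)

lemma cup_cap_web_of: "stack (piece_web (Cup x)) (piece_web (Cap x)) = web_of [x, opp x] [([], Cap x, []), ([], Cup x, [])] [x, opp x]"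
  by (simp add: piece_web_web_of stack_web_of)

lemma act0: "act 0 (Cup x) f (i # j # b) = (if i = j then state_weight x i * f b else 0)"
  "act 0 (Cap x) f b = state_weight x S1 * f (S1 # S1 # b) + state_weight x S2 * f (S2 # S2 # b) + state_weight x S3 * f (S3 # S3 # b)"
  "act 0 (Merge x) f (k # b) = sum_states 2 (\<lambda>i. piece_coef (Merge x) [k] i * f (i @ b))"
  "act 0 (Split x) f (k # j # b) = vertex_coef x S1 j k * state_weight x j * f (S1 # b) + vertex_coef x S2 j k * state_weight x j * f (S2 # b) + vertex_coef x S3 j k * state_weight x j * f (S3 # b)"
  "act (Suc 0) (Merge x) f (a # k # b) = sum_states 2 (\<lambda>i. piece_coef (Merge x) [k] i * f (a # i @ b))"
  using act_Cup[of "[]" 0 x f i j b] act_Cap[of "[]" 0 x f b] act_Merge[of "[]" 0 x f k b] act_Split[of "[]" 0 x f k j b]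
    act_Merge[of "[a]" "Suc 0" x f k b] by simp_all

lemma web_relations_negligible: "f \<in> web_relations \<Longrightarrow> negligible f"
proof (induction rule: web_relations.induct)
  case (loop x)
  have "rep (loop_web x) g [] = qint 3 * rep (id_web []) g []" for g
    by (cases x) (simp_all add: loop_web_web_of id_web_web_of rep_web_of act0 qint_three algebra_simps)
  then show ?case
    by (auto simp: negligible_def ext_diff entry_def loop_web_web_of id_web_web_of rep_web_of)
next
  case (bigon x)
  have "rep (bigon_web x) g [i] = - qint 2 * rep (id_web [x]) g [i]" for g i
    by (cases x; cases i) (simp_all add: bigon_web_web_of id_web_web_of rep_web_of act0 qint_two[unfolded numeral_2_eq_2] numeral_2_eq_2 algebra_simps)
  then show ?case
    by (auto simp: negligible_def ext_diff entry_def bigon_web_web_of id_web_web_of rep_web_of length_Suc_conv)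
next
  case (square x)
  have "rep (square_web x) g [i, j] = rep (id_web [x, opp x]) g [i, j] + rep (stack (piece_web (Cup x)) (piece_web (Cap x))) g [i, j]" for g i j
    by (cases x; cases i; cases j) (simp_all add: square_web_web_of id_web_web_of cup_cap_web_of rep_web_of act0 numeral_2_eq_2 algebra_simps)
  then show ?case
    by (auto simp: negligible_def ext_diff ext_add entry_def square_web_web_of id_web_web_of cup_cap_web_of rep_web_of length_Suc_conv)
next
  case (stack_above f g)
  show ?case by (rule negligible_stack_above[OF stack_above.IH])
next
  case (stack_below f g)
  show ?case by (rule negligible_stack_below[OF stack_below.IH])
next
  case (juxt_left f g)
  show ?case by (rule negligible_juxt_right[OF juxt_left.IH])
next
  case (juxt_right f g)
  show ?case by (rule negligible_juxt_left[OF juxt_right.IH])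
qed (simp_all add: negligible_def ext_add ext_scale)

text \<open>Highest weight vectors: in the dual representation this is the dual of the lowest state
  \<open>S3\<close>.\<close>

primrec top_state :: "sgn \<Rightarrow> state"
  where
    "top_state Pos = S1"
  | "top_state Neg = S3"

definition top_vector :: "sword \<Rightarrow> state list \<Rightarrow> K"
  where "top_vector s i = (if i = map top_state s then 1 else 0)"

lift_definition top_entry :: "sword \<Rightarrow> skein \<Rightarrow> K" is
  "\<lambda>s f. ext (entry s s (top_vector s) (map top_state s)) f"
proof -
  fix s :: sword and f g :: lin_web
  assume "f - g \<in> web_relations"
  then have "ext (entry s s (top_vector s) (map top_state s)) (f - g) = 0"
    using web_relations_negligible by (simp add: negligible_def)
  then show "ext (entry s s (top_vector s) (map top_state s)) f = ext (entry s s (top_vector s) (map top_state s)) g"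
    by (simp add: ext_diff)
qed

lemma top_entry_zero [simp]: "top_entry s 0 = 0"
  and top_entry_add: "top_entry s (f + g) = top_entry s f + top_entry s g"
  and top_entry_diff: "top_entry s (f - g) = top_entry s f - top_entry s g"
  and top_entry_scale: "top_entry s (c \<cdot> f) = c * top_entry s f"
proof -
  show "top_entry s 0 = 0" by transfer simp
  show "top_entry s (f + g) = top_entry s f + top_entry s g" by transfer (simp add: ext_add)
  show "top_entry s (f - g) = top_entry s f - top_entry s g" by transfer (simp add: ext_diff)
  show "top_entry s (c \<cdot> f) = c * top_entry s f" by transfer (simp add: ext_scale)
qed

lemma top_entry_web_class: "top_entry s (web_class w) = entry s s (top_vector s) (map top_state s) w"
  by (simp add: web_class_def top_entry.abs_eq)

lemma top_entry_id: "top_entry s (id_skein s) = 1"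
  by (simp add: id_skein_def top_entry_web_class entry_def id_web_web_of rep_web_of top_vector_def)

lemma top_entry_comp_zero:
  assumes "f \<in> Hom t s" "is_diagram s [(l, p, r)] t"
    and z: "\<And>i. length i = length t \<Longrightarrow> act (length l) p (top_vector s) i = 0"
  shows "top_entry s (f \<circle> wid l (piece_skein p) r) = 0"
  using assms(1)
proof (induction rule: Hom_induct)
  case (web w)
  let ?v = "web_of s [(l, p, r)] t"
  have "rep ?v (top_vector s) = (\<lambda>i. 0)"
    using z by (simp add: fun_eq_iff rep_web_of[OF assms(2)])
  then have "rep w (rep ?v (top_vector s)) j = 0" for j
    by simp
  then show ?case
    using web by (simp add: web_class_web_of_single[OF assms(2), symmetric] comp_web_class top_entry_web_class
        entry_def rep_stack web_top_web_of[OF assms(2)])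
qed (simp_all add: comp_add_left top_entry_add top_entry_scale)

text \<open>A cap asks for equal states on letters of opposite sign, where the top states are
  \<open>S1\<close> and \<open>S3\<close>; a merge vanishes on two equal states. The lowest piece
  therefore annihilates the top vector.\<close>

lemma top_entry_starts_down: "starts_down s s f \<Longrightarrow> top_entry s f = 0"
proof (induction rule: starts_down.induct)
  case (cap l x r f)
  have "act (length l) (Cap x) (top_vector s) i = 0" if "length i = length (l @ r)" for i
  proof -
    have "length i = length l + length r" using that by simp
    then obtain a b where i: "i = a @ b" "length a = length l"
      using length_split by blast
    show ?thesis
      unfolding i(1) act_Cap[OF i(2)] using i(2) cap(1)
      by (cases x) (auto simp: top_vector_def)
  qed
  then show ?case
    by (intro top_entry_comp_zero[OF cap(2)]) (auto simp: cap(1))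
next
  case (mg l x r f)
  have "act (length l) (Merge x) (top_vector s) i = 0" if "length i = length (l @ [opp x] @ r)" for i
  proof -
    have "length i = length l + Suc (length r)" using that by simp
    then obtain a k b where i: "i = a @ k # b" "length a = length l" by (rule length_split_Suc)
    show ?thesis
      unfolding i(1) act_Merge[OF i(2)] using i(2) mg(1)
      by (cases x) (auto simp: top_vector_def numeral_2_eq_2)
  qed
  then show ?case
    by (intro top_entry_comp_zero[OF mg(2)]) (auto simp: mg(1))
qed (simp_all add: top_entry_add)

lemma strong_nonzero: "strong s p \<Longrightarrow> p \<noteq> 0"
  using top_entry_starts_down[OF strongD(3), of s p] top_entry_id[of s] by (auto simp: top_entry_diff)


section \<open>The clasps\<close>

theorem clasp_sg: "clasp (sg x a b) = rclasp x a b"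
  by (rule clasp_eq_strong[OF strong_rclasp HOL.refl strong_nonzero[OF strong_rclasp]])

lemma H_minus_Hweb: "web_class H_minus = Hweb Neg"
  by (simp add: H_minus_def Hweb_def piece_skein_def web_class_stack)

lemma sweep_up_ends [simp]: "web_bot (sweep_up n) = replicate (Suc n) Neg" "web_top (sweep_up n) = replicate (Suc n) Neg"
  and H_minus_ends [simp]: "web_bot H_minus = [Neg, Neg]" "web_top H_minus = [Neg, Neg]"
proof -
  show H: "web_bot H_minus = [Neg, Neg]" "web_top H_minus = [Neg, Neg]"
    by (simp_all add: H_minus_def web_ends_stack)
  have "web_bot (sweep_up n) = replicate (Suc n) Neg \<and> web_top (sweep_up n) = replicate (Suc n) Neg"
    by (induction n) (auto simp: web_ends_stack H replicate_append_same)
  then show "web_bot (sweep_up n) = replicate (Suc n) Neg" "web_top (sweep_up n) = replicate (Suc n) Neg" by auto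
qed

lemma alpha_web_ends: "web_bot (alpha_web n) = replicate n Neg"
  by (simp add: alpha_web_def web_ends_stack)

text \<open>In the web one cup lies below the whole sweep, whereas \<open>alpha\<close> adds one
  strand with its crossing at a time; separating the last crossing of the sweep matches the
  two.\<close>

lemma web_class_alpha: "web_class (alpha_web n) = alpha Pos n"
proof -
  have a: "web_class (alpha_web n) = wid [Pos] (web_class (sweep_up n)) [] \<circle> wid [] (cup Pos) (replicate n Neg)" for n
    unfolding alpha_web_def
    by (subst web_class_stack) (simp_all add: web_class_juxt wid_def piece_skein_def id_skein_def[symmetric])
  have s: "web_class (sweep_up (Suc n)) = wid (replicate n Neg) (Hweb Neg) [] \<circle> wid [] (web_class (sweep_up n)) [Neg]" for n
    unfolding sweep_up.simps
    by (subst web_class_stack)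
      (simp_all add: web_class_juxt wid_def id_skein_def[symmetric] H_minus_Hweb replicate_append_same)
  show ?thesis
  proof (induction n)
    case 0
    have "cup Pos \<in> Hom [] [Pos, Neg]" using piece_Hom(1)[of Pos] by simp
    then show ?case
      unfolding a by (simp add: id_skein_def[symmetric] Hom_id_comp)
  next
    case (Suc n)
    have "wid [Pos] (web_class (sweep_up n)) [Neg] \<circle> wid [] (cup Pos) (Neg # replicate n Neg) = wid [] (alpha Pos n) [Neg]"
      unfolding Suc[symmetric] a by (simp add: wid_comp replicate_append_same)
    then show ?case
      unfolding a s by (simp add: wid_comp comp_skein_assoc replicate_append_same)
  qed
qed

lemma flip_H_minus: "flip_web H_minus = H_minus"
  by (simp add: H_minus_def flip_web_stack)

lemma flip_sweep_up: "flip_web (sweep_up n) = sweep_down n"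
  by (induction n) (simp_all add: flip_web_stack flip_web_juxt flip_H_minus replicate_append_same)

lemma beta_web_alpha_web: "beta_web n = flip_web (alpha_web n)"
  unfolding beta_web_def alpha_web_def
  by (simp add: flip_web_stack flip_web_juxt flip_sweep_up)

lemma web_class_X: "web_class (X_web b) = alpha Pos (b - 1) \<circle> beta Pos (b - 1)"
  unfolding X_web_def
  by (subst web_class_stack)
    (simp_all add: beta_web_alpha_web alpha_web_ends web_class_alpha beta_def flip: flip_web_class)

theorem theorem3p3:
  fixes a b :: nat and Q :: skein
  assumes "a \<ge> 1" and "b \<ge> 1"
  defines "Q \<equiv> clasp (seg a (b - 1)) \<otimes> id_skein [Neg]"
  shows "clasp (seg a b) =
    Q + (if b = 1 then 0 else
          (qint (b - 1) / qint b) \<cdot>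
            (Q \<circle> (id_skein (seg a (b - 2)) \<otimes> web_class H_minus) \<circle> Q))
      - (qint a / (qint b * qint (a + b + 1))) \<cdot>
            (Q \<circle> (id_skein (seg (a - 1) 0) \<otimes> web_class (X_web b)) \<circle> Q)"
proof -
  obtain c where b: "b = Suc c"
    using assms(2) by (cases b) auto
  have seg: "seg m n = sg Pos m n" for m n
    by (simp add: seg_def sg_def)
  have Q: "Q = wid [] (rclasp Pos a c) [Neg]"
    unfolding Q_def by (simp add: seg clasp_sg wid_def b)
  have H: "id_skein (seg a (b - 2)) \<otimes> web_class H_minus = wid (sg Pos a (c - 1)) (Hweb Neg) []"
    by (simp add: wid_def seg H_minus_Hweb b)
  have X: "id_skein (seg (a - 1) 0) \<otimes> web_class (X_web b) = wid (replicate (a - 1) Pos) (alpha Pos c \<circle> beta Pos c) []"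
    by (simp add: wid_def web_class_X b seg_def)
  \<comment> \<open>For \<open>b = 1\<close> the H term of \<open>rclasp\<close> has the coefficient
    \<open>qint 0\<close>, in agreement with the absent term.\<close>
  show ?thesis
    unfolding H X Q by (simp add: b seg clasp_sg comp_skein_assoc)
qed

end
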